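(* Let $d\ge1$ and let $T^d=\mathbb R^d/\mathbb Z^d$ be the smooth $d$-dimensional torus, with a fixed basis $(\chi_1,\dots,\chi_d)$ of $H_1(T^d,\mathbb Z)$ and dual basis of closed $1$-forms $(\alpha_1,\dots,\alpha_d)$. Let $h$ and $h_0$ be flat Riemannian metrics on $T^d$ with the same ground state spectrum, i.e. $$\lambda_1\Big(T^d,h,\tfrac1n(\alpha_j+\alpha_k)\Big)=\lambda_1\Big(T^d,h_0,\tfrac1n(\alpha_j+\alpha_k)\Big)\quad\text{for all }1\le j\le k\le d\text{ and all positive integers }n .$$ Then $(T^d,h)$ and $(T^d,h_0)$ are isometric.
   Context: For a smooth real $1$-form $A$ on a compact Riemannian manifold $(M,h)$ without boundary, $\lambda_1(M,h,A)$ denotes the lowest eigenvalue of the magnetic Laplacian $\Delta_A=(d^A)^*d^A$, where $d^Au=du-iuA$; i.e. $$\lambda_1(M,h,A)=\min_{0\neq u\in C^\infty(M,\mathbb C)}\frac{\int_M|du-iuA|_h^2\,dv_h}{\int_M|u|^2dv_h}.$$ The dual basis is defined by $\int_{\chi_j}\alpha_k=\delta_{jk}$; it is determined up to exact forms, which do not affect $\lambda_1$, and is chosen independently of the metric. *)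

theory Defs
  imports "HOL-Analysis.Analysis" "HOL-Homology.Homology"
begin

section \<open>Smooth maps between normed spaces\<close>

text \<open>Both notions are intended for open \<open>S\<close> only. For a finite-dimensional domain, continuity of
  all iterated directional derivatives gives the usual classes \<open>C\<^sup>k\<close>.\<close>

primrec Ck_on ::
  "nat \<Rightarrow> 'a::real_normed_vector set \<Rightarrow> ('a \<Rightarrow> 'b::real_normed_vector) \<Rightarrow> bool"
where
  "Ck_on 0 S f \<longleftrightarrow> continuous_on S f"
| "Ck_on (Suc k) S f \<longleftrightarrow>
     (\<forall>x\<in>S. f differentiable (at x)) \<and> (\<forall>v. Ck_on k S (\<lambda>x. frechet_derivative f (at x) v))"

definition smooth_on :: "'a::real_normed_vector set \<Rightarrow> ('a \<Rightarrow> 'b::real_normed_vector) \<Rightarrow> bool"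
  where "smooth_on S f \<longleftrightarrow> (\<forall>k. Ck_on k S f)"

section \<open>The torus\<close>

quotient_type (overloaded) 'n torus = "real ^ ('n::finite)" / "\<lambda>x y. \<forall>i. x $ i - y $ i \<in> \<int>"
  morphisms torus_rep torus_proj
proof (rule equivpI)
  show "reflp (\<lambda>(x::real^'n) y. \<forall>i. x $ i - y $ i \<in> \<int>)"
    by (simp add: reflp_def)
  show "symp (\<lambda>(x::real^'n) y. \<forall>i. x $ i - y $ i \<in> \<int>)"
    unfolding symp_def by (metis Ints_minus minus_diff_eq)
  show "transp (\<lambda>(x::real^'n) y. \<forall>i. x $ i - y $ i \<in> \<int>)"
    unfolding transp_def
  proof (intro allI impI)
    fix x y z :: "real^'n" and i
    assume "\<forall>i. x $ i - y $ i \<in> \<int>" "\<forall>i. y $ i - z $ i \<in> \<int>"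
    then have "(x $ i - y $ i) + (y $ i - z $ i) \<in> \<int>"
      by (intro Ints_add) auto
    then show "x $ i - z $ i \<in> \<int>" by simp
  qed
qed

instantiation torus :: (finite) topological_space
begin

definition open_torus :: "'a torus set \<Rightarrow> bool"
  where "open_torus U \<longleftrightarrow> open (torus_proj -` U)"

instance
  by standard (auto simp: open_torus_def vimage_Union)

end

text \<open>Tensor fields on the torus are given by their components in the global frame
  \<open>\<partial>/\<partial>x\<^sub>i\<close> (or \<open>dx\<^sub>i\<close>) inherited from \<open>\<real>\<^sup>d\<close>;
  \<open>tpull\<close> yields the corresponding \<open>\<int>\<^sup>d\<close>-periodic field on \<open>\<real>\<^sup>d\<close>.\<close>

definition tpull :: "('n::finite torus \<Rightarrow> 'b) \<Rightarrow> real ^ 'n \<Rightarrow> 'b"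
  where "tpull f x = f (torus_proj x)"

definition torus_smooth :: "('n::finite torus \<Rightarrow> 'b::real_normed_vector) \<Rightarrow> bool"
  where "torus_smooth f \<longleftrightarrow> smooth_on UNIV (tpull f)"

definition tpartial ::
  "('n::finite torus \<Rightarrow> 'b::real_normed_vector) \<Rightarrow> 'n \<Rightarrow> real ^ 'n \<Rightarrow> 'b"
  where "tpartial f i x = frechet_derivative (tpull f) (at x) (axis i 1)"

definition closed_one_form :: "('n::finite torus \<Rightarrow> real ^ 'n) \<Rightarrow> bool"
  where "closed_one_form a \<longleftrightarrow> torus_smooth a \<and>
    (\<forall>x i j. tpartial (\<lambda>p. a p $ j) i x = tpartial (\<lambda>p. a p $ i) j x)"

section \<open>Riemannian metrics on the torus\<close>

definition riemannian_metric :: "('n::finite torus \<Rightarrow> real ^ 'n ^ 'n) \<Rightarrow> bool"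
  where "riemannian_metric h \<longleftrightarrow> torus_smooth h \<and>
    (\<forall>p. transpose (h p) = h p \<and> (\<forall>v. v \<noteq> 0 \<longrightarrow> v \<bullet> (h p *v v) > 0))"

text \<open>Flat means locally isometric to Euclidean space. The pullback condition makes the
  differential of \<open>F\<close> invertible, so \<open>F\<close> is a diffeomorphism of \<open>U\<close> onto an open set.\<close>

definition flat_metric :: "('n::finite torus \<Rightarrow> real ^ 'n ^ 'n) \<Rightarrow> bool"
  where "flat_metric h \<longleftrightarrow> riemannian_metric h \<and>
    (\<forall>x. \<exists>U (F :: real ^ 'n \<Rightarrow> real ^ 'n). open U \<and> x \<in> U \<and> smooth_on U F \<and> inj_on F U \<and>
      (\<forall>y\<in>U. \<forall>v w. frechet_derivative F (at y) v \<bullet> frechet_derivative F (at y) w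
                    = v \<bullet> (tpull h y *v w)))"

definition torus_lift ::
  "('n::finite torus \<Rightarrow> 'n torus) \<Rightarrow> (real ^ 'n) set \<Rightarrow> (real ^ 'n \<Rightarrow> real ^ 'n) \<Rightarrow> bool"
  where "torus_lift \<phi> U \<Phi> \<longleftrightarrow>
    open U \<and> smooth_on U \<Phi> \<and> (\<forall>y\<in>U. \<phi> (torus_proj y) = torus_proj (\<Phi> y))"

definition torus_smooth_map :: "('n::finite torus \<Rightarrow> 'n torus) \<Rightarrow> bool"
  where "torus_smooth_map \<phi> \<longleftrightarrow> (\<forall>x. \<exists>U \<Phi>. x \<in> U \<and> torus_lift \<phi> U \<Phi>)"

definition torus_diffeomorphism :: "('n::finite torus \<Rightarrow> 'n torus) \<Rightarrow> bool"
  where "torus_diffeomorphism \<phi> \<longleftrightarrow>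
    bij \<phi> \<and> torus_smooth_map \<phi> \<and> torus_smooth_map (inv_into UNIV \<phi>)"

definition torus_isometry ::
  "('n::finite torus \<Rightarrow> real ^ 'n ^ 'n) \<Rightarrow> ('n torus \<Rightarrow> real ^ 'n ^ 'n) \<Rightarrow>
   ('n torus \<Rightarrow> 'n torus) \<Rightarrow> bool"
  where "torus_isometry h h0 \<phi> \<longleftrightarrow> torus_diffeomorphism \<phi> \<and>
    (\<forall>U \<Phi>. torus_lift \<phi> U \<Phi> \<longrightarrow>
      (\<forall>y\<in>U. \<forall>v w.
        frechet_derivative \<Phi> (at y) v \<bullet> (tpull h0 (\<Phi> y) *v frechet_derivative \<Phi> (at y) w)
          = v \<bullet> (tpull h y *v w)))"

definition isometric_metrics ::
  "('n::finite torus \<Rightarrow> real ^ 'n ^ 'n) \<Rightarrow> ('n torus \<Rightarrow> real ^ 'n ^ 'n) \<Rightarrow> bool"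
  where "isometric_metrics h h0 \<longleftrightarrow> (\<exists>\<phi>. torus_isometry h h0 \<phi>)"

section \<open>The ground state energy of the magnetic Laplacian\<close>

text \<open>\<open>covector_norm_sq H w\<close> is the squared norm of a complex covector \<open>w\<close> for the Hermitian
  extension of the dual of the inner product with Gram matrix \<open>H\<close>.\<close>

definition covector_norm_sq :: "real ^ 'n ^ 'n \<Rightarrow> complex ^ ('n::finite) \<Rightarrow> real"
  where "covector_norm_sq H w =
    Re (\<Sum>i\<in>UNIV. \<Sum>j\<in>UNIV. complex_of_real (matrix_inv H $ i $ j) * (w $ i) * cnj (w $ j))"

definition magnetic_differential ::
  "('n::finite torus \<Rightarrow> real ^ 'n) \<Rightarrow> ('n torus \<Rightarrow> complex) \<Rightarrow> real ^ 'n \<Rightarrow> complex ^ 'n"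
  where "magnetic_differential A u x =
    (\<chi> i. tpartial u i x - \<i> * tpull u x * complex_of_real (tpull A x $ i))"

text \<open>The integral of a function on the torus, given by its periodic lift \<open>f\<close>, against the
  Riemannian volume \<open>dv\<^sub>h\<close>.\<close>

definition volume_integral ::
  "('n::finite torus \<Rightarrow> real ^ 'n ^ 'n) \<Rightarrow> (real ^ 'n \<Rightarrow> real) \<Rightarrow> real"
  where "volume_integral h f = integral (cbox 0 1) (\<lambda>x. f x * sqrt (det (tpull h x)))"

definition rayleigh_quotient ::
  "('n::finite torus \<Rightarrow> real ^ 'n ^ 'n) \<Rightarrow> ('n torus \<Rightarrow> real ^ 'n) \<Rightarrow> ('n torus \<Rightarrow> complex) \<Rightarrow> real"
  where "rayleigh_quotient h A u =
    volume_integral h (\<lambda>x. covector_norm_sq (tpull h x) (magnetic_differential A u x))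
      / volume_integral h (\<lambda>x. (cmod (tpull u x))\<^sup>2)"

definition ground_state_energy ::
  "('n::finite torus \<Rightarrow> real ^ 'n ^ 'n) \<Rightarrow> ('n torus \<Rightarrow> real ^ 'n) \<Rightarrow> real"
  where "ground_state_energy h A = Inf {rayleigh_quotient h A u | u. torus_smooth u \<and> u \<noteq> (\<lambda>_. 0)}"

section \<open>Integration of closed 1-forms over homology classes\<close>

definition simplex_edge :: "real \<Rightarrow> nat \<Rightarrow> real"
  where "simplex_edge t = (\<lambda>i. if i = 0 then 1 - t else if i = 1 then t else 0)"

definition smooth_edge_lift ::
  "((nat \<Rightarrow> real) \<Rightarrow> 'n::finite torus) \<Rightarrow> (real \<Rightarrow> real ^ 'n) \<Rightarrow> bool"
  where "smooth_edge_lift \<sigma> \<gamma> \<longleftrightarrow>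
    smooth_on UNIV \<gamma> \<and> (\<forall>t\<in>{0..1}. torus_proj (\<gamma> t) = \<sigma> (simplex_edge t))"

text \<open>Two lifts of \<open>\<sigma>\<close> differ on \<open>[0,1]\<close> by a constant vector in \<open>\<int>\<^sup>d\<close>, so the choice of
  lift is immaterial.\<close>

definition simplex_integral ::
  "('n::finite torus \<Rightarrow> real ^ 'n) \<Rightarrow> ((nat \<Rightarrow> real) \<Rightarrow> 'n torus) \<Rightarrow> real"
  where "simplex_integral a \<sigma> =
    (let \<gamma> = (SOME \<gamma>. smooth_edge_lift \<sigma> \<gamma>)
     in integral {0..1} (\<lambda>t. tpull a (\<gamma> t) \<bullet> vector_derivative \<gamma> (at t)))"

definition smooth_chain :: "'n::finite torus chain \<Rightarrow> bool"
  where "smooth_chain c \<longleftrightarrow> (\<forall>\<sigma>\<in>Poly_Mapping.keys c. \<exists>\<gamma>. smooth_edge_lift \<sigma> \<gamma>)"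

definition chain_integral ::
  "('n::finite torus \<Rightarrow> real ^ 'n) \<Rightarrow> 'n torus chain \<Rightarrow> real"
  where "chain_integral a c =
    (\<Sum>\<sigma>\<in>Poly_Mapping.keys c. of_int (Poly_Mapping.lookup c \<sigma>) * simplex_integral a \<sigma>)"

text \<open>Every class in \<open>H\<^sub>1\<close> contains smooth cycles and, for a closed form, the integral does not
  depend on which one is chosen (Stokes).\<close>

definition class_integral ::
  "('n::finite torus \<Rightarrow> real ^ 'n) \<Rightarrow> 'n torus chain set \<Rightarrow> real"
  where "class_integral a X = chain_integral a (SOME c. c \<in> X \<and> smooth_chain c)"

text \<open>HOL-Algebra writes the Abelian group \<open>H\<^sub>1\<close> multiplicatively.\<close>

definition integral_basis :: "('g, 'm) monoid_scheme \<Rightarrow> nat \<Rightarrow> (nat \<Rightarrow> 'g) \<Rightarrow> bool"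
  where "integral_basis G d \<xi> \<longleftrightarrow> (\<forall>j\<in>{1..d}. \<xi> j \<in> carrier G) \<and>
    (\<forall>g\<in>carrier G. \<exists>!m. (m :: nat \<Rightarrow> int) \<in> extensional {1..d} \<and>
       g = finprod G (\<lambda>j. \<xi> j [^]\<^bsub>G\<^esub> m j) {1..d})"

definition dual_basis ::
  "nat \<Rightarrow> (nat \<Rightarrow> 'n::finite torus chain set) \<Rightarrow> (nat \<Rightarrow> 'n torus \<Rightarrow> real ^ 'n) \<Rightarrow> bool"
  where "dual_basis d \<xi> \<alpha> \<longleftrightarrow> (\<forall>k\<in>{1..d}. closed_one_form (\<alpha> k)) \<and>
    (\<forall>j\<in>{1..d}. \<forall>k\<in>{1..d}. class_integral (\<alpha> k) (\<xi> j) = (if j = k then 1 else 0))"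

end

(* A flat metric on R^n invariant under Z^n has a developing map D: the local Euclidean charts
   differ by Euclidean isometries, since transition maps preserve small distances, and can be
   glued over boxes. The displacement |D(x+m) - D(x)| of a deck transformation is invariant under
   the commutative group Z^n, hence bounded, so deck transformations become translations. This
   yields global coordinates Psi, commuting with translations by Z^n, in which the metric has
   constant coefficients.

   A closed form lifts to Psi^*a + df with a its period vector and f periodic. After removing df
   by a gauge transformation, the Poincare inequality on the torus shows that, for large n, the
   constant function minimises the Rayleigh quotient of beta/n, so lambda_1(beta/n) = |a|^2/n^2 in
   the dual norm of the constant metric. The energies of alpha_j + alpha_k therefore determine by
   polarisation the dual inner products of the period vectors a_j. These vectors form a basis: a
   linear relation makes a combination of the alpha_j exact, and pairing it with smooth cycles
   representing the chi_j gives zero coefficients. Hence both constant metrics agree, and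
   Psi_0^{-1} o Psi descends to an isometry. *)
theory Submission
  imports Defs
begin

section \<open>Calculus of iterated derivatives\<close>

text \<open>The period vector of a form is read off from a potential on R^n, without any metric.
  Since Psi and Psi_0 both commute with Z^n, the same vectors a_j serve both tori and only the dual
  norm changes. The threshold on n depends on the metric and on the form, but for each pair (j, k)
  one n beyond both thresholds suffices. The only danger for small forms is the cross term of the
  energy, which is linear in 1/n. Derivatives of periodic functions have mean zero, so the Poincare
  inequality bounds this term by the gradient energy, and a small factor lets it be absorbed.
  Inverting D requires local inverses on balls of a uniform radius, which compactness modulo Z^n
  provides. A last obstacle lies in the definition of the integral over a homology class: it uses a
  chosen smooth representative, so each chi_j must be shown to contain one. Lattice-valued winding
  vectors achieve this without a computation of H_1: they invert the matrix that expresses the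
  coordinate loops in the given basis, so the inverse is integral and yields a combination of
  coordinate loops.\<close>

lemma Ck_on_cong:
  fixes f g :: "'a::real_normed_vector \<Rightarrow> 'b::real_normed_vector"
  assumes "open S" "\<And>x. x \<in> S \<Longrightarrow> f x = g x" "Ck_on k S f"
  shows "Ck_on k S g"
  using assms(2,3)
proof (induction k arbitrary: f g)
  case 0
  then show ?case by (metis Ck_on.simps(1) continuous_on_cong)
next
  case (Suc k)
  have D: "(g has_derivative frechet_derivative f (at x)) (at x)" if "x \<in> S" for x
  proof (rule has_derivative_transform_within_open[OF _ \<open>open S\<close> that Suc.prems(1)])
    show "(f has_derivative frechet_derivative f (at x)) (at x)"
      using Suc.prems(2) that by (auto simp: frechet_derivative_works)
  qed
  have eq: "frechet_derivative f (at x) = frechet_derivative g (at x)" if "x \<in> S" for x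
    using D[OF that] frechet_derivative_at by blast
  have "Ck_on k S (\<lambda>x. frechet_derivative g (at x) v)" for v
  proof (rule Suc.IH[where f = "\<lambda>x. frechet_derivative f (at x) v"])
    show "frechet_derivative f (at x) v = frechet_derivative g (at x) v" if "x \<in> S" for x
      using eq[OF that] by simp
    show "Ck_on k S (\<lambda>x. frechet_derivative f (at x) v)"
      using Suc.prems(2) by simp
  qed
  then show ?case using D unfolding Ck_on.simps differentiable_def by blast
qed

text \<open>The derivative is supplied as an explicit family \<open>f'\<close>, so that later
  inductions compute with a formula instead of the choice-based \<open>frechet_derivative\<close>;
  both agree at every point of S.\<close>

lemma Ck_on_SucI:
  fixes f :: "'a::real_normed_vector \<Rightarrow> 'b::real_normed_vector"
  assumes "open S" "\<And>x. x \<in> S \<Longrightarrow> (f has_derivative f' x) (at x)"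
    and "\<And>v. Ck_on k S (\<lambda>x. f' x v)"
  shows "Ck_on (Suc k) S f"
proof -
  have "Ck_on k S (\<lambda>x. frechet_derivative f (at x) v)" for v
    by (rule Ck_on_cong[OF \<open>open S\<close> _ assms(3)[of v]])
      (simp add: frechet_derivative_at[OF assms(2), symmetric])
  then show ?thesis using assms(2) unfolding Ck_on.simps differentiable_def by blast
qed

lemma Ck_on_has_derivative:
  "Ck_on (Suc k) S f \<Longrightarrow> x \<in> S \<Longrightarrow> (f has_derivative frechet_derivative f (at x)) (at x)"
  by (auto simp: frechet_derivative_works)

lemma Ck_on_lower: "Ck_on (Suc k) S f \<Longrightarrow> Ck_on k S f"
proof (induction k arbitrary: f)
  case 0
  then have "f differentiable_on S"
    unfolding differentiable_on_def by (metis Ck_on.simps(2) differentiable_at_withinI)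
  then show ?case by (simp add: differentiable_imp_continuous_on)
next
  case (Suc k)
  show ?case
    unfolding Ck_on.simps(2)[of k]
  proof (intro conjI allI)
    show "\<forall>x\<in>S. f differentiable at x" using Suc.prems by simp
    fix v
    show "Ck_on k S (\<lambda>x. frechet_derivative f (at x) v)"
      using Suc.prems by (intro Suc.IH) simp
  qed
qed

lemma Ck_on_subset: "Ck_on k T f \<Longrightarrow> S \<subseteq> T \<Longrightarrow> Ck_on k S f"
proof (induction k arbitrary: f)
  case 0
  then show ?case using continuous_on_subset by auto
next
  case (Suc k)
  then show ?case by auto
qed

lemma Ck_on_locally:
  assumes "\<And>x. x \<in> S \<Longrightarrow> \<exists>U. open U \<and> x \<in> U \<and> Ck_on k U f"
  shows "Ck_on k S f"
  using assms
proof (induction k arbitrary: f)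
  case 0
  then show ?case
    by (metis Ck_on.simps(1) continuous_at_imp_continuous_on continuous_on_eq_continuous_at)
next
  case (Suc k)
  show ?case
    unfolding Ck_on.simps(2)
  proof (intro conjI ballI allI)
    show "f differentiable at x" if "x \<in> S" for x using Suc.prems[OF that] by auto
    show "Ck_on k S (\<lambda>x. frechet_derivative f (at x) v)" for v
    proof (rule Suc.IH)
      fix x assume "x \<in> S"
      then show "\<exists>U. open U \<and> x \<in> U \<and> Ck_on k U (\<lambda>x. frechet_derivative f (at x) v)"
        using Suc.prems[of x] by auto
    qed
  qed
qed

lemma Ck_on_const: "Ck_on k S (\<lambda>x. c)"
proof (induction k arbitrary: c)
  case (Suc k)
  then show ?case by (simp add: frechet_derivative_const)
qed simp

lemma Ck_on_add:
  assumes "open S" "Ck_on k S f" "Ck_on k S g"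
  shows "Ck_on k S (\<lambda>x. f x + g x)"
  using assms(2,3)
proof (induction k arbitrary: f g)
  case 0
  then show ?case by (auto intro!: continuous_intros)
next
  case (Suc k)
  show ?case
  proof (rule Ck_on_SucI[OF \<open>open S\<close>])
    show "((\<lambda>x. f x + g x) has_derivative
        (\<lambda>v. frechet_derivative f (at x) v + frechet_derivative g (at x) v)) (at x)" if "x \<in> S" for x
      using Suc.prems that by (intro has_derivative_add Ck_on_has_derivative)
  qed (use Suc in auto)
qed

text \<open>One Leibniz rule for products, scalar multiples and inner products. Each summand of the
  derivative pairs a factor lowered to order k with a derivative of order k, which is what the
  induction hypothesis accepts.\<close>

lemma Ck_on_bilinear:
  assumes "bounded_bilinear prd" "open S" "Ck_on k S f" "Ck_on k S g"
  shows "Ck_on k S (\<lambda>x. prd (f x) (g x))"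
  using assms(3,4)
proof (induction k arbitrary: f g)
  case 0
  then show ?case by (auto intro: bounded_bilinear.continuous_on[OF assms(1)])
next
  case (Suc k)
  show ?case
  proof (rule Ck_on_SucI[OF \<open>open S\<close>])
    show "((\<lambda>x. prd (f x) (g x)) has_derivative
        (\<lambda>v. prd (f x) (frechet_derivative g (at x) v) + prd (frechet_derivative f (at x) v) (g x)))
        (at x)" if "x \<in> S" for x
      using Suc.prems that
      by (intro bounded_bilinear.FDERIV[OF assms(1)] Ck_on_has_derivative)
    show "Ck_on k S (\<lambda>x. prd (f x) (frechet_derivative g (at x) v) +
        prd (frechet_derivative f (at x) v) (g x))" for v
      using Suc.prems Ck_on_lower[OF Suc.prems(1)] Ck_on_lower[OF Suc.prems(2)]
      by (intro Ck_on_add \<open>open S\<close> Suc.IH) auto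
  qed
qed

lemma Ck_on_sum:
  assumes "open S" "finite I" "\<And>i. i \<in> I \<Longrightarrow> Ck_on k S (f i)"
  shows "Ck_on k S (\<lambda>x. \<Sum>i\<in>I. f i x)"
  using assms(2,3)
  by (induction I rule: finite_induct) (auto intro: Ck_on_const Ck_on_add[OF \<open>open S\<close>])

lemma Ck_on_linear:
  assumes "bounded_linear L" "open S" "Ck_on k S f"
  shows "Ck_on k S (\<lambda>x. L (f x))"
proof -
  interpret L: bounded_linear L by fact
  \<comment> \<open>A linear map is treated as bilinear in a scalar and a vector, with the scalar
    frozen at 1, so that the Leibniz rule applies.\<close>
  have bb: "bounded_bilinear (\<lambda>r x. r *\<^sub>R L x)"
    using bounded_bilinear.comp[OF bounded_bilinear_scaleR bounded_linear_ident assms(1)] .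
  show ?thesis
    using Ck_on_bilinear[OF bb \<open>open S\<close> Ck_on_const[of k S "1::real"] assms(3)] by simp
qed

text \<open>In the chain rule the direction \<open>?g' x v\<close> moves with x, whereas
  \<open>Ck_on\<close> differentiates along fixed directions. Expanding it over \<open>Basis\<close>
  leaves scalar coefficients times derivatives of f in fixed directions, to which the induction
  hypothesis applies; hence the Euclidean codomain of g.\<close>

lemma Ck_on_compose:
  fixes g :: "'a::real_normed_vector \<Rightarrow> 'b::euclidean_space"
  assumes "open S" "open T" "g ` S \<subseteq> T" "Ck_on k T f" "Ck_on k S g"
  shows "Ck_on k S (\<lambda>x. f (g x))"
  using assms(4,5)
proof (induction k arbitrary: f)
  case 0
  then show ?case using assms(3) by (auto intro: continuous_on_compose2)
next
  case (Suc k)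
  let ?f' = "\<lambda>y. frechet_derivative f (at y)" and ?g' = "\<lambda>x. frechet_derivative g (at x)"
  show ?case
  proof (rule Ck_on_SucI[OF \<open>open S\<close>])
    fix x assume x: "x \<in> S"
    then have gx: "g x \<in> T" using assms(3) by auto
    have f': "(f has_derivative ?f' (g x)) (at (g x))"
      using Suc.prems gx Ck_on_has_derivative by blast
    have g': "(g has_derivative ?g' x) (at x)"
      using Suc.prems x Ck_on_has_derivative by blast
    have "?f' (g x) (?g' x v) = (\<Sum>b\<in>Basis. (?g' x v \<bullet> b) *\<^sub>R ?f' (g x) b)" for v
    proof -
      have "?f' (g x) (?g' x v) = ?f' (g x) (\<Sum>b\<in>Basis. (?g' x v \<bullet> b) *\<^sub>R b)"
        by (simp add: euclidean_representation)
      then show ?thesis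
        using has_derivative_linear[OF f'] by (simp add: linear_sum linear_cmul)
    qed
    moreover have "((\<lambda>x. f (g x)) has_derivative (\<lambda>v. ?f' (g x) (?g' x v))) (at x)"
      using has_derivative_compose[OF g' f'] .
    ultimately show "((\<lambda>x. f (g x)) has_derivative
        (\<lambda>v. \<Sum>b\<in>Basis. (?g' x v \<bullet> b) *\<^sub>R ?f' (g x) b)) (at x)"
      by simp
  next
    fix v
    show "Ck_on k S (\<lambda>x. \<Sum>b\<in>Basis. (?g' x v \<bullet> b) *\<^sub>R ?f' (g x) b)"
    proof (intro Ck_on_sum \<open>open S\<close> finite_Basis Ck_on_bilinear[OF bounded_bilinear_scaleR])
      fix b :: 'b
      show "Ck_on k S (\<lambda>x. ?g' x v \<bullet> b)"
        using Suc.prems by (intro Ck_on_linear[OF bounded_linear_inner_left] \<open>open S\<close>) auto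
      show "Ck_on k S (\<lambda>x. ?f' (g x) b)"
        using Suc.prems Ck_on_lower[OF Suc.prems(2)] by (intro Suc.IH) auto
    qed
  qed
qed

lemma smooth_on_has_derivative:
  "smooth_on S f \<Longrightarrow> x \<in> S \<Longrightarrow> (f has_derivative frechet_derivative f (at x)) (at x)"
  unfolding smooth_on_def using Ck_on_has_derivative by blast

lemma smooth_on_derivative:
  "smooth_on S f \<Longrightarrow> smooth_on S (\<lambda>x. frechet_derivative f (at x) v)"
  unfolding smooth_on_def by (metis Ck_on.simps(2))

lemma smooth_on_imp_continuous_on: "smooth_on S f \<Longrightarrow> continuous_on S f"
  unfolding smooth_on_def by (metis Ck_on.simps(1))

lemma smooth_onI_derivative:
  assumes "open S" "\<And>x. x \<in> S \<Longrightarrow> (f has_derivative f' x) (at x)"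
    and "\<And>v. smooth_on S (\<lambda>x. f' x v)"
  shows "smooth_on S f"
  unfolding smooth_on_def
  using Ck_on_SucI[OF assms(1,2)] Ck_on_lower assms(3) unfolding smooth_on_def by blast

lemma smooth_on_cong:
  assumes "open S" "\<And>x. x \<in> S \<Longrightarrow> f x = g x" "smooth_on S f"
  shows "smooth_on S g"
  using Ck_on_cong[of S f g, OF assms(1,2)] assms(3) unfolding smooth_on_def by blast

lemma smooth_on_subset: "smooth_on T f \<Longrightarrow> S \<subseteq> T \<Longrightarrow> smooth_on S f"
  unfolding smooth_on_def using Ck_on_subset by blast

lemma smooth_on_locally:
  assumes "\<And>x. x \<in> S \<Longrightarrow> \<exists>U. open U \<and> x \<in> U \<and> smooth_on U f"
  shows "smooth_on S f"
  using assms Ck_on_locally unfolding smooth_on_def by metis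

lemma smooth_on_const [simp, intro]: "smooth_on S (\<lambda>x. c)"
  by (simp add: smooth_on_def Ck_on_const)

lemma smooth_on_add:
  "open S \<Longrightarrow> smooth_on S f \<Longrightarrow> smooth_on S g \<Longrightarrow> smooth_on S (\<lambda>x. f x + g x)"
  by (simp add: smooth_on_def Ck_on_add)

lemma smooth_on_bilinear:
  "bounded_bilinear prd \<Longrightarrow> open S \<Longrightarrow> smooth_on S f \<Longrightarrow> smooth_on S g
    \<Longrightarrow> smooth_on S (\<lambda>x. prd (f x) (g x))"
  by (simp add: smooth_on_def Ck_on_bilinear)

lemmas smooth_on_mult = smooth_on_bilinear[OF bounded_bilinear_mult]

lemma smooth_on_linear:
  "bounded_linear L \<Longrightarrow> open S \<Longrightarrow> smooth_on S f \<Longrightarrow> smooth_on S (\<lambda>x. L (f x))"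
  by (simp add: smooth_on_def Ck_on_linear)

lemma smooth_on_linear_map: 
  assumes "bounded_linear L" shows "smooth_on UNIV L"
  by (rule smooth_onI_derivative[OF open_UNIV bounded_linear_imp_has_derivative[OF assms]]) simp

lemma smooth_on_diff:
  assumes "open S" "smooth_on S f" "smooth_on S g"
  shows "smooth_on S (\<lambda>x. f x - g x)"
proof -
  have "bounded_linear (\<lambda>x::'b. - x)" by (rule bounded_linear_minus) (rule bounded_linear_ident)
  from smooth_on_add[OF assms(1,2) smooth_on_linear[OF this assms(1,3)]] show ?thesis by simp
qed

lemma smooth_on_sum:
  "open S \<Longrightarrow> finite I \<Longrightarrow> (\<And>i. i \<in> I \<Longrightarrow> smooth_on S (f i)) \<Longrightarrow> smooth_on S (\<lambda>x. \<Sum>i\<in>I. f i x)"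
  by (simp add: smooth_on_def Ck_on_sum)

lemma smooth_on_prod:
  fixes f :: "'i \<Rightarrow> 'a::real_normed_vector \<Rightarrow> real"
  assumes "open S" "finite I" "\<And>i. i \<in> I \<Longrightarrow> smooth_on S (f i)"
  shows "smooth_on S (\<lambda>x. \<Prod>i\<in>I. f i x)"
  using assms(2,3)
  by (induction I rule: finite_induct) (auto intro: smooth_on_mult[OF \<open>open S\<close>])

lemma smooth_on_compose:
  fixes g :: "'a::real_normed_vector \<Rightarrow> 'b::euclidean_space"
  shows "open S \<Longrightarrow> open T \<Longrightarrow> g ` S \<subseteq> T \<Longrightarrow> smooth_on T f \<Longrightarrow> smooth_on S g
    \<Longrightarrow> smooth_on S (\<lambda>x. f (g x))"
  by (simp add: smooth_on_def Ck_on_compose)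

text \<open>The derivative of 1/f is a product of the smooth f' and two copies of 1/f, so each order
  of differentiability of 1/f yields the next.\<close>

lemma smooth_on_inverse:
  fixes f :: "'a::real_normed_vector \<Rightarrow> real"
  assumes "open S" "smooth_on S f" "\<And>x. x \<in> S \<Longrightarrow> f x \<noteq> 0"
  shows "smooth_on S (\<lambda>x. inverse (f x))"
  unfolding smooth_on_def
proof
  fix k
  let ?f' = "\<lambda>x. frechet_derivative f (at x)"
  show "Ck_on k S (\<lambda>x. inverse (f x))"
  proof (induction k)
    case 0
    then show ?case
      using assms smooth_on_imp_continuous_on by (auto intro!: continuous_intros)
  next
    case (Suc k)
    show ?case
    proof (rule Ck_on_SucI[OF \<open>open S\<close>])
      show "((\<lambda>x. inverse (f x)) has_derivative (\<lambda>v. - (inverse (f x) * ?f' x v * inverse (f x)))) (at x)"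
        if "x \<in> S" for x
        using that assms by (intro Deriv.has_derivative_inverse smooth_on_has_derivative) auto
      have "Ck_on k S (\<lambda>x. ?f' x v)" for v
        using smooth_on_derivative[OF assms(2)] by (simp add: smooth_on_def)
      then show "Ck_on k S (\<lambda>x. - (inverse (f x) * ?f' x v * inverse (f x)))" for v
        by (intro Ck_on_linear[OF bounded_linear_minus[OF bounded_linear_ident]]
            Ck_on_bilinear[OF bounded_bilinear_mult] Suc \<open>open S\<close>)
    qed
  qed
qed

text \<open>Differentiation only multiplies by a constant, so the induction runs over the family
  \<open>c * cis t\<close> with arbitrary complex c, which is closed under derivatives.\<close>

lemma smooth_on_cis: "smooth_on UNIV cis"
proof -
  have "Ck_on k UNIV (\<lambda>t. c * cis t)" for k c
  proof (induction k arbitrary: c)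
    case 0
    then show ?case by (auto intro!: continuous_intros)
  next
    case (Suc k)
    show ?case
    proof (rule Ck_on_SucI)
      show "((\<lambda>t. c * cis t) has_derivative (\<lambda>v. (c * complex_of_real v * \<i>) * cis t)) (at t)" for t
      proof -
        have "((\<lambda>t. \<i> * complex_of_real t) has_derivative (\<lambda>v. \<i> * complex_of_real v)) (at t)"
          by (intro has_derivative_mult_right bounded_linear_imp_has_derivative bounded_linear_of_real)
        from has_derivative_compose[OF this DERIV_exp[unfolded has_field_derivative_def]]
        have "(cis has_derivative (\<lambda>v. cis t * (\<i> * complex_of_real v))) (at t)"
          by (simp add: cis_conv_exp[abs_def])
        from has_derivative_mult_right[OF this, of c] show ?thesis
          by (simp add: mult_ac)
      qed
      show "Ck_on k UNIV (\<lambda>x. c * complex_of_real v * \<i> * cis x)" for v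
        using Suc.IH[of "c * complex_of_real v * \<i>"] by simp
    qed simp
  qed
  from this[of _ 1] show ?thesis by (simp add: smooth_on_def)
qed

lemma smooth_on_vec_iff:
  fixes f :: "'a::real_normed_vector \<Rightarrow> 'b::euclidean_space ^ 'n"
  assumes "open S"
  shows "smooth_on S f \<longleftrightarrow> (\<forall>i. smooth_on S (\<lambda>x. f x $ i))"
proof
  show "smooth_on S f \<Longrightarrow> \<forall>i. smooth_on S (\<lambda>x. f x $ i)"
    using smooth_on_linear[OF bounded_linear_vec_nth assms] by blast
  assume *: "\<forall>i. smooth_on S (\<lambda>x. f x $ i)"
  have "smooth_on S (\<lambda>x. (\<Sum>i\<in>UNIV. axis i (f x $ i)))"
  proof (intro smooth_on_sum assms)
    fix i
    have "linear (axis i :: 'b \<Rightarrow> 'b^'n)"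
      by (rule linearI) (simp_all add: vec_eq_iff axis_def)
    then have "bounded_linear (axis i :: 'b \<Rightarrow> 'b^'n)"
      by (rule linear_conv_bounded_linear[THEN iffD1])
    from smooth_on_linear[OF this assms] * show "smooth_on S (\<lambda>x. axis i (f x $ i))" by blast
  qed simp
  moreover have "(\<Sum>i\<in>UNIV. axis i (y $ i)) = y" for y :: "'b^'n"
    by (simp add: vec_eq_iff axis_def if_distrib[of "\<lambda>f. f _"] cong: if_cong)
  ultimately show "smooth_on S f" by simp
qed

lemma smooth_on_det:
  fixes A :: "'a::real_normed_vector \<Rightarrow> real^'n^'n"
  assumes "open S" "\<And>i j. smooth_on S (\<lambda>x. A x $ i $ j)"
  shows "smooth_on S (\<lambda>x. det (A x))"
  unfolding det_def
  by (intro smooth_on_sum smooth_on_mult smooth_on_prod assms smooth_on_const) auto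

text \<open>Cramer's rule writes the solution as a quotient of determinants, which are polynomials
  in smooth entries. It is applied to the inverse Jacobian, whose values solve such a
  system.\<close>

lemma smooth_on_linear_system:
  fixes A :: "'a::real_normed_vector \<Rightarrow> real^'n^'n"
  assumes "open S" "\<And>i j. smooth_on S (\<lambda>x. A x $ i $ j)" "\<And>i. smooth_on S (\<lambda>x. b x $ i)"
    and "\<And>x. x \<in> S \<Longrightarrow> det (A x) \<noteq> 0" "\<And>x. x \<in> S \<Longrightarrow> A x *v p x = b x"
  shows "smooth_on S p"
  unfolding smooth_on_vec_iff[OF \<open>open S\<close>]
proof
  fix k
  let ?M = "\<lambda>x. (\<chi> i j. if j = k then b x $ i else A x $ i $ j) :: real^'n^'n"
  have "smooth_on S (\<lambda>x. det (?M x) * inverse (det (A x)))"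
  proof (intro smooth_on_mult smooth_on_det smooth_on_inverse assms)
    show "smooth_on S (\<lambda>x. ?M x $ i $ j)" for i j
      using assms(2,3) by (cases "j = k") auto
  qed auto
  moreover have "det (?M x) * inverse (det (A x)) = p x $ k" if "x \<in> S" for x
  proof -
    have "p x = (\<chi> k. det (\<chi> i j. if j = k then b x $ i else A x $ i $ j) / det (A x))"
      using cramer[OF assms(4)[OF that]] assms(5)[OF that] by blast
    then have "p x $ k = det (\<chi> i j. if j = k then b x $ i else A x $ i $ j) / det (A x)"
      by simp
    then show ?thesis by (simp add: divide_inverse)
  qed
  ultimately show "smooth_on S (\<lambda>x. p x $ k)"
    by (rule smooth_on_cong[OF \<open>open S\<close>, rotated])
qed

text \<open>Bootstrap: the derivative of the inverse at y is \<open>P (\<theta> y)\<close>, where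
  \<open>P x\<close> is the inverse Jacobian, smooth in x by Cramer's rule. If \<theta> is of class
  C^k, so is this composite, and then \<theta> is of class C^(k+1).\<close>

lemma smooth_on_inverse_function:
  fixes \<Psi> \<theta> :: "real^'n \<Rightarrow> real^'n"
  assumes "smooth_on UNIV \<Psi>" "\<And>x. \<theta> (\<Psi> x) = x" "\<And>y. \<Psi> (\<theta> y) = y" "continuous_on UNIV \<theta>"
    and "\<And>x. inj (frechet_derivative \<Psi> (at x))"
  shows "smooth_on UNIV \<theta>"
    and "frechet_derivative \<Psi> (at (\<theta> y)) (frechet_derivative \<theta> (at y) v) = v"
proof -
  let ?D = "\<lambda>x. frechet_derivative \<Psi> (at x)"
  have D: "(\<Psi> has_derivative ?D x) (at x)" for x
    using smooth_on_has_derivative[OF assms(1)] by simp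
  have lin: "linear (?D x)" for x using has_derivative_linear[OF D] .
  define P where "P x = inv_into UNIV (?D x)" for x
  have surj: "surj (?D x)" for x
    using linear_injective_imp_surjective[OF lin assms(5)] by simp
  have linP: "linear (P x)" for x
    unfolding P_def using inj_linear_imp_inv_linear[OF lin assms(5)] .
  have DP: "?D x (P x v) = v" for x v
    unfolding P_def using surj by (simp add: surj_f_inv_f)
  have PD: "P x (?D x v) = v" for x v
    unfolding P_def using assms(5) by simp
  have P: "smooth_on UNIV (\<lambda>x. P x v)" for v
  proof (rule smooth_on_linear_system[where A = "\<lambda>x. matrix (?D x)" and b = "\<lambda>x. v"])
    show "smooth_on UNIV (\<lambda>x. matrix (?D x) $ i $ j)" for i j
      unfolding matrix_def
      using smooth_on_linear[OF bounded_linear_vec_nth open_UNIV smooth_on_derivative[OF assms(1)]]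
      by simp
    show "det (matrix (?D x)) \<noteq> 0" for x
      using det_nz_iff_inj[OF lin] assms(5) by blast
    show "matrix (?D x) *v P x v = v" for x
      using lin DP by (simp add: matrix_works linear_matrix_vector_mul_eq)
  qed auto
  have \<theta>': "(\<theta> has_derivative P (\<theta> y)) (at y)" for y
  proof (rule has_derivative_inverse_basic[where f = \<Psi> and T = UNIV])
    show "bounded_linear (P (\<theta> y))" using linP linear_conv_bounded_linear by blast
    show "P (\<theta> y) \<circ> ?D (\<theta> y) = id" using PD by auto
    show "isCont \<theta> y" using assms(4) by (simp add: continuous_on_eq_continuous_at)
  qed (use assms D in auto)
  have "Ck_on k UNIV \<theta>" for k
  proof (induction k)
    case 0
    then show ?case using assms by simp
  next
    case (Suc k)
    show ?case
    proof (rule Ck_on_SucI[OF open_UNIV \<theta>'])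
      fix v
      show "Ck_on k UNIV (\<lambda>x. P (\<theta> x) v)"
        using Ck_on_compose[OF open_UNIV open_UNIV _ _ Suc, of "\<lambda>x. P x v"] P
        by (simp add: smooth_on_def)
    qed
  qed
  then show "smooth_on UNIV \<theta>" by (simp add: smooth_on_def)
  show "?D (\<theta> y) (frechet_derivative \<theta> (at y) v) = v"
    using frechet_derivative_at[OF \<theta>'] DP by metis
qed

section \<open>The developing map of a flat metric\<close>

text \<open>Polarisation: an inner product of differences is a combination of three squared
  distances.\<close>

lemma inner_diff_eq_of_dist_eq:
  fixes a b c :: "'a::real_inner" and a' b' c' :: "'b::real_inner"
  assumes "dist a c = dist a' c'" "dist b c = dist b' c'" "dist a b = dist a' b'"
  shows "(a - c) \<bullet> (b - c) = (a' - c') \<bullet> (b' - c')"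
proof -
  have *: "2 * ((x - z) \<bullet> (y - z)) = (dist x z)\<^sup>2 + (dist y z)\<^sup>2 - (dist x y)\<^sup>2"
    for x y z :: "'x::real_inner"
    unfolding dist_norm power2_norm_eq_inner by (simp add: algebra_simps inner_commute)
  show ?thesis using *[of a c b] *[of a' c' b'] assms by simp
qed

text \<open>The identity \<open>(\<phi> a - \<phi> p) \<bullet> (\<phi> b - \<phi> p) = (a - p)
  \<bullet> (b - p)\<close> is differentiated in a and then, separately, in b. The result
  \<open>\<phi>' a v \<bullet> \<phi>' b w = v \<bullet> w\<close> holds for any two points, so the
  square of \<open>\<phi>' a v - \<phi>' b v\<close> expands to zero. First derivatives
  suffice.\<close>

lemma distance_preserving_derivative_const:
  fixes \<phi> :: "'a::euclidean_space \<Rightarrow> 'b::euclidean_space"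
  assumes D: "\<And>a. a \<in> ball p r \<Longrightarrow> (\<phi> has_derivative \<phi>' a) (at a)"
    and dist: "\<And>a b. a \<in> ball p r \<Longrightarrow> b \<in> ball p r \<Longrightarrow> dist (\<phi> a) (\<phi> b) = dist a b"
    and ab: "a \<in> ball p r" "b \<in> ball p r"
  shows "\<phi>' a = \<phi>' b"
proof -
  have p: "p \<in> ball p r" using ab by (metis centre_in_ball dist_not_less_zero linorder_not_less mem_ball order_le_less_trans)
  have inner: "(\<phi> a - \<phi> p) \<bullet> (\<phi> b - \<phi> p) = (a - p) \<bullet> (b - p)" if "a \<in> ball p r" "b \<in> ball p r" for a b
    by (rule inner_diff_eq_of_dist_eq) (use dist p that in auto)
  have 1: "\<phi>' a v \<bullet> (\<phi> b - \<phi> p) = v \<bullet> (b - p)" if "a \<in> ball p r" "b \<in> ball p r" for a b v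
  proof -
    have "((\<lambda>a. (\<phi> a - \<phi> p) \<bullet> (\<phi> b - \<phi> p)) has_derivative (\<lambda>v. \<phi>' a v \<bullet> (\<phi> b - \<phi> p))) (at a)"
      using D[OF that(1)] by (auto intro!: derivative_eq_intros)
    moreover have "((\<lambda>a. (\<phi> a - \<phi> p) \<bullet> (\<phi> b - \<phi> p)) has_derivative (\<lambda>v. v \<bullet> (b - p))) (at a)"
    proof (rule has_derivative_transform_within_open[OF _ open_ball that(1)])
      show "((\<lambda>a. (a - p) \<bullet> (b - p)) has_derivative (\<lambda>v. v \<bullet> (b - p))) (at a)"
        by (auto intro!: derivative_eq_intros)
    qed (use inner that in auto)
    ultimately show ?thesis using has_derivative_unique by metis
  qed
  have 2: "\<phi>' a v \<bullet> \<phi>' b w = v \<bullet> w" if "a \<in> ball p r" "b \<in> ball p r" for a b v w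
  proof -
    have "((\<lambda>b. \<phi>' a v \<bullet> (\<phi> b - \<phi> p)) has_derivative (\<lambda>w. \<phi>' a v \<bullet> \<phi>' b w)) (at b)"
      using D[OF that(2)] by (auto intro!: derivative_eq_intros)
    moreover have "((\<lambda>b. \<phi>' a v \<bullet> (\<phi> b - \<phi> p)) has_derivative (\<lambda>w. v \<bullet> w)) (at b)"
    proof (rule has_derivative_transform_within_open[OF _ open_ball that(2)])
      show "((\<lambda>b. v \<bullet> (b - p)) has_derivative (\<lambda>w. v \<bullet> w)) (at b)"
        by (auto intro!: derivative_eq_intros)
    qed (use 1 that in auto)
    ultimately show ?thesis using has_derivative_unique by metis
  qed
  show ?thesis
  proof
    fix v
    have "(\<phi>' a v - \<phi>' b v) \<bullet> (\<phi>' a v - \<phi>' b v) = 0"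
      by (simp add: inner_diff_left inner_diff_right 2[OF ab(1) ab(1)] 2[OF ab(1) ab(2)] 2[OF ab(2) ab(1)] 2[OF ab(2) ab(2)])
    then show "\<phi>' a v = \<phi>' b v" by simp
  qed
qed

text \<open>Here \<open>g x v w\<close> is the inner product of the tangent vectors \<open>v\<close> and \<open>w\<close> at \<open>x\<close>.\<close>

definition local_isometry ::
  "('a::euclidean_space \<Rightarrow> 'a \<Rightarrow> 'a \<Rightarrow> real) \<Rightarrow> 'a set \<Rightarrow> ('a \<Rightarrow> 'a) \<Rightarrow> bool"
  where "local_isometry g S F \<longleftrightarrow> open S \<and> smooth_on S F \<and>
    (\<forall>y\<in>S. \<forall>v w. frechet_derivative F (at y) v \<bullet> frechet_derivative F (at y) w = g y v w) \<and>
    (\<forall>x\<in>S. \<exists>U. open U \<and> x \<in> U \<and> inj_on F U)"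

lemma local_isometryD:
  assumes "local_isometry g S F"
  shows "open S" "smooth_on S F"
    and "y \<in> S \<Longrightarrow> frechet_derivative F (at y) v \<bullet> frechet_derivative F (at y) w = g y v w"
    and "y \<in> S \<Longrightarrow> \<exists>U. open U \<and> y \<in> U \<and> inj_on F U"
  using assms unfolding local_isometry_def by simp_all

lemma local_isometryI:
  assumes "open S" "smooth_on S F"
    and "\<And>y v w. y \<in> S \<Longrightarrow> frechet_derivative F (at y) v \<bullet> frechet_derivative F (at y) w = g y v w"
    and "\<And>y. y \<in> S \<Longrightarrow> \<exists>U. open U \<and> y \<in> U \<and> inj_on F U"
  shows "local_isometry g S F"
  using assms unfolding local_isometry_def by simp

lemma local_isometry_subset:
  assumes F: "local_isometry g T F" and S: "open S" "S \<subseteq> T"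
  shows "local_isometry g S F"
  by (rule local_isometryI) (use S local_isometryD[OF F] smooth_on_subset[of T F S] in auto)

lemma local_isometry_cong:
  assumes "local_isometry g S F" "\<And>x. x \<in> S \<Longrightarrow> F x = G x"
  shows "local_isometry g S G"
proof -
  have S: "open S" and sF: "smooth_on S F" using assms(1) by (auto simp: local_isometry_def)
  have D: "frechet_derivative G (at y) = frechet_derivative F (at y)" if "y \<in> S" for y
    using has_derivative_transform_within_open[OF smooth_on_has_derivative[OF sF that] S that assms(2)]
    by (simp add: frechet_derivative_at[symmetric])
  have "smooth_on S G" using smooth_on_cong[OF S assms(2) sF] .
  moreover have "\<exists>U. open U \<and> x \<in> U \<and> inj_on G U" if "x \<in> S" for x
  proof -
    from local_isometryD(4)[OF assms(1) that]
    obtain U where "open U" "x \<in> U" "inj_on F U" by blast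
    then have "inj_on F (U \<inter> S)" by (blast intro: inj_on_subset)
    then have "inj_on G (U \<inter> S)" using inj_on_cong[of "U \<inter> S" F G] assms(2) by blast
    then show ?thesis using S that \<open>open U\<close> \<open>x \<in> U\<close> by blast
  qed
  ultimately show ?thesis
    using S D local_isometryD(3)[OF assms(1)] by (intro local_isometryI) auto
qed

lemma local_isometry_locally:
  assumes "\<And>x. x \<in> S \<Longrightarrow> \<exists>U. x \<in> U \<and> U \<subseteq> S \<and> local_isometry g U F"
  shows "local_isometry g S F"
proof -
  have *: "\<exists>U. open U \<and> x \<in> U \<and> U \<subseteq> S \<and> smooth_on U F" if "x \<in> S" for x
  proof -
    from assms[OF that] obtain U where "x \<in> U" "U \<subseteq> S" "local_isometry g U F" by blast
    then show ?thesis using local_isometryD(1,2)[of g U F] by blast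
  qed
  show ?thesis
  proof (rule local_isometryI)
    show "open S" "smooth_on S F"
      using * open_subopen[of S] smooth_on_locally[of S F] by blast+
    fix y assume "y \<in> S"
    then obtain U where U: "y \<in> U" "local_isometry g U F" using assms by blast
    show "frechet_derivative F (at y) v \<bullet> frechet_derivative F (at y) w = g y v w" for v w
      using local_isometryD(3)[OF U(2,1)] .
    show "\<exists>U. open U \<and> y \<in> U \<and> inj_on F U"
      using local_isometryD(4)[OF U(2,1)] .
  qed
qed

lemma local_isometry_comp_isometry:
  assumes F: "local_isometry g S F" and Q: "orthogonal_transformation Q"
  shows "local_isometry g S (\<lambda>x. Q (F x) + b)"
proof -
  have S: "open S" and sF: "smooth_on S F" using F by (auto simp: local_isometry_def)
  have lQ: "bounded_linear Q"
    using orthogonal_transformation_linear[OF Q] linear_conv_bounded_linear by blast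
  have D: "frechet_derivative (\<lambda>x. Q (F x) + b) (at y) = (\<lambda>v. Q (frechet_derivative F (at y) v))"
    if "y \<in> S" for y
  proof -
    have "((\<lambda>x. Q (F x) + b) has_derivative (\<lambda>v. Q (frechet_derivative F (at y) v))) (at y)"
      using bounded_linear.has_derivative[OF lQ smooth_on_has_derivative[OF sF that]]
      by (auto intro!: derivative_eq_intros)
    then show ?thesis by (simp add: frechet_derivative_at[symmetric])
  qed
  have "smooth_on S (\<lambda>x. Q (F x) + b)"
    using smooth_on_linear[OF lQ S sF] smooth_on_add[OF S _ smooth_on_const] by blast
  moreover have inj: "inj_on (\<lambda>x. Q (F x) + b) U" if "inj_on F U" for U
    using that orthogonal_transformation_inj[OF Q] by (auto simp: inj_on_def)
  moreover have "\<exists>U. open U \<and> y \<in> U \<and> inj_on (\<lambda>x. Q (F x) + b) U" if "y \<in> S" for y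
    using local_isometryD(4)[OF F that] inj by blast
  ultimately show ?thesis
    using S D Q local_isometryD(3)[OF F]
    by (intro local_isometryI) (simp_all add: orthogonal_transformation_def)
qed

section \<open>Transition maps between local isometries\<close>

locale positive_metric =
  fixes g :: "'a::euclidean_space \<Rightarrow> 'a \<Rightarrow> 'a \<Rightarrow> real"
  assumes pos: "v \<noteq> 0 \<Longrightarrow> g x v v > 0"
begin

lemma local_isometry_derivative:
  assumes "local_isometry g S F" "y \<in> S"
  shows "(F has_derivative frechet_derivative F (at y)) (at y)"
    and "linear (frechet_derivative F (at y))"
    and "bij (frechet_derivative F (at y))"
    and "frechet_derivative F (at y) v \<bullet> frechet_derivative F (at y) w = g y v w"
proof -
  show D: "(F has_derivative frechet_derivative F (at y)) (at y)"
    using smooth_on_has_derivative[OF local_isometryD(2)[OF assms(1)] assms(2)] .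
  then show lin: "linear (frechet_derivative F (at y))" by (rule has_derivative_linear)
  show *: "frechet_derivative F (at y) v \<bullet> frechet_derivative F (at y) w = g y v w" for v w
    using local_isometryD(3)[OF assms] .
  have "v = 0" if "frechet_derivative F (at y) v = 0" for v
    using *[of v v] pos[of v y] that by auto
  then have "inj (frechet_derivative F (at y))"
    using lin linear_injective_0 by blast
  then show "bij (frechet_derivative F (at y))"
    using linear_injective_imp_surjective[OF lin] by (simp add: bij_def)
qed

lemma transition_has_derivative:
  assumes F: "local_isometry g S F" and G: "local_isometry g S G" and inj: "inj_on F S" and "y \<in> S"
  shows "((\<lambda>a. G (inv_into S F a)) has_derivative
    (\<lambda>v. frechet_derivative G (at y) (inv_into UNIV (frechet_derivative F (at y)) v))) (at (F y))"
proof -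
  have S: "open S" using F by (simp add: local_isometry_def)
  have bij: "bij (frechet_derivative F (at y))"
    using local_isometry_derivative(3)[OF F \<open>y \<in> S\<close>] .
  have "(inv_into S F has_derivative inv_into UNIV (frechet_derivative F (at y))) (at (F y))"
  proof (rule has_derivative_inverse_on[OF S _ _ _ \<open>y \<in> S\<close>])
    show "(F has_derivative frechet_derivative F (at x)) (at x)" if "x \<in> S" for x
      using local_isometry_derivative(1)[OF F that] .
    show "frechet_derivative F (at y) \<circ> inv_into UNIV (frechet_derivative F (at y)) = id"
      using bij by (simp add: bij_is_surj surj_iff[symmetric])
  qed (use inj in auto)
  moreover have "(G has_derivative frechet_derivative G (at y)) (at (inv_into S F (F y)))"
    using local_isometry_derivative(1)[OF G \<open>y \<in> S\<close>] inj \<open>y \<in> S\<close> by simp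
  ultimately show ?thesis by (rule has_derivative_compose)
qed

lemma transition_derivative_norm:
  assumes F: "local_isometry g S F" and G: "local_isometry g S G" and "y \<in> S"
  shows "norm (frechet_derivative G (at y) (inv_into UNIV (frechet_derivative F (at y)) v)) = norm v"
proof -
  let ?u = "inv_into UNIV (frechet_derivative F (at y)) v"
  have "frechet_derivative F (at y) ?u = v"
    using local_isometry_derivative(3)[OF F \<open>y \<in> S\<close>] by (simp add: bij_is_surj surj_f_inv_f)
  then have "frechet_derivative G (at y) ?u \<bullet> frechet_derivative G (at y) ?u = v \<bullet> v"
    using local_isometry_derivative(4)[OF G \<open>y \<in> S\<close>] local_isometry_derivative(4)[OF F \<open>y \<in> S\<close>]
    by metis
  then show ?thesis by (simp add: norm_eq_sqrt_inner)
qed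

text \<open>Mean value inequality: the derivative of the transition map preserves norms and the ball
  is convex. The ball lies in the image of F, so the segment from a to b stays in the domain of the
  inverse chart.\<close>

lemma transition_nonexpanding:
  assumes F: "local_isometry g S F" and G: "local_isometry g S G" and inj: "inj_on F S"
    and ball: "ball p r \<subseteq> F ` S" and ab: "a \<in> ball p r" "b \<in> ball p r"
  shows "dist (G (inv_into S F a)) (G (inv_into S F b)) \<le> dist a b"
proof -
  let ?D = "\<lambda>x v. frechet_derivative G (at (inv_into S F x))
      (inv_into UNIV (frechet_derivative F (at (inv_into S F x))) v)"
  have "norm (G (inv_into S F a) - G (inv_into S F b)) \<le> 1 * norm (a - b)"
  proof (rule differentiable_bound[OF convex_ball _ _ ab, where f' = ?D])
    fix x assume x: "x \<in> ball p r"
    then have y: "inv_into S F x \<in> S" "F (inv_into S F x) = x"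
      using inv_into_into[OF subsetD[OF ball x]] f_inv_into_f[OF subsetD[OF ball x]] by simp_all
    show "((\<lambda>a. G (inv_into S F a)) has_derivative ?D x) (at x within ball p r)"
      using transition_has_derivative[OF F G inj y(1)] unfolding y(2)
      by (rule has_derivative_at_withinI)
    show "onorm (?D x) \<le> 1"
      by (rule onorm_le) (simp add: transition_derivative_norm[OF F G y(1)])
  qed
  then show ?thesis by (simp add: dist_norm)
qed

text \<open>The transition maps in the two directions are nonexpanding and inverse to each other.
  Hence near \<open>F x\<close> they preserve distances, which forces a constant derivative.\<close>

lemma transition_locally_constant:
  assumes F: "local_isometry g S F" and G: "local_isometry g S G"
    and inj: "inj_on F S" "inj_on G S" and "x \<in> S"
  obtains U where "open U" "x \<in> U" "U \<subseteq> S"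
    "\<And>y. y \<in> U \<Longrightarrow> frechet_derivative G (at y) \<circ> inv_into UNIV (frechet_derivative F (at y)) =
      frechet_derivative G (at x) \<circ> inv_into UNIV (frechet_derivative F (at x))"
proof -
  have S: "open S" and cF: "continuous_on S F" and cG: "continuous_on S G"
    using F G smooth_on_imp_continuous_on by (auto simp: local_isometry_def)
  have "open (F ` S)" "open (G ` S)"
    using invariance_of_domain S cF cG inj by blast+
  then obtain r1 r2 where r: "r1 > 0" "ball (F x) r1 \<subseteq> F ` S" "r2 > 0" "ball (G x) r2 \<subseteq> G ` S"
    by (meson \<open>x \<in> S\<close> imageI open_contains_ball)
  \<comment> \<open>One radius for both images: the transition map does not expand, so it sends the
    ball about \<open>F x\<close> into the ball of the same radius about \<open>G x\<close>, where
    the reverse estimate is available.\<close>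
  define r where "r = min r1 r2"
  have r0: "r > 0" and rF: "ball (F x) r \<subseteq> F ` S" and rG: "ball (G x) r \<subseteq> G ` S"
    using r by (auto simp: r_def)
  let ?\<phi> = "\<lambda>a. G (inv_into S F a)"
  let ?\<phi>' = "\<lambda>a v. frechet_derivative G (at (inv_into S F a))
      (inv_into UNIV (frechet_derivative F (at (inv_into S F a))) v)"
  have S_inv: "inv_into S F a \<in> S" "F (inv_into S F a) = a" if "a \<in> ball (F x) r" for a
    using inv_into_into[OF subsetD[OF rF that]] f_inv_into_f[OF subsetD[OF rF that]] by simp_all
  have px: "?\<phi> (F x) = G x" using inj \<open>x \<in> S\<close> by simp
  have into: "?\<phi> a \<in> ball (G x) r" if "a \<in> ball (F x) r" for a
    using transition_nonexpanding[OF F G inj(1) rF _ that, of "F x"] that r0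
    unfolding px mem_ball by (meson centre_in_ball le_less_trans mem_ball)
  have iso: "dist (?\<phi> a) (?\<phi> b) = dist a b" if "a \<in> ball (F x) r" "b \<in> ball (F x) r" for a b
  proof (rule antisym)
    show "dist (?\<phi> a) (?\<phi> b) \<le> dist a b"
      using transition_nonexpanding[OF F G inj(1) rF that] .
    have "F (inv_into S G (?\<phi> c)) = c" if "c \<in> ball (F x) r" for c
      using S_inv[OF that] inj(2) by simp
    then show "dist a b \<le> dist (?\<phi> a) (?\<phi> b)"
      using transition_nonexpanding[OF G F inj(2) rG into[OF that(1)] into[OF that(2)]] that by simp
  qed
  have D: "(?\<phi> has_derivative ?\<phi>' a) (at a)" if "a \<in> ball (F x) r" for a
    using transition_has_derivative[OF F G inj(1) S_inv(1)[OF that]] S_inv(2)[OF that] by simp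
  have const: "?\<phi>' a = ?\<phi>' (F x)" if "a \<in> ball (F x) r" for a
    using distance_preserving_derivative_const[where \<phi> = ?\<phi> and \<phi>' = ?\<phi>', OF D iso that, of "F x"] r0
    by simp
  show thesis
  proof
    show "open (S \<inter> F -` ball (F x) r)"
      using cF S by (simp add: continuous_on_open_vimage Int_commute)
    show "x \<in> S \<inter> F -` ball (F x) r" using \<open>x \<in> S\<close> r0 by simp
    fix y assume "y \<in> S \<inter> F -` ball (F x) r"
    then show "frechet_derivative G (at y) \<circ> inv_into UNIV (frechet_derivative F (at y)) =
      frechet_derivative G (at x) \<circ> inv_into UNIV (frechet_derivative F (at x))"
      using const[of "F y"] inj \<open>x \<in> S\<close> by (simp add: comp_def)
  qed auto
qed

text \<open>The linear part of the transition is locally constant, hence constant on a connected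
  set. After it has been subtracted, \<open>G y - Q (F y)\<close> has derivative zero, and its
  constant value is the translation b.\<close>

proposition local_isometry_rigid:
  assumes F: "local_isometry g S F" and G: "local_isometry g S G" and "connected S" "S \<noteq> {}"
  obtains Q b where "orthogonal_transformation Q" "\<And>y. y \<in> S \<Longrightarrow> G y = Q (F y) + b"
proof -
  obtain x0 where x0: "x0 \<in> S" using \<open>S \<noteq> {}\<close> by blast
  have S: "open S" using F by (simp add: local_isometry_def)
  let ?Q = "\<lambda>y. frechet_derivative G (at y) \<circ> inv_into UNIV (frechet_derivative F (at y))"
  define Q where "Q = ?Q x0"
  have const: "?Q y = Q" if "y \<in> S" for y
    unfolding Q_def
  proof (rule connected_local_const[where f = ?Q, OF \<open>connected S\<close> that x0], intro ballI)
    fix x assume "x \<in> S"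
    then have "\<exists>U. open U \<and> x \<in> U \<and> inj_on F U" "\<exists>U. open U \<and> x \<in> U \<and> inj_on G U"
      using local_isometryD(4)[OF F] local_isometryD(4)[OF G] by blast+
    then obtain A B where AB: "open A" "x \<in> A" "inj_on F A" "open B" "x \<in> B" "inj_on G B"
      by blast
    have FG: "local_isometry g (S \<inter> A \<inter> B) F" "local_isometry g (S \<inter> A \<inter> B) G"
      by (rule local_isometry_subset[OF F] local_isometry_subset[OF G]; use S AB in auto)+
    have inj: "inj_on F (S \<inter> A \<inter> B)" "inj_on G (S \<inter> A \<inter> B)" "x \<in> S \<inter> A \<inter> B"
      using AB \<open>x \<in> S\<close> by (auto intro: inj_on_subset)
    obtain U where U: "open U" "x \<in> U" "U \<subseteq> S \<inter> A \<inter> B" "\<And>y. y \<in> U \<Longrightarrow> ?Q y = ?Q x"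
      by (rule transition_locally_constant[OF FG inj]) (rule that)
    show "eventually (\<lambda>b. ?Q x = ?Q b) (at x within S)"
      unfolding eventually_at_topological
      by (intro exI[of _ U] conjI U(1,2) ballI impI U(4)[symmetric])
  qed
  have lin: "linear Q"
    unfolding Q_def
    using local_isometry_derivative(2)[OF G x0] local_isometry_derivative(2,3)[OF F x0]
    by (intro linear_compose inj_linear_imp_inv_linear) (auto simp: bij_is_inj)
  have orth: "orthogonal_transformation Q"
    unfolding orthogonal_transformation using lin transition_derivative_norm[OF F G x0]
    by (simp add: Q_def)
  have DG: "frechet_derivative G (at y) v = Q (frechet_derivative F (at y) v)" if "y \<in> S" for y v
    unfolding const[OF that, symmetric] comp_def
    using local_isometry_derivative(3)[OF F that] by (simp add: bij_is_inj)
  have lQ: "bounded_linear Q" using lin linear_conv_bounded_linear by blast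
  have D0: "((\<lambda>y. G y - Q (F y)) has_derivative (\<lambda>v. 0)) (at y)" if "y \<in> S" for y
    using has_derivative_diff[OF local_isometry_derivative(1)[OF G that]
        bounded_linear.has_derivative[OF lQ local_isometry_derivative(1)[OF F that]]]
    by (simp add: DG[OF that])
  have "G y - Q (F y) = G x0 - Q (F x0)" if "y \<in> S" for y
    by (rule has_derivative_zero_unique_connected[where f = "\<lambda>y. G y - Q (F y)",
          OF S \<open>connected S\<close> D0 that x0])
  then have "G y = Q (F y) + (G x0 - Q (F x0))" if "y \<in> S" for y
    using that by (simp add: diff_eq_eq add.commute)
  then show thesis using orth that by blast
qed

text \<open>A rigid motion relates the two maps. On U it fixes the values of F, and since the
  derivative of F is onto, its linear part is the identity; then the translation vanishes
  too.\<close>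

lemma local_isometry_unique:
  assumes F: "local_isometry g S F" and G: "local_isometry g S G" and "connected S"
    and U: "open U" "U \<noteq> {}" "U \<subseteq> S" "\<And>y. y \<in> U \<Longrightarrow> F y = G y" and "y \<in> S"
  shows "F y = G y"
proof -
  obtain x where x: "x \<in> U" using U by blast
  then have xS: "x \<in> S" using U by blast
  obtain Q b where Q: "orthogonal_transformation Q" and eq: "\<And>y. y \<in> S \<Longrightarrow> G y = Q (F y) + b"
    using local_isometry_rigid[OF F G \<open>connected S\<close>] xS by (metis empty_iff)
  have "bounded_linear Q"
    using orthogonal_transformation_linear[OF Q] linear_conv_bounded_linear by blast
  from bounded_linear.has_derivative[OF this local_isometry_derivative(1)[OF F xS]]
  have "((\<lambda>y. Q (F y) + b) has_derivative (\<lambda>v. Q (frechet_derivative F (at x) v))) (at x)"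
    by (auto intro!: derivative_eq_intros)
  then have "(F has_derivative (\<lambda>v. Q (frechet_derivative F (at x) v))) (at x)"
  proof (rule has_derivative_transform_within_open[OF _ U(1) x])
    show "Q (F y) + b = F y" if "y \<in> U" for y
      using eq[of y] U(4)[OF that] that U(3) by fastforce
  qed
  then have "(\<lambda>v. Q (frechet_derivative F (at x) v)) = frechet_derivative F (at x)"
    using local_isometry_derivative(1)[OF F xS] by (rule has_derivative_unique)
  moreover have "surj (frechet_derivative F (at x))"
    using local_isometry_derivative(3)[OF F xS] by (rule bij_is_surj)
  ultimately have "Q z = z" for z
    using surjD[of "frechet_derivative F (at x)" z] by (metis (no_types))
  then show ?thesis using eq[OF xS] eq[OF \<open>y \<in> S\<close>] U(4)[OF x] by simp
qed

end

section \<open>Gluing charts to a global developing map\<close>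

locale flat_space = positive_metric +
  assumes chart: "\<exists>U F. x \<in> U \<and> local_isometry g U F"
begin

text \<open>Rigidity needs a connected overlap. The common face K of the two halves is compact and
  convex, so some e-neighbourhood of it lies in both domains and is again convex. The rigid motion
  found there corrects F2 to match F1.\<close>

lemma local_isometry_glue:
  assumes F1: "local_isometry g S1 F1" and F2: "local_isometry g S2 F2" and k: "k \<in> Basis"
    and sub: "cbox a b \<inter> {x. x \<bullet> k \<le> c} \<subseteq> S1" "cbox a b \<inter> {x. x \<bullet> k \<ge> c} \<subseteq> S2"
    and ne: "cbox a b \<inter> {x. x \<bullet> k = c} \<noteq> {}"
  shows "\<exists>S F. cbox a b \<subseteq> S \<and> local_isometry g S F"
proof -
  define K where "K = cbox a b \<inter> {x. x \<bullet> k = c}"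
  have hyp: "{x. x \<bullet> k = c} = {x. k \<bullet> x = c}" by (simp add: inner_commute)
  have "compact K" "convex K"
    unfolding K_def hyp
    by (simp_all add: compact_Int_closed closed_hyperplane convex_Int convex_hyperplane)
  have o: "open S1" "open S2" using F1 F2 local_isometryD(1) by blast+
  have "K \<subseteq> S1 \<inter> S2" using sub unfolding K_def by auto
  then obtain e where e: "e > 0" "(\<Union>x\<in>K. ball x e) \<subseteq> S1 \<inter> S2"
    using compact_subset_open_imp_ball_epsilon_subset[OF \<open>compact K\<close> open_Int[OF o]] by blast
  define N where "N = (\<Union>x\<in>K. ball x e)"
  \<comment> \<open>Written as the Minkowski sum of K and a ball, the neighbourhood is convex
    because both summands are.\<close>
  have N_eq: "(\<Union>x\<in>K. \<Union>y\<in>ball 0 e. {x + y}) = N"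
    unfolding N_def
  proof (intro equalityI subsetI)
    fix z assume "z \<in> (\<Union>x\<in>K. ball x e)"
    then obtain x where x: "x \<in> K" "z \<in> ball x e" by blast
    then have "z - x \<in> ball 0 e" "z = x + (z - x)"
      by (auto simp: dist_norm norm_minus_commute)
    then show "z \<in> (\<Union>x\<in>K. \<Union>y\<in>ball 0 e. {x + y})" using x(1) by blast
  next
    fix z assume "z \<in> (\<Union>x\<in>K. \<Union>y\<in>ball 0 e. {x + y})"
    then obtain x y where "x \<in> K" "norm y < e" "z = x + y" by auto
    then show "z \<in> (\<Union>x\<in>K. ball x e)" by (auto simp: dist_norm intro!: bexI[of _ x])
  qed
  have "convex N"
    using convex_sums[OF \<open>convex K\<close> convex_ball[of 0 e]] unfolding N_eq .
  then have connN: "connected N" by (rule convex_connected)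
  have oN: "open N" unfolding N_def by auto
  have NS: "N \<subseteq> S1" "N \<subseteq> S2" using e(2) by (auto simp: N_def)
  have KN: "K \<subseteq> N" using e(1) by (auto simp: N_def)
  have "N \<noteq> {}" using ne KN unfolding K_def by blast
  then obtain Q b' where Q: "orthogonal_transformation Q" and eq: "\<And>y. y \<in> N \<Longrightarrow> F1 y = Q (F2 y) + b'"
    by (rule local_isometry_rigid[OF local_isometry_subset[OF F2 oN NS(2)]
        local_isometry_subset[OF F1 oN NS(1)] connN]) (rule that)
  define F2' where "F2' x = Q (F2 x) + b'" for x
  have F2': "local_isometry g S2 F2'"
    unfolding F2'_def by (rule local_isometry_comp_isometry[OF F2 Q])
  define F where "F x = (if x \<bullet> k < c then F1 x else F2' x)" for x
  let ?L = "S1 \<inter> {x. x \<bullet> k < c}" and ?R = "S2 \<inter> {x. x \<bullet> k > c}"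
  have "open {x. x \<bullet> k < c}" "open {x. x \<bullet> k > c}"
    by (simp_all add: open_halfspace_component_lt open_halfspace_component_gt)
  then have LR: "open ?L" "open ?R" using o by auto
  have L: "local_isometry g ?L F"
    by (rule local_isometry_cong[OF local_isometry_subset[OF F1 LR(1)]]) (auto simp: F_def)
  have R: "local_isometry g ?R F"
    by (rule local_isometry_cong[OF local_isometry_subset[OF F2' LR(2)]]) (auto simp: F_def)
  have N: "local_isometry g N F"
    by (rule local_isometry_cong[OF local_isometry_subset[OF F1 oN NS(1)]])
      (simp add: F_def F2'_def eq)
  have "local_isometry g (?L \<union> N \<union> ?R) F"
  proof (rule local_isometry_locally)
    fix x assume "x \<in> ?L \<union> N \<union> ?R"
    then consider "x \<in> ?L" | "x \<in> N" | "x \<in> ?R" by blast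
    then show "\<exists>U. x \<in> U \<and> U \<subseteq> ?L \<union> N \<union> ?R \<and> local_isometry g U F"
    proof cases
      case 1
      show ?thesis by (intro exI[of _ ?L] conjI 1 L) auto
    next
      case 2
      show ?thesis by (intro exI[of _ N] conjI 2 N) auto
    next
      case 3
      show ?thesis by (intro exI[of _ ?R] conjI 3 R) auto
    qed
  qed
  moreover have "cbox a b \<subseteq> ?L \<union> N \<union> ?R"
  proof
    fix x assume "x \<in> cbox a b"
    then show "x \<in> ?L \<union> N \<union> ?R"
      using sub KN unfolding K_def by (cases "x \<bullet> k" c rule: linorder_cases) auto
  qed
  ultimately show ?thesis by blast
qed

text \<open>Sets with empty interior count as developable because \<open>operative\<close> demands
  the neutral value on degenerate boxes. The domain S is open, which leaves room for an overlap when
  two boxes are glued.\<close>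

definition developable :: "'a set \<Rightarrow> bool"
  where "developable K \<longleftrightarrow> interior K = {} \<or> (\<exists>S F. K \<subseteq> S \<and> local_isometry g S F)"

lemma developable_mono: "developable L \<Longrightarrow> K \<subseteq> L \<Longrightarrow> developable K"
  unfolding developable_def using interior_mono[of K L] by (metis order_trans subset_empty)

lemma developable_cbox_split:
  assumes k: "k \<in> Basis"
  shows "developable (cbox a b) \<longleftrightarrow>
    developable (cbox a b \<inter> {x. x \<bullet> k \<le> c}) \<and> developable (cbox a b \<inter> {x. x \<bullet> k \<ge> c})"
proof (intro iffI)
  assume "developable (cbox a b)"
  then show "developable (cbox a b \<inter> {x. x \<bullet> k \<le> c}) \<and> developable (cbox a b \<inter> {x. x \<bullet> k \<ge> c})"
    by (auto intro: developable_mono)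
next
  assume *: "developable (cbox a b \<inter> {x. x \<bullet> k \<le> c}) \<and> developable (cbox a b \<inter> {x. x \<bullet> k \<ge> c})"
  show "developable (cbox a b)"
  proof (cases "box a b = {}")
    case True
    then show ?thesis by (simp add: developable_def interior_cbox)
  next
    case False
    then have ab: "a \<bullet> i < b \<bullet> i" if "i \<in> Basis" for i using that by (simp add: box_ne_empty)
    consider "c \<le> a \<bullet> k" | "c \<ge> b \<bullet> k" | "a \<bullet> k < c" "c < b \<bullet> k" by linarith
    then show ?thesis
    proof cases
      case 1
      then have "cbox a b \<inter> {x. x \<bullet> k \<ge> c} = cbox a b"
        using k by (simp add: mem_box set_eq_iff) (meson order_trans)
      then show ?thesis using * by simp
    next
      case 2
      then have "cbox a b \<inter> {x. x \<bullet> k \<le> c} = cbox a b"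
        using k by (simp add: mem_box set_eq_iff) (meson order_trans)
      then show ?thesis using * by simp
    next
      case 3
      have "interior (cbox a b \<inter> {x. x \<bullet> k \<le> c}) \<noteq> {}" "interior (cbox a b \<inter> {x. x \<bullet> k \<ge> c}) \<noteq> {}"
        unfolding interval_split[OF k] interior_cbox box_ne_empty
        using ab 3 by (auto simp: k)
      with * have "\<exists>S F. cbox a b \<inter> {x. x \<bullet> k \<le> c} \<subseteq> S \<and> local_isometry g S F"
        "\<exists>S F. cbox a b \<inter> {x. x \<bullet> k \<ge> c} \<subseteq> S \<and> local_isometry g S F"
        unfolding developable_def by simp_all
      then obtain S1 F1 S2 F2 where S: "local_isometry g S1 F1" "local_isometry g S2 F2"
        "cbox a b \<inter> {x. x \<bullet> k \<le> c} \<subseteq> S1" "cbox a b \<inter> {x. x \<bullet> k \<ge> c} \<subseteq> S2"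
        by (elim exE conjE) (rule that)
      moreover have "cbox a b \<inter> {x. x \<bullet> k = c} \<noteq> {}"
      proof -
        have "(\<Sum>i\<in>Basis. (if i = k then c else a \<bullet> i) *\<^sub>R i) \<in> cbox a b \<inter> {x. x \<bullet> k = c}"
          using k ab 3 by (auto simp: mem_box less_imp_le)
        then show ?thesis by blast
      qed
      ultimately show ?thesis
        using local_isometry_glue[OF S(1,2) k S(3,4)] unfolding developable_def by simp
    qed
  qed
qed

text \<open>The chart domains form a gauge, and a division of the box fine for this gauge exists by
  compactness. The splitting lemma then propagates developability from the pieces to the whole box,
  whatever the shape of the division.\<close>

lemma developable_cbox: "developable (cbox a b)"
proof -
  have "\<forall>x. \<exists>U. x \<in> U \<and> (\<exists>F. local_isometry g U F)"
    using chart by simp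
  from choice[OF this] obtain U where U': "\<forall>x. x \<in> U x \<and> (\<exists>F. local_isometry g (U x) F)" ..
  then have U: "x \<in> U x" "\<exists>F. local_isometry g (U x) F" for x by auto
  have "open (U x)" for x using U(2)[of x] local_isometryD(1) by auto
  then have "gauge U" using U by (simp add: gauge_def)
  then obtain p where p: "p tagged_division_of cbox a b" "U fine p"
    using fine_division_exists by blast
  \<comment> \<open>With conjunction as the monoid operation, the fold over a division asserts that
    every piece is developable.\<close>
  interpret operative "(\<and>)" True developable
  proof
    show "developable (cbox a b) = True" if "box a b = {}" for a b
      using that by (simp add: developable_def interior_cbox)
  qed (rule developable_cbox_split)
  have "developable k" if "(x, k) \<in> p" for x k
    using fineD[OF p(2) that] U(2)[of x] unfolding developable_def by (intro disjI2 exI[of _ "U x"]) simp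
  then show ?thesis
    unfolding division[symmetric, OF division_of_tagged_division[OF p(1)]] comm_monoid_set_F_and
    by auto
qed

lemma local_isometry_ball: "\<exists>F. local_isometry g (ball 0 r) F"
proof (cases "r > 0")
  case True
  obtain a :: 'a where a: "ball 0 r \<subseteq> cbox (-a) a"
    using bounded_subset_cbox_symmetric[OF bounded_ball] by blast
  then have "interior (cbox (-a) a) \<noteq> {}"
    using True interior_mono[OF a] by auto
  then obtain S F where "cbox (-a) a \<subseteq> S" "local_isometry g S F"
    using developable_cbox[of "-a" a] unfolding developable_def by auto
  then have "local_isometry g (ball 0 r) F"
    using a by (intro local_isometry_subset[OF _ open_ball, where T = S]) auto
  then show ?thesis by blast
next
  case False
  then have "ball (0::'a) r = {}" by simp
  moreover have "local_isometry g {} (\<lambda>x. 0)" by (rule local_isometryI) auto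
  ultimately show ?thesis by metis
qed

text \<open>Isometries on an exhausting sequence of balls are corrected by rigid motions so that all
  agree on the unit ball. Uniqueness on connected sets then makes any two agree on the smaller of
  their balls.\<close>

theorem developing_map: "\<exists>D. local_isometry g UNIV D"
proof -
  let ?B = "\<lambda>n. ball (0::'a) (real (Suc n))"
  have "\<forall>n. \<exists>F. local_isometry g (?B n) F" using local_isometry_ball by blast
  from choice[OF this] obtain F where F: "local_isometry g (?B n) (F n)" for n by blast
  have sub: "?B m \<subseteq> ?B n" if "m \<le> n" for m n using that by (intro subset_ball) simp
  have "\<exists>G. local_isometry g (?B n) G \<and> (\<forall>y\<in>?B 0. G y = F 0 y)" for n
  proof -
    have "local_isometry g (?B 0) (F n)"
      by (rule local_isometry_subset[OF F open_ball sub]) simp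
    moreover have "?B 0 \<noteq> {}" by simp
    ultimately obtain Q b where Q: "orthogonal_transformation Q" "\<And>y. y \<in> ?B 0 \<Longrightarrow> F 0 y = Q (F n y) + b"
      by (rule local_isometry_rigid[OF _ F connected_ball]) (rule that)
    then show ?thesis
      using local_isometry_comp_isometry[OF F[of n] Q(1), of b] by auto
  qed
  then have "\<forall>n. \<exists>G. local_isometry g (?B n) G \<and> (\<forall>y\<in>?B 0. G y = F 0 y)" by blast
  from choice[OF this] obtain G where
    "\<forall>n. local_isometry g (?B n) (G n) \<and> (\<forall>y\<in>?B 0. G n y = F 0 y)" ..
  then have G: "local_isometry g (?B n) (G n)" and G0: "y \<in> ?B 0 \<Longrightarrow> G n y = F 0 y" for n y
    by blast+
  have agree: "G m y = G n y" if "m \<le> n" "y \<in> ?B m" for m n y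
  proof (rule local_isometry_unique[OF G local_isometry_subset[OF G open_ball sub[OF that(1)]] connected_ball
        open_ball _ sub[of 0 m] _ that(2)])
    show "G m z = G n z" if "z \<in> ?B 0" for z using G0[OF that] by simp
  qed auto
  \<comment> \<open>The ball of index n has radius n + 1, so the ball of index
    \<open>nat \<lceil>norm x\<rceil>\<close> contains x even when its norm is an integer.\<close>
  define D where "D x = G (nat \<lceil>norm x\<rceil>) x" for x
  have D: "D x = G n x" if "x \<in> ?B n" for x n
  proof -
    have "x \<in> ?B (nat \<lceil>norm x\<rceil>)" by (simp, linarith)
    then show ?thesis
      unfolding D_def using agree that by (metis nat_le_linear)
  qed
  have "local_isometry g UNIV D"
  proof (rule local_isometry_locally)
    fix x
    have "x \<in> ?B (nat \<lceil>norm x\<rceil>)" by (simp, linarith)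
    moreover have "local_isometry g (?B n) D" for n
      using local_isometry_cong[OF G] D by metis
    ultimately show "\<exists>U. x \<in> U \<and> U \<subseteq> UNIV \<and> local_isometry g U D"
      by (intro exI conjI subset_UNIV)
  qed
  then show ?thesis by blast
qed

end

section \<open>Global invertibility of local homeomorphisms\<close>

text \<open>Agreement of two sections is a locally constant property: where they agree, injectivity
  of f near the common value keeps them equal; where they differ, the Hausdorff property keeps them
  apart.\<close>

lemma local_sections_agree:
  fixes f :: "'a::t2_space \<Rightarrow> 'b::t2_space"
  assumes inj: "\<And>x. \<exists>U. open U \<and> x \<in> U \<and> inj_on f U" and C: "open C" "connected C"
    and s: "continuous_on C s" "\<And>q. q \<in> C \<Longrightarrow> f (s q) = q"
    and t: "continuous_on C t" "\<And>q. q \<in> C \<Longrightarrow> f (t q) = q"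
    and p: "p \<in> C" "s p = t p" and "q \<in> C"
  shows "s q = t q"
proof -
  have "(s q = t q) = (s p = t p)"
  proof (rule connected_local_const[where f = "\<lambda>q. s q = t q", OF C(2) \<open>q \<in> C\<close> p(1)], intro ballI)
    fix c assume c: "c \<in> C"
    have st: "isCont s c" "isCont t c"
      using s(1) t(1) C(1) c by (simp_all add: continuous_on_eq_continuous_at)
    have ev: "\<forall>\<^sub>F b in nhds c. b \<in> C" using C(1) c by (rule eventually_nhds_in_open)
    have "\<forall>\<^sub>F b in nhds c. (s c = t c) = (s b = t b)"
    proof (cases "s c = t c")
      case True
      obtain U where U: "open U" "s c \<in> U" "inj_on f U" using inj by blast
      have "\<forall>\<^sub>F b in nhds c. s b \<in> U" "\<forall>\<^sub>F b in nhds c. t b \<in> U"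
        using st U(1,2) True by (simp_all add: continuous_at_open eventually_nhds)
      then have "\<forall>\<^sub>F b in nhds c. s b = t b"
        using ev by eventually_elim (metis U(3) inj_onD s(2) t(2))
      then show ?thesis using True by simp
    next
      case False
      then obtain U V where UV: "open U" "open V" "s c \<in> U" "t c \<in> V" "U \<inter> V = {}"
        using hausdorff[OF False] by blast
      have "\<forall>\<^sub>F b in nhds c. s b \<in> U" "\<forall>\<^sub>F b in nhds c. t b \<in> V"
        using st UV by (simp_all add: continuous_at_open eventually_nhds)
      then have "\<forall>\<^sub>F b in nhds c. s b \<noteq> t b"
        by eventually_elim (use UV in auto)
      then show ?thesis using False by simp
    qed
    then show "\<forall>\<^sub>F b in at c within C. (s c = t c) = (s b = t b)"
      using filter_leD[OF at_le] filter_leD[OF at_within_le_nhds] by blast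
  qed
  then show ?thesis using p(2) by simp
qed

text \<open>A radius independent of the point turns the local homeomorphism into a covering map. The
  identity of the simply connected target lifts to a global section s, and s is a two-sided inverse
  because its range is open and closed.\<close>

lemma uniform_local_sections_inverse:
  fixes f :: "'a::euclidean_space \<Rightarrow> 'a"
  assumes inj: "\<And>x. \<exists>U. open U \<and> x \<in> U \<and> inj_on f U" and cont: "continuous_on UNIV f"
    and "surj f" "r > 0"
    and sec: "\<And>x. \<exists>s. continuous_on (ball (f x) r) s \<and> s (f x) = x \<and> (\<forall>q\<in>ball (f x) r. f (s q) = q)"
  obtains s where "continuous_on UNIV s" "\<And>q. f (s q) = q" "\<And>x. s (f x) = x"
proof -
  have "\<forall>x. \<exists>s. continuous_on (ball (f x) r) s \<and> s (f x) = x \<and> (\<forall>q\<in>ball (f x) r. f (s q) = q)"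
    using sec by blast
  from choice[OF this] obtain \<sigma> where \<sigma>: "continuous_on (ball (f x) r) (\<sigma> x)" "\<sigma> x (f x) = x"
    "q \<in> ball (f x) r \<Longrightarrow> f (\<sigma> x q) = q" for x q by blast
  have "covering_space UNIV f UNIV"
  proof
    show "continuous_on UNIV f" by fact
    show "f ` UNIV = UNIV" by fact
    fix q :: 'a
    \<comment> \<open>Half the radius: if \<open>f z\<close> lies in T, then T lies in the ball of
      radius r about \<open>f z\<close>, so the section through z is defined on all of T and z
      belongs to a sheet.\<close>
    define T where "T = ball q (r / 2)"
    have T: "open T" "connected T" "q \<in> T" using \<open>r > 0\<close> by (auto simp: T_def)
    have Tsub: "T \<subseteq> ball q r" using \<open>r > 0\<close> by (auto simp: T_def)
    have c\<sigma>: "continuous_on T (\<sigma> x)" "a \<in> T \<Longrightarrow> f (\<sigma> x a) = a" "\<sigma> x q = x" if "f x = q" for x a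
      using continuous_on_subset[OF \<sigma>(1)[of x], of T] \<sigma>(2)[of x] \<sigma>(3)[of a x] that Tsub by auto
    have agree: "\<sigma> x b = \<sigma> y b" if "f x = q" "f y = q" "a \<in> T" "\<sigma> x a = \<sigma> y a" "b \<in> T" for x y a b
      using local_sections_agree[OF inj T(1,2) c\<sigma>(1,2)[OF that(1)] c\<sigma>(1,2)[OF that(2)] that(3,4,5)]
      by blast
    \<comment> \<open>The sheets over T are the images of the sections through the points of the
      fibre over q.\<close>
    define v where "v = (\<lambda>x. \<sigma> x ` T) ` {x. f x = q}"
    have "\<Union>v = f -` T"
    proof (intro equalityI subsetI)
      fix z assume "z \<in> f -` T"
      then have z: "dist q (f z) < r / 2" "f z \<in> T" by (auto simp: T_def)
      define x where "x = \<sigma> z q"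
      have qz: "q \<in> ball (f z) r" using z \<open>r > 0\<close> by (simp add: dist_commute)
      have fx: "f x = q" using \<sigma>(3)[OF qz] by (simp add: x_def)
      have Tz: "T \<subseteq> ball (f z) r"
      proof
        fix a assume "a \<in> T"
        then show "a \<in> ball (f z) r"
          using z dist_triangle[of "f z" a q] by (simp add: T_def dist_commute)
      qed
      have "\<sigma> x (f z) = \<sigma> z (f z)"
      proof (rule local_sections_agree[OF inj T(1,2) c\<sigma>(1,2)[OF fx] _ _ T(3)])
        show "continuous_on T (\<sigma> z)" using \<sigma>(1) Tz continuous_on_subset by blast
        show "f (\<sigma> z q) = q" if "q \<in> T" for q using \<sigma>(3) that Tz by blast
        show "\<sigma> x q = \<sigma> z q" using c\<sigma>(3)[OF fx] by (simp add: x_def)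
      qed (use z in auto)
      then have "z = \<sigma> x (f z)" using \<sigma>(2) by simp
      then show "z \<in> \<Union>v" using z fx unfolding v_def by blast
    qed (use c\<sigma> in \<open>auto simp: v_def\<close>)
    moreover have "openin (top_of_set UNIV) u" if "u \<in> v" for u
    proof -
      from that obtain x where x: "f x = q" "u = \<sigma> x ` T" by (auto simp: v_def)
      have "inj_on (\<sigma> x) T" using c\<sigma>(2)[OF x(1)] by (metis inj_onI)
      from invariance_of_domain[OF c\<sigma>(1)[OF x(1)] T(1) this] show ?thesis using x(2) by simp
    qed
    moreover have "pairwise disjnt v"
      unfolding pairwise_def
    proof (intro ballI impI)
      fix A B assume "A \<in> v" "B \<in> v" and ne: "A \<noteq> B"
      then obtain x y where xy: "f x = q" "A = \<sigma> x ` T" "f y = q" "B = \<sigma> y ` T"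
        by (auto simp: v_def)
      show "disjnt A B"
      proof (rule ccontr)
        assume "\<not> disjnt A B"
        then obtain a b where ab: "a \<in> T" "b \<in> T" "\<sigma> x a = \<sigma> y b"
          unfolding xy disjnt_def by blast
        then have "a = b" using c\<sigma>(2) xy by metis
        with ab have "\<sigma> x c = \<sigma> y c" if "c \<in> T" for c using agree xy(1,3) that by blast
        then show False using ne unfolding xy by (metis image_cong)
      qed
    qed
    moreover have "\<exists>s. homeomorphism u T f s" if "u \<in> v" for u
    proof -
      from that obtain x where x: "f x = q" "u = \<sigma> x ` T" by (auto simp: v_def)
      have "homeomorphism u T f (\<sigma> x)"
      proof (rule homeomorphismI)
        show "continuous_on u f" using cont continuous_on_subset by blast
        show "continuous_on T (\<sigma> x)" using c\<sigma>(1)[OF x(1)] .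
      qed (use c\<sigma>(2)[OF x(1)] in \<open>auto simp: x(2)\<close>)
      then show ?thesis by blast
    qed
    ultimately show "\<exists>T. q \<in> T \<and> openin (top_of_set UNIV) T \<and>
        (\<exists>v. \<Union>v = UNIV \<inter> f -` T \<and> (\<forall>u\<in>v. openin (top_of_set UNIV) u) \<and> pairwise disjnt v \<and>
          (\<forall>u\<in>v. \<exists>s. homeomorphism u T f s))"
      using T by (intro exI[of _ T] conjI exI[of _ v]) auto
  qed
  note lift = covering_space_lift[OF this, of UNIV "\<lambda>x. x"]
  have "simply_connected (UNIV::'a set)" "locally path_connected (UNIV::'a set)"
    by (simp_all add: convex_imp_simply_connected convex_imp_locally_path_connected)
  then obtain s where s': "continuous_on UNIV s" "s \<in> UNIV \<rightarrow> UNIV" "\<And>y. y \<in> UNIV \<Longrightarrow> f (s y) = y"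
    by (rule lift[OF _ _ continuous_on_id]) (auto intro: that)
  then have s: "continuous_on UNIV s" "f (s y) = y" for y by auto
  have "inj s" using s(2) by (metis injI)
  then have "open (range s)" using invariance_of_domain[OF s(1) open_UNIV] by simp
  \<comment> \<open>Openness of the range comes from invariance of domain; closedness comes from
    this description of it as an equaliser of continuous maps.\<close>
  moreover have "range s = {x. s (f x) = x}"
  proof (intro equalityI subsetI)
    fix x assume "x \<in> {x. s (f x) = x}"
    then show "x \<in> range s" using rangeI[of s "f x"] by simp
  qed (use s(2) in auto)
  moreover have "closed {x. s (f x) = x}"
    by (intro closed_Collect_eq continuous_on_compose2[OF s(1)] cont continuous_on_id) auto
  ultimately have "{x. s (f x) = x} = UNIV"
    using clopen[of "range s"] by auto
  then show thesis using that s by blast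
qed

section \<open>Flat metrics invariant under the integer lattice\<close>

definition integer_lattice :: "(real^'n) set"
  where "integer_lattice = {m. \<forall>i. m $ i \<in> \<int>}"

lemma integer_lattice_add: "m \<in> integer_lattice \<Longrightarrow> k \<in> integer_lattice \<Longrightarrow> m + k \<in> integer_lattice"
  and integer_lattice_minus: "m \<in> integer_lattice \<Longrightarrow> - m \<in> integer_lattice"
  and integer_lattice_diff: "m \<in> integer_lattice \<Longrightarrow> k \<in> integer_lattice \<Longrightarrow> m - k \<in> integer_lattice"
  and integer_lattice_zero: "0 \<in> integer_lattice"
  by (auto simp: integer_lattice_def)

lemma integer_lattice_axis: "of_int z *\<^sub>R axis i 1 \<in> integer_lattice"
  by (auto simp: integer_lattice_def axis_def)

lemma integer_lattice_sum:
  "(\<And>i. i \<in> I \<Longrightarrow> f i \<in> integer_lattice) \<Longrightarrow> (\<Sum>i\<in>I. f i) \<in> integer_lattice"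
  by (induction I rule: infinite_finite_induct) (auto intro: integer_lattice_add integer_lattice_zero)

text \<open>Additivity settles integer multiples of an axis vector by induction in both directions
  from 0, and then sums over the coordinates. It serves both the translation vectors of deck
  transformations and the periods of potentials.\<close>

lemma lattice_additive_eq:
  fixes b :: "real^'n \<Rightarrow> 'b::real_vector"
  assumes add: "\<And>m k. m \<in> integer_lattice \<Longrightarrow> k \<in> integer_lattice \<Longrightarrow> b (m + k) = b m + b k"
    and m: "m \<in> integer_lattice"
  shows "b m = (\<Sum>i\<in>UNIV. m $ i *\<^sub>R b (axis i 1))"
proof -
  have b0: "b 0 = 0" using add[OF integer_lattice_zero integer_lattice_zero] by simp
  have step: "b (of_int z *\<^sub>R axis i 1) = of_int z *\<^sub>R b (axis i 1)" for z i
  proof (induction z rule: int_induct[where k = 0])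
    case base
    then show ?case using b0 by simp
  next
    case (step1 j)
    have "b (of_int j *\<^sub>R axis i 1 + of_int 1 *\<^sub>R axis i 1)
        = b (of_int j *\<^sub>R axis i 1) + b (of_int 1 *\<^sub>R axis i 1)"
      by (intro add integer_lattice_axis)
    then show ?case using step1.IH by (simp add: scaleR_left.add)
  next
    case (step2 j)
    have "b (of_int (j - 1) *\<^sub>R axis i 1 + of_int 1 *\<^sub>R axis i 1)
        = b (of_int (j - 1) *\<^sub>R axis i 1) + b (of_int 1 *\<^sub>R axis i 1)"
      by (intro add integer_lattice_axis)
    then show ?case using step2.IH by (simp add: scaleR_left.diff scaleR_left.add eq_diff_eq)
  qed
  have "b (\<Sum>i\<in>I. m $ i *\<^sub>R axis i 1) = (\<Sum>i\<in>I. m $ i *\<^sub>R b (axis i 1))" for I :: "'n set"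
    using finite[of I]
  proof (induction I rule: finite_induct)
    case empty
    then show ?case using b0 by simp
  next
    case (insert x I)
    obtain z where z: "m $ x = of_int z" using m by (auto simp: integer_lattice_def Ints_def)
    have *: "m $ i *\<^sub>R axis i 1 \<in> integer_lattice" for i
    proof -
      obtain z where "m $ i = of_int z" using m by (auto simp: integer_lattice_def Ints_def)
      then show ?thesis using integer_lattice_axis[of z i] by simp
    qed
    have "b (m $ x *\<^sub>R axis x 1 + (\<Sum>i\<in>I. m $ i *\<^sub>R axis i 1))
        = b (m $ x *\<^sub>R axis x 1) + b (\<Sum>i\<in>I. m $ i *\<^sub>R axis i 1)"
      by (intro add integer_lattice_sum *)
    then show ?case using insert step[of z x] by (simp add: z)
  qed
  moreover have "(\<Sum>i\<in>UNIV. m $ i *\<^sub>R axis i 1) = m"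
    using basis_expansion[of m] by (simp add: scalar_mult_eq_scaleR)
  ultimately show ?thesis by metis
qed

lemma lattice_translate_into_cube:
  fixes x :: "real^'n"
  obtains m where "m \<in> integer_lattice" "x - m \<in> cbox 0 1"
proof
  show "(\<chi> i. of_int \<lfloor>x $ i\<rfloor>) \<in> integer_lattice" by (simp add: integer_lattice_def)
  have "0 \<le> x $ i - of_int \<lfloor>x $ i\<rfloor>" "x $ i - of_int \<lfloor>x $ i\<rfloor> \<le> 1" for i by linarith+
  then show "x - (\<chi> i. of_int \<lfloor>x $ i\<rfloor>) \<in> cbox 0 1"
    by (simp add: mem_box_cart)
qed

lemma bounded_lattice_periodic:
  fixes f :: "real^'n \<Rightarrow> 'b::metric_space"
  assumes "continuous_on UNIV f" "\<And>m x. m \<in> integer_lattice \<Longrightarrow> f (x + m) = f x"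
  shows "bounded (range f)"
proof -
  have "range f \<subseteq> f ` cbox 0 1"
  proof
    fix y assume "y \<in> range f"
    then obtain x where x: "y = f x" by blast
    obtain m where m: "m \<in> integer_lattice" "x - m \<in> cbox 0 1" by (rule lattice_translate_into_cube)
    have "f (x - m) = f x" using assms(2)[OF m(1), of "x - m"] by simp
    then show "y \<in> f ` cbox 0 1" using m(2) x by (metis imageI)
  qed
  moreover have "compact (f ` cbox 0 1)"
    using assms(1) by (intro compact_continuous_image) (auto intro: continuous_on_subset)
  ultimately show ?thesis using bounded_subset compact_imp_bounded by blast
qed

lemma bounded_affine_imp_zero:
  fixes L :: "'a::real_normed_vector \<Rightarrow> 'b::real_normed_vector"
  assumes "linear L" "\<And>z. norm (L z + b) \<le> C"
  shows "L z = 0"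
proof (rule ccontr)
  assume nz: "L z \<noteq> 0"
  \<comment> \<open>A multiple of z for which \<open>L (t *\<^sub>R z)\<close> has norm
    \<open>C + norm b + 1\<close>, one more than the bound permits.\<close>
  define t where "t = (C + norm b + 1) / norm (L z)"
  have C: "0 \<le> C" using assms(2) norm_ge_zero order_trans by blast
  have "norm (L (t *\<^sub>R z)) \<le> norm (L (t *\<^sub>R z) + b) + norm b"
    by (metis add_diff_cancel_right' norm_triangle_ineq4)
  then have "norm (L (t *\<^sub>R z)) \<le> C + norm b" using assms(2)[of "t *\<^sub>R z"] by linarith
  moreover have "norm (L (t *\<^sub>R z)) = C + norm b + 1"
    using nz C by (simp add: linear_cmul[OF assms(1)] t_def)
  ultimately show False by simp
qed

section \<open>Deck transformations of the developing map\<close>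

locale flat_torus_space = flat_space g for g :: "real^'n \<Rightarrow> real^'n \<Rightarrow> real^'n \<Rightarrow> real" +
  assumes periodic: "m \<in> integer_lattice \<Longrightarrow> g (x + m) v w = g x v w"
begin

lemma local_isometry_translate:
  assumes D: "local_isometry g UNIV D" and m: "m \<in> integer_lattice"
  shows "local_isometry g UNIV (\<lambda>x. D (x + m))"
proof (rule local_isometryI)
  have sm: "smooth_on UNIV (\<lambda>x::real^'n. x + m)"
    by (rule smooth_on_add[OF open_UNIV smooth_on_linear_map[OF bounded_linear_ident] smooth_on_const])
  show "smooth_on UNIV (\<lambda>x. D (x + m))"
    by (rule smooth_on_compose[OF open_UNIV open_UNIV _ local_isometryD(2)[OF D] sm]) simp
  fix y v w
  have "((\<lambda>x. x + m) has_derivative (\<lambda>v. v)) (at y)" by (auto intro!: derivative_eq_intros)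
  from has_derivative_compose[OF this local_isometry_derivative(1)[OF D UNIV_I]]
  have "frechet_derivative (\<lambda>x. D (x + m)) (at y) = frechet_derivative D (at (y + m))"
    by (metis frechet_derivative_at)
  then show "frechet_derivative (\<lambda>x. D (x + m)) (at y) v \<bullet> frechet_derivative (\<lambda>x. D (x + m)) (at y) w = g y v w"
    using local_isometryD(3)[OF D UNIV_I] periodic[OF m] by simp
  from local_isometryD(4)[OF D UNIV_I, of "y + m"]
  obtain U where U: "open U" "y + m \<in> U" "inj_on D U" by blast
  have "open ((\<lambda>x. x + m) -` U)"
    using U(1) by (intro open_vimage) (auto intro!: continuous_intros)
  moreover have "inj_on (\<lambda>x. D (x + m)) ((\<lambda>x. x + m) -` U)"
    using U(3) unfolding inj_on_def by (metis add_right_cancel vimageD)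
  ultimately show "\<exists>U. open U \<and> y \<in> U \<and> inj_on (\<lambda>x. D (x + m)) U"
    using U(2) by (intro exI[of _ "(\<lambda>x. x + m) -` U"]) simp
qed simp

lemma local_isometry_open_range:
  assumes D: "local_isometry g UNIV D" and "open U"
  shows "open (D ` U)"
  unfolding open_subopen[of "D ` U"]
proof
  fix y assume "y \<in> D ` U"
  then obtain x where x: "x \<in> U" "y = D x" by blast
  from local_isometryD(4)[OF D UNIV_I, of x] obtain V where V: "open V" "x \<in> V" "inj_on D V" by blast
  have "continuous_on (U \<inter> V) D"
    using smooth_on_imp_continuous_on[OF local_isometryD(2)[OF D]] continuous_on_subset by blast
  moreover have "inj_on D (U \<inter> V)" using V(3) inj_on_subset by blast
  ultimately have "open (D ` (U \<inter> V))"
    using invariance_of_domain V(1) \<open>open U\<close> by blast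
  then show "\<exists>T. open T \<and> y \<in> T \<and> T \<subseteq> D ` U"
    using x V(2) by (intro exI[of _ "D ` (U \<inter> V)"]) auto
qed

lemma equivariance:
  assumes D: "local_isometry g UNIV D"
  shows "\<exists>Q b. \<forall>m\<in>integer_lattice. orthogonal_transformation (Q m) \<and> (\<forall>x. D (x + m) = Q m (D x) + b m)"
proof -
  have "\<forall>m\<in>integer_lattice. \<exists>Qb. orthogonal_transformation (fst Qb) \<and> (\<forall>x. D (x + m) = fst Qb (D x) + snd Qb)"
  proof
    fix m :: "real^'n" assume m: "m \<in> integer_lattice"
    obtain Q b where "orthogonal_transformation Q" "\<And>x. x \<in> UNIV \<Longrightarrow> D (x + m) = Q (D x) + b"
      by (rule local_isometry_rigid[OF D local_isometry_translate[OF D m] connected_UNIV UNIV_not_empty])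
        (rule that)
    then show "\<exists>Qb. orthogonal_transformation (fst Qb) \<and> (\<forall>x. D (x + m) = fst Qb (D x) + snd Qb)"
      by (intro exI[of _ "(Q, b)"]) simp
  qed
  from bchoice[OF this] obtain f where
    "\<forall>m\<in>integer_lattice. orthogonal_transformation (fst (f m)) \<and> (\<forall>x. D (x + m) = fst (f m) (D x) + snd (f m))"
    by blast
  then show ?thesis by (intro exI[of _ "fst \<circ> f"] exI[of _ "snd \<circ> f"]) simp
qed

text \<open>The range is open. It is also closed: the compact image of the unit cube has an
  e-neighbourhood inside the range, and the rigid motions with linear part \<open>Q m\<close> carry
  it to every other point of the range with the same e.\<close>

lemma local_isometry_surj:
  assumes D: "local_isometry g UNIV D"
  shows "surj D"
proof -
  obtain Q b where Qb: "\<And>m. m \<in> integer_lattice \<Longrightarrow> orthogonal_transformation (Q m)"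
    "\<And>m x. m \<in> integer_lattice \<Longrightarrow> D (x + m) = Q m (D x) + b m"
    using equivariance[OF D] by blast
  have op: "open (range D)" using local_isometry_open_range[OF D open_UNIV] .
  have "continuous_on (cbox 0 1) D"
    using smooth_on_imp_continuous_on[OF local_isometryD(2)[OF D]] continuous_on_subset by blast
  then have "compact (D ` cbox 0 1)" by (rule compact_continuous_image[OF _ compact_cbox])
  then obtain e where e: "e > 0" "(\<Union>x\<in>D ` cbox 0 1. ball x e) \<subseteq> range D"
    using compact_subset_open_imp_ball_epsilon_subset[OF _ op, of "D ` cbox 0 1"] by blast
  have ball: "p \<in> range D" if p: "dist (D x) p < e" for x p
  proof -
    obtain m where m: "m \<in> integer_lattice" "x - m \<in> cbox 0 1" by (rule lattice_translate_into_cube)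
    have orth: "orthogonal_transformation (Q m)" using Qb(1)[OF m(1)] .
    then obtain q where q: "Q m q = p - b m" using orthogonal_transformation_surj by (metis surjD)
    have "D x = Q m (D (x - m)) + b m" using Qb(2)[OF m(1), of "x - m"] by simp
    then have "dist (D x) p = dist (Q m (D (x - m))) (Q m q)" using q
      by (simp add: dist_norm) (metis (no_types, lifting) add.commute add_diff_cancel_left' diff_add_eq diff_diff_eq2)
    also have "\<dots> = dist (D (x - m)) q" using orth orthogonal_transformation_isometry by blast
    finally have "q \<in> (\<Union>x\<in>D ` cbox 0 1. ball x e)" using p m(2) by auto
    then obtain z where z: "q = D z" using e(2) by blast
    have "D (z + m) = p" using Qb(2)[OF m(1), of z] q by (simp add: z)
    then show ?thesis by blast
  qed
  have "closed (range D)"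
    unfolding closed_def open_dist
  proof (intro ballI)
    fix p assume p: "p \<in> - range D"
    show "\<exists>e>0. \<forall>y. dist y p < e \<longrightarrow> y \<in> - range D"
      using ball p e(1) by (intro exI[of _ e]) (auto simp: dist_commute)
  qed
  then show ?thesis using op clopen[of "range D"] by auto
qed

lemma equivariance_translations:
  assumes D: "local_isometry g UNIV D"
  obtains B where "linear B" "bij B" "\<And>m x. m \<in> integer_lattice \<Longrightarrow> D (x + m) = D x + B m"
proof -
  obtain Q b where Qb: "\<And>m. m \<in> integer_lattice \<Longrightarrow> orthogonal_transformation (Q m)"
    "\<And>m x. m \<in> integer_lattice \<Longrightarrow> D (x + m) = Q m (D x) + b m"
    using equivariance[OF D] by blast
  have cont: "continuous_on UNIV D" by (rule smooth_on_imp_continuous_on[OF local_isometryD(2)[OF D]])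
  have cont_shift: "continuous_on UNIV (\<lambda>x. D (x + m))" for m
    by (rule continuous_on_compose2[OF cont]) (auto intro!: continuous_intros)
  have surj: "surj D" using local_isometry_surj[OF D] .
  \<comment> \<open>The displacement of a deck transformation is invariant under the commutative deck group,
    hence bounded, which leaves no room for a rotational part.\<close>
  have Q: "Q m z = z" if m: "m \<in> integer_lattice" for m z
  proof -
    let ?f = "\<lambda>x. norm (D (x + m) - D x)"
    have "bounded (range ?f)"
    proof (rule bounded_lattice_periodic)
      show "continuous_on UNIV ?f"
        by (intro continuous_intros cont cont_shift)
      fix k x :: "real^'n" assume k: "k \<in> integer_lattice"
      have lin: "linear (Q k)" using Qb(1)[OF k] orthogonal_transformation_linear by blast
      have "D (x + k + m) - D (x + k) = Q k (D (x + m) - D x)"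
        using Qb(2)[OF k, of "x + m"] Qb(2)[OF k, of x] by (simp add: linear_diff[OF lin] add_ac)
      then show "?f (x + k) = ?f x"
        using orthogonal_transformation_norm[OF Qb(1)[OF k]] by simp
    qed
    then obtain C where C: "?f x \<le> C" for x
      unfolding bounded_iff by (auto simp: abs_le_iff)
    have lin: "linear (\<lambda>z. Q m z - z)"
      using orthogonal_transformation_linear[OF Qb(1)[OF m]] by (intro linear_compose_sub linear_ident)
    have "norm ((Q m z - z) + b m) \<le> C" for z
    proof -
      obtain x where "z = D x" using surj by (metis surjD)
      then show ?thesis using C[of x] Qb(2)[OF m, of x] by (simp add: algebra_simps)
    qed
    then have "Q m z - z = 0" by (rule bounded_affine_imp_zero[OF lin])
    then show ?thesis by simp
  qed
  have shift: "D (x + m) = D x + b m" if "m \<in> integer_lattice" for x m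
    using Qb(2)[OF that] Q[OF that] by simp
  have add: "b (m + k) = b m + b k" if "m \<in> integer_lattice" "k \<in> integer_lattice" for m k
    using shift[OF integer_lattice_add[OF that], of 0] shift[OF that(2), of m] shift[OF that(1), of 0]
    by simp
  \<comment> \<open>On the lattice b is additive; B is its linear extension to the whole
    space.\<close>
  define B where "B y = (\<Sum>i\<in>UNIV. y $ i *\<^sub>R b (axis i 1))" for y :: "real^'n"
  have bB: "b m = B m" if "m \<in> integer_lattice" for m
    unfolding B_def by (rule lattice_additive_eq[OF add that])
  have B: "linear B"
    unfolding B_def by (rule linearI) (simp_all add: scaleR_left.add sum.distrib scaleR_sum_right)
  have DB: "D (x + m) = D x + B m" if "m \<in> integer_lattice" for x m
    using shift[OF that] bB[OF that] by simp
  have "surj B"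
  proof (rule ccontr)
    assume "\<not> surj B"
    then have "span (range B) \<noteq> UNIV" using B by (simp add: span_eq_iff[THEN iffD2] linear_subspace_image)
    then have "dim (range B) < DIM(real^'n)"
      using dim_eq_full dim_subset_UNIV by (metis le_neq_implies_less)
    then obtain c where c: "c \<noteq> 0" "\<And>y. y \<in> span (range B) \<Longrightarrow> orthogonal c y"
      using orthogonal_to_subspace_exists by blast
    have cB: "c \<bullet> B x = 0" for x using c(2)[of "B x"] by (simp add: orthogonal_def span_base)
    \<comment> \<open>For c orthogonal to the range of B this component of D is lattice-periodic,
      hence bounded, which contradicts the surjectivity of D.\<close>
    let ?f = "\<lambda>x. c \<bullet> D x"
    have "bounded (range ?f)"
    proof (rule bounded_lattice_periodic)
      show "continuous_on UNIV ?f" by (intro continuous_intros cont)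
      show "?f (x + k) = ?f x" if "k \<in> integer_lattice" for k x
        using DB[OF that, of x] cB by (simp add: inner_add_right)
    qed
    then obtain C where C: "norm (?f x) \<le> C" for x
      unfolding bounded_iff by auto
    have "norm (c \<bullet> z + 0) \<le> C" for z
    proof -
      obtain x where "z = D x" using surj by (metis surjD)
      then show ?thesis using C[of x] by simp
    qed
    from bounded_affine_imp_zero[where L = "(\<bullet>) c", OF _ this, of c] have "c \<bullet> c = 0"
      by (simp add: linear_iff inner_add_right)
    then show False using c(1) by simp
  qed
  then have "bij B" using linear_surjective_imp_injective[OF B] by (simp add: bij_def)
  then show thesis using that B DB by blast
qed

text \<open>Near each point local inverses exist with some common radius, and finitely many such
  radii serve the unit cube. Translation by m in the source is translation by \<open>B m\<close> in
  the target, so the least of them works everywhere.\<close>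

lemma local_isometry_uniform_sections:
  assumes D: "local_isometry g UNIV D"
  obtains r where "r > 0"
    "\<And>x. \<exists>s. continuous_on (ball (D x) r) s \<and> s (D x) = x \<and> (\<forall>q\<in>ball (D x) r. D (s q) = q)"
proof -
  obtain B where "linear B" "bij B" and B: "\<And>m x. m \<in> integer_lattice \<Longrightarrow> D (x + m) = D x + B m"
    by (rule equivariance_translations[OF D]) (rule that)
  have cont: "continuous_on S D" for S
    using smooth_on_imp_continuous_on[OF local_isometryD(2)[OF D]] continuous_on_subset by blast
  let ?sec = "\<lambda>x r. \<exists>s. continuous_on (ball (D x) r) s \<and> s (D x) = x \<and> (\<forall>q\<in>ball (D x) r. D (s q) = q)"
  have sec_mono: "?sec x r'" if "?sec x r" "r' \<le> r" for x r r'
  proof -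
    from that(1) obtain s where s: "continuous_on (ball (D x) r) s" "s (D x) = x" "\<forall>q\<in>ball (D x) r. D (s q) = q"
      by blast
    have "ball (D x) r' \<subseteq> ball (D x) r" using that(2) by (rule subset_ball)
    then show ?thesis using s continuous_on_subset by (intro exI[of _ s]) blast
  qed
  have "\<exists>W r. open W \<and> a \<in> W \<and> r > 0 \<and> (\<forall>x\<in>W. ?sec x r)" for a
  proof -
    from local_isometryD(4)[OF D UNIV_I, of a] obtain U where U: "open U" "a \<in> U" "inj_on D U" by blast
    have oDU: "open (D ` U)" using local_isometry_open_range[OF D U(1)] .
    then obtain e where e: "e > 0" "ball (D a) e \<subseteq> D ` U"
      using U(2) by (meson imageI open_contains_ball)
    obtain s where s: "homeomorphism U (D ` U) D s"
      using invariance_of_domain_homeomorphism[OF U(1) cont _ U(3)] by blast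
    \<comment> \<open>With e halved, the ball of radius \<open>e / 2\<close> about
      \<open>D x\<close> stays inside the image of U for all x in W, not only for a.\<close>
    define W where "W = U \<inter> D -` ball (D a) (e / 2)"
    have "open W" unfolding W_def
      using cont[of U] U(1) by (simp add: continuous_on_open_vimage Int_commute)
    moreover have "a \<in> W" using U(2) e(1) by (simp add: W_def)
    moreover have "?sec x (e / 2)" if x: "x \<in> W" for x
    proof (intro exI conjI ballI)
      have sub: "ball (D x) (e / 2) \<subseteq> D ` U"
      proof
        fix q assume "q \<in> ball (D x) (e / 2)"
        then have "dist (D a) q < e" using x dist_triangle[of "D a" q "D x"] by (simp add: W_def)
        then show "q \<in> D ` U" using e(2) by auto
      qed
      show "continuous_on (ball (D x) (e / 2)) s"
        using homeomorphism_cont2[OF s] sub continuous_on_subset by blast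
      show "s (D x) = x" using homeomorphism_apply1[OF s] x by (simp add: W_def)
      show "D (s q) = q" if "q \<in> ball (D x) (e / 2)" for q
        using homeomorphism_apply2[OF s subsetD[OF sub that]] .
    qed
    ultimately show ?thesis using e(1) by (intro exI[of _ W] exI[of _ "e / 2"]) auto
  qed
  then have "\<forall>a. \<exists>Wr. open (fst Wr) \<and> a \<in> fst Wr \<and> snd Wr > 0 \<and> (\<forall>x\<in>fst Wr. ?sec x (snd Wr))"
    by (metis fst_conv snd_conv)
  from choice[OF this] obtain f where
    "\<forall>a. open (fst (f a)) \<and> a \<in> fst (f a) \<and> snd (f a) > 0 \<and> (\<forall>x\<in>fst (f a). ?sec x (snd (f a)))" by blast
  then have f: "open (fst (f a))" "a \<in> fst (f a)" "snd (f a) > 0" "x \<in> fst (f a) \<Longrightarrow> ?sec x (snd (f a))" for a x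
    by simp_all
  have "cbox 0 (1::real^'n) \<subseteq> (\<Union>a\<in>UNIV. fst (f a))" using f(2) by blast
  then obtain A where A: "finite A" "cbox 0 (1::real^'n) \<subseteq> (\<Union>a\<in>A. fst (f a))"
    using compactE_image[OF compact_cbox[of 0 "1::real^'n"], of UNIV "\<lambda>a. fst (f a)"] f(1) by metis
  define r where "r = Min (insert 1 ((\<lambda>a. snd (f a)) ` A))"
  have r0: "r > 0" unfolding r_def using A(1) f(3) by simp
  have "?sec x r" for x
  proof -
    obtain m where m: "m \<in> integer_lattice" "x - m \<in> cbox 0 1" by (rule lattice_translate_into_cube)
    then obtain a where a: "a \<in> A" "x - m \<in> fst (f a)" using A(2) by blast
    have "r \<le> snd (f a)" unfolding r_def using A(1) a(1) by simp
    from sec_mono[OF f(4)[OF a(2)] this]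
    obtain s where s: "continuous_on (ball (D (x - m)) r) s" "s (D (x - m)) = x - m"
      "\<forall>q\<in>ball (D (x - m)) r. D (s q) = q" by blast
    have Dx: "D x = D (x - m) + B m" using B[OF m(1), of "x - m"] by simp
    show ?thesis
    proof (intro exI[of _ "\<lambda>q. s (q - B m) + m"] conjI ballI)
      show "continuous_on (ball (D x) r) (\<lambda>q. s (q - B m) + m)"
        by (intro continuous_intros continuous_on_compose2[OF s(1)])
          (auto simp: Dx dist_norm algebra_simps)
      show "s (D x - B m) + m = x" using s(2) by (simp add: Dx)
      fix q assume "q \<in> ball (D x) r"
      then have "q - B m \<in> ball (D (x - m)) r" by (simp add: Dx dist_norm algebra_simps)
      then show "D (s (q - B m) + m) = q" using s(3) B[OF m(1)] by simp
    qed
  qed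
  with r0 show thesis by (rule that)
qed

text \<open>In the coordinates \<open>\<Psi>\<close> the metric has constant coefficients, given by the Gram matrix
  of the columns of \<open>B\<close>.\<close>

theorem normal_form:
 obtains \<Psi> \<Theta> B :: "real^'n \<Rightarrow> real^'n" where "linear B" "bij B" "smooth_on UNIV \<Psi>" "smooth_on UNIV \<Theta>"
    "\<And>x. \<Theta> (\<Psi> x) = x" "\<And>y. \<Psi> (\<Theta> y) = y"
    "\<And>m x. m \<in> integer_lattice \<Longrightarrow> \<Psi> (x + m) = \<Psi> x + m"
    "\<And>x. bij (frechet_derivative \<Psi> (at x))"
    "\<And>x v w. B (frechet_derivative \<Psi> (at x) v) \<bullet> B (frechet_derivative \<Psi> (at x) w) = g x v w"
    "\<And>y v. frechet_derivative \<Psi> (at (\<Theta> y)) (frechet_derivative \<Theta> (at y) v) = v"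
proof -
  obtain D where D: "local_isometry g UNIV D" using developing_map by blast
  obtain B where B: "linear B" "bij B" and DB: "\<And>m x. m \<in> integer_lattice \<Longrightarrow> D (x + m) = D x + B m"
    by (rule equivariance_translations[OF D]) (rule that)
  have cont: "continuous_on UNIV D" by (rule smooth_on_imp_continuous_on[OF local_isometryD(2)[OF D]])
  obtain r where r: "r > 0"
    "\<And>x. \<exists>s. continuous_on (ball (D x) r) s \<and> s (D x) = x \<and> (\<forall>q\<in>ball (D x) r. D (s q) = q)"
    by (rule local_isometry_uniform_sections[OF D]) (rule that)
  obtain s where s: "continuous_on UNIV s" "\<And>q. D (s q) = q" "\<And>x. s (D x) = x"
    by (rule uniform_local_sections_inverse[OF local_isometryD(4)[OF D UNIV_I] cont local_isometry_surj[OF D] r])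
      (rule that)
  define B' where "B' = inv_into UNIV B"
  have B'B: "B' (B x) = x" "B (B' x) = x" for x
    using B(2) by (simp_all add: B'_def bij_is_inj bij_is_surj surj_f_inv_f)
  have lB': "linear B'" unfolding B'_def using inj_linear_imp_inv_linear[OF B(1)] B(2) bij_is_inj by blast
  then have bB': "bounded_linear B'" using linear_conv_bounded_linear by blast
  have bB: "bounded_linear B" using B(1) linear_conv_bounded_linear by blast
  \<comment> \<open>Composing with the inverse of B turns \<open>D (x + m) = D x + B m\<close> into
    plain lattice equivariance and moves all information on the metric into B.\<close>
  define \<Psi> where "\<Psi> x = B' (D x)" for x
  define \<Theta> where "\<Theta> y = s (B y)" for y
  have inv: "\<Theta> (\<Psi> x) = x" "\<Psi> (\<Theta> y) = y" for x y
    by (simp_all add: \<Psi>_def \<Theta>_def B'B s)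
  have D': "frechet_derivative \<Psi> (at x) = (\<lambda>v. B' (frechet_derivative D (at x) v))" for x
    unfolding \<Psi>_def
    using bounded_linear.has_derivative[OF bB' local_isometry_derivative(1)[OF D UNIV_I]]
    by (metis frechet_derivative_at)
  have bij: "bij (frechet_derivative \<Psi> (at x))" for x
  proof -
    have "bij B'" unfolding B'_def using B(2) bij_imp_bij_inv by blast
    from bij_comp[OF local_isometry_derivative(3)[OF D UNIV_I] this] show ?thesis
      by (simp add: D' comp_def)
  qed
  have sm: "smooth_on UNIV \<Psi>"
    unfolding \<Psi>_def by (rule smooth_on_linear[OF bB' open_UNIV local_isometryD(2)[OF D]])
  have c\<Theta>: "continuous_on UNIV \<Theta>"
    unfolding \<Theta>_def by (rule continuous_on_compose2[OF s(1) linear_continuous_on[OF bB]]) simp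
  have inj: "inj (frechet_derivative \<Psi> (at x))" for x using bij by (rule bij_is_inj)
  show thesis
  proof (rule that[of B \<Psi> \<Theta>])
    show "smooth_on UNIV \<Theta>" by (rule smooth_on_inverse_function(1)[OF sm inv c\<Theta> inj])
    show "frechet_derivative \<Psi> (at (\<Theta> y)) (frechet_derivative \<Theta> (at y) v) = v" for y v
      by (rule smooth_on_inverse_function(2)[OF sm inv c\<Theta> inj])
    show "\<Psi> (x + m) = \<Psi> x + m" if "m \<in> integer_lattice" for m x
      by (simp add: \<Psi>_def DB[OF that] linear_add[OF lB'] B'B)
    show "B (frechet_derivative \<Psi> (at x) v) \<bullet> B (frechet_derivative \<Psi> (at x) w) = g x v w" for x v w
      by (simp add: D' B'B local_isometry_derivative(4)[OF D])
  qed (fact B sm inv bij)+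
qed

end

section \<open>Integration over fundamental domains of the integer lattice\<close>

text \<open>The library states the change of variables formula for a well-ordered index type. This is
  an order-equipped copy of a finite type to which the formula can be transferred.\<close>

typedef 'a ordered_copy = "UNIV :: 'a set" morphisms of_copy to_copy
  by simp

lemma of_copy_to_copy [simp]: "of_copy (to_copy x) = x"
  and to_copy_of_copy [simp]: "to_copy (of_copy y) = y"
  by (simp_all add: to_copy_inverse of_copy_inverse)

lemma bij_to_copy: "bij to_copy"
  by (rule bij_betw_byWitness[where f' = of_copy]) auto

instantiation ordered_copy :: (finite) "{finite, wellorder}"
begin

definition less_eq_ordered_copy :: "'a ordered_copy \<Rightarrow> 'a ordered_copy \<Rightarrow> bool"
  where "less_eq_ordered_copy x y \<longleftrightarrow> to_nat (of_copy x) \<le> to_nat (of_copy y)"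

definition less_ordered_copy :: "'a ordered_copy \<Rightarrow> 'a ordered_copy \<Rightarrow> bool"
  where "less_ordered_copy x y \<longleftrightarrow> to_nat (of_copy x) < to_nat (of_copy y)"

instance
proof
  fix x y z :: "'a ordered_copy"
  show "(x < y) = (x \<le> y \<and> \<not> y \<le> x)" "x \<le> x" "x \<le> y \<or> y \<le> x"
    by (auto simp: less_eq_ordered_copy_def less_ordered_copy_def)
  show "x \<le> z" if "x \<le> y" "y \<le> z"
    using that by (simp add: less_eq_ordered_copy_def)
  show "x = y" if "x \<le> y" "y \<le> x"
    using that by (simp add: less_eq_ordered_copy_def of_copy_inject)
  have "finite (range (to_copy :: 'a \<Rightarrow> _))" by simp
  then show "finite (UNIV :: 'a ordered_copy set)"
    unfolding bij_is_surj[OF bij_to_copy] .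
  fix P :: "'a ordered_copy \<Rightarrow> bool" and a
  assume step: "\<And>x. (\<And>y. y < x \<Longrightarrow> P y) \<Longrightarrow> P x"
  show "P a"
  proof (induction a rule: measure_induct_rule[where f = "\<lambda>x. to_nat (of_copy x)"])
    case (less x)
    show ?case by (rule step, rule less) (simp add: less_ordered_copy_def)
  qed
qed

end

text \<open>Conjugation by f is a bijection between the permutations of the two index types and
  preserves signs, so the Leibniz sums match term by term.\<close>

lemma det_reindex:
  fixes A :: "real^'n^'n" and f :: "'m::finite \<Rightarrow> 'n"
  assumes "bij f"
  shows "det (\<chi> i j. A $ f i $ f j) = det A"
proof -
  let ?conj = "\<lambda>p x. if x \<in> (UNIV::'n set) then f (p (inv_into UNIV f x)) else x"
  have bij: "bij_betw ?conj {p. p permutes (UNIV::'m set)} {p. p permutes (UNIV::'n set)}"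
    by (rule bij_betw_permutations) (use assms in simp)
  have sign: "sign (?conj p) = sign p" if "p permutes (UNIV::'m set)" for p
  proof -
    interpret permutes_bij_finite p UNIV UNIV f "inv_into UNIV f" "?conj p"
    proof unfold_locales
    qed (use that assms in \<open>auto simp: bij_is_inj bij_is_surj surj_f_inv_f\<close>)
    show ?thesis by (rule sign_p')
  qed
  have prod: "(\<Prod>i\<in>UNIV. A $ f i $ f (p i)) = (\<Prod>i\<in>UNIV. A $ i $ ?conj p i)" for p
  proof -
    have "(\<Prod>i\<in>UNIV. A $ f i $ f (p i)) = (\<Prod>i\<in>UNIV. A $ f i $ ?conj p (f i))"
      using assms by (simp add: bij_is_inj)
    also have "\<dots> = (\<Prod>i\<in>UNIV. A $ i $ ?conj p i)"
      by (rule prod.reindex_bij_betw[where g = "\<lambda>i. A $ i $ ?conj p i"]) (use assms in simp)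
    finally show ?thesis .
  qed
  have "det A = (\<Sum>p\<in>{p. p permutes (UNIV::'m set)}.
      of_int (sign (?conj p)) * (\<Prod>i\<in>UNIV. A $ i $ ?conj p i))"
    unfolding det_def by (rule sum.reindex_bij_betw[OF bij, symmetric])
  also have "\<dots> = det (\<chi> i j. A $ f i $ f j)"
    unfolding det_def by (rule sum.cong[OF refl]) (simp only: mem_Collect_eq sign prod vec_lambda_beta)
  finally show ?thesis by simp
qed

definition reindex_vec :: "('m::finite \<Rightarrow> 'n::finite) \<Rightarrow> real^'n \<Rightarrow> real^'m"
  where "reindex_vec f x = (\<chi> i. x $ f i)"

lemma linear_reindex_vec: "linear (reindex_vec f)"
  by (rule linearI) (simp_all add: reindex_vec_def vec_eq_iff)

lemma reindex_vec_inverse: "(\<And>x. f (g x) = x) \<Longrightarrow> reindex_vec g (reindex_vec f x) = x"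
  by (simp add: reindex_vec_def vec_eq_iff)

lemma reindex_vec_image_cbox:
  assumes "\<And>x. f (g x) = x" "\<And>x. g (f x) = x"
  shows "reindex_vec f ` cbox u v = cbox (reindex_vec f u) (reindex_vec f v)"
proof (intro equalityI subsetI)
  fix y assume y: "y \<in> cbox (reindex_vec f u) (reindex_vec f v)"
  have "reindex_vec g y \<in> cbox u v"
    unfolding mem_box_cart
  proof
    fix i
    show "u $ i \<le> reindex_vec g y $ i \<and> reindex_vec g y $ i \<le> v $ i"
      using y[unfolded mem_box_cart, rule_format, of "g i"] assms by (simp add: reindex_vec_def)
  qed
  then show "y \<in> reindex_vec f ` cbox u v"
    using reindex_vec_inverse[of g f y] assms by (metis imageI)
qed (auto simp: mem_box_cart reindex_vec_def)

text \<open>Relabelling coordinates maps boxes to boxes of equal volume, so the factor in the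
  substitution rule is 1.\<close>

lemma has_integral_reindex_vec:
  fixes F :: "real^'m::finite \<Rightarrow> real" and f :: "'m \<Rightarrow> 'n::finite"
  assumes fg: "\<And>x. f (g x) = x" "\<And>x. g (f x) = x"
    and F: "(F has_integral y) (cbox u v)"
  shows "((\<lambda>x. F (reindex_vec f x)) has_integral y) (cbox (reindex_vec g u) (reindex_vec g v))"
proof -
  have "bij f" by (rule bij_betw_byWitness[where f' = g]) (use fg in auto)
  have "((\<lambda>x. F (reindex_vec f x)) has_integral (1 / 1) *\<^sub>R y) (reindex_vec g ` cbox u v)"
  proof (rule has_integral_twiddle[OF zero_less_one _ _ _ _ _ _ F])
    show "reindex_vec g (reindex_vec f x) = x" for x using reindex_vec_inverse fg by blast
    show "reindex_vec f (reindex_vec g x) = x" for x using reindex_vec_inverse fg by blast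
    show "continuous (at x) (reindex_vec f)" for x
      using linear_continuous_at linear_reindex_vec linear_conv_bounded_linear by blast
    show "\<exists>w z. reindex_vec f ` cbox u v = cbox w z" for u v
      using reindex_vec_image_cbox[OF fg] by blast
    show "\<exists>w z. reindex_vec g ` cbox u v = cbox w z" for u v
      using reindex_vec_image_cbox[OF fg(2,1)] by blast
    fix u v :: "real^'n"
    show "measure lborel (reindex_vec f ` cbox u v) = 1 * measure lborel (cbox u v)"
    proof (cases "cbox u v = {}")
      case False
      then have "cbox (reindex_vec f u) (reindex_vec f v) \<noteq> {}"
        using reindex_vec_image_cbox[OF fg] by (metis image_is_empty)
      then have "measure lborel (reindex_vec f ` cbox u v) = (\<Prod>i\<in>UNIV. v $ f i - u $ f i)"
        unfolding reindex_vec_image_cbox[OF fg] by (simp add: content_cbox_cart reindex_vec_def)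
      also have "\<dots> = (\<Prod>i\<in>UNIV. v $ i - u $ i)"
        by (rule prod.reindex_bij_betw[where g = "\<lambda>i. v $ i - u $ i"]) (use \<open>bij f\<close> in simp)
      finally show ?thesis using False by (simp add: content_cbox_cart)
    qed simp
  qed
  then show ?thesis unfolding reindex_vec_image_cbox[OF fg(2,1)] by simp
qed

text \<open>The tiling by lattice translates is strict, not merely up to null sets. The closed cube
  fails this on its faces, hence the half-open cube below.\<close>

definition fundamental_domain :: "(real^'n) set \<Rightarrow> bool"
  where "fundamental_domain A \<longleftrightarrow>
    bounded A \<and> A \<in> sets lebesgue \<and> (\<forall>y. \<exists>!m. m \<in> integer_lattice \<and> y + m \<in> A)"

definition half_open_cube :: "(real^'n) set"
  where "half_open_cube = {x. \<forall>i. 0 \<le> x $ i \<and> x $ i < 1}"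

lemma half_open_cube_borel: "half_open_cube \<in> sets borel"
proof -
  have "half_open_cube = (\<Inter>i\<in>UNIV. {x::real^'n. 0 \<le> x $ i} \<inter> {x. x $ i < 1})"
    by (auto simp: half_open_cube_def)
  also have "\<dots> \<in> sets borel"
  proof (intro sets.finite_INT sets.Int)
    show "{x::real^'n. 0 \<le> x $ i} \<in> sets borel" for i
      by (intro borel_closed closed_Collect_le continuous_intros)
    show "{x::real^'n. x $ i < 1} \<in> sets borel" for i
      by (intro borel_open open_Collect_less continuous_intros)
  qed auto
  finally show ?thesis .
qed

lemma half_open_cube_subset: "half_open_cube \<subseteq> cbox 0 1"
  by (auto simp: half_open_cube_def mem_box_cart less_imp_le)

lemma half_open_cube_translate: "\<exists>!m. m \<in> integer_lattice \<and> y + m \<in> half_open_cube"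
proof (intro ex1I conjI)
  let ?m = "\<chi> i. - of_int \<lfloor>y $ i\<rfloor>"
  show "?m \<in> integer_lattice" by (simp add: integer_lattice_def)
  show "y + ?m \<in> half_open_cube" by (simp add: half_open_cube_def) linarith
  fix m assume m: "m \<in> integer_lattice \<and> y + m \<in> half_open_cube"
  show "m = ?m"
    unfolding vec_eq_iff
  proof
    fix i
    obtain z where "m $ i = of_int z" using m by (auto simp: integer_lattice_def Ints_def)
    moreover have "0 \<le> y $ i + m $ i" "y $ i + m $ i < 1" using m by (auto simp: half_open_cube_def)
    ultimately have "\<lfloor>y $ i\<rfloor> = - z" by linarith
    then show "m $ i = ?m $ i" using \<open>m $ i = of_int z\<close> by simp
  qed
qed

lemma fundamental_domain_half_open_cube: "fundamental_domain half_open_cube"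
  unfolding fundamental_domain_def
proof (intro conjI allI)
  show "bounded (half_open_cube :: (real^'n) set)"
    using bounded_subset[OF bounded_cbox half_open_cube_subset] .
  show "half_open_cube \<in> sets (lebesgue :: (real^'n) measure)"
    using half_open_cube_borel by (metis sets_completionI_sets sets_lborel)
qed (rule half_open_cube_translate)

lemma has_integral_half_open_cube:
  fixes f :: "real^'n \<Rightarrow> real"
  shows "(f has_integral y) half_open_cube \<longleftrightarrow> (f has_integral y) (cbox 0 1)"
proof (rule has_integral_spike_set_eq)
  have neg: "negligible (\<Union>i\<in>UNIV. {x::real^'n. x $ i = 1})"
  proof (rule negligible_Union)
    fix T assume "T \<in> range (\<lambda>i. {x::real^'n. x $ i = 1})"
    then show "negligible T"
      using negligible_standard_hyperplane[of "axis _ (1::real)" 1]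
      by (auto simp: cart_eq_inner_axis axis_in_Basis_iff)
  qed simp
  show "negligible {x \<in> half_open_cube - cbox 0 1. f x \<noteq> 0}"
  proof -
    have "{x \<in> half_open_cube - cbox 0 1. f x \<noteq> 0} = {}" using half_open_cube_subset by blast
    then show ?thesis by (metis negligible_empty)
  qed
  show "negligible {x \<in> cbox 0 1 - half_open_cube. f x \<noteq> 0}"
    by (rule negligible_subset[OF neg])
      (auto simp: half_open_cube_def mem_box_cart order.order_iff_strict)
qed

lemma finite_bounded_lattice:
  assumes "bounded S"
  shows "finite (integer_lattice \<inter> S :: (real^'n) set)"
proof -
  obtain R where R: "\<And>x. x \<in> S \<Longrightarrow> norm x \<le> R" using assms by (auto simp: bounded_iff)
  let ?I = "{x \<in> \<int>. - R \<le> x \<and> x \<le> R}"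
  have "finite (PiE (UNIV::'n set) (\<lambda>_. ?I))"
    by (intro finite_PiE finite_int_segment) simp
  moreover have "integer_lattice \<inter> S \<subseteq> vec_lambda ` (PiE (UNIV::'n set) (\<lambda>_. ?I))"
  proof
    fix m assume m: "m \<in> integer_lattice \<inter> S"
    have "\<bar>m $ i\<bar> \<le> R" for i using component_le_norm_cart[of m i] R[of m] m by simp
    then have "(\<lambda>i. m $ i) \<in> PiE UNIV (\<lambda>_. ?I)"
      using m by (auto simp: integer_lattice_def abs_le_iff minus_le_iff)
    then show "m \<in> vec_lambda ` (PiE (UNIV::'n set) (\<lambda>_. ?I))"
      using imageI[of "\<lambda>i. m $ i" _ vec_lambda] by simp
  qed
  ultimately show ?thesis using finite_surj by blast
qed

lemma absolutely_integrable_continuous_bounded: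
  fixes f :: "'a::euclidean_space \<Rightarrow> 'b::euclidean_space"
  assumes "continuous_on UNIV f" "bounded A" "A \<in> sets lebesgue"
  shows "f absolutely_integrable_on A"
proof -
  obtain a where a: "A \<subseteq> cbox (-a) a" using bounded_subset_cbox_symmetric[OF assms(2)] by blast
  have "f absolutely_integrable_on cbox (-a) a"
    using assms(1) continuous_on_subset by (intro absolutely_integrable_continuous) blast
  then show ?thesis using set_integrable_subset[OF _ assms(3) a] by blast
qed

lemma has_integral_translate:
  fixes f :: "'a::euclidean_space \<Rightarrow> 'b::banach"
  assumes f: "(f has_integral y) S" and "bounded S"
  shows "((\<lambda>x. f (x + c)) has_integral y) {x. x + c \<in> S}"
proof -
  obtain a where a: "S \<subseteq> cbox (-a) a" using bounded_subset_cbox_symmetric[OF assms(2)] by blast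
  have "((\<lambda>x. if x \<in> S then f x else 0) has_integral y) (cbox (-a) a)"
    using f a by simp
  from has_integral_shift_cbox[OF this, of c]
  have "((\<lambda>x. if x \<in> {x. x + c \<in> S} then f (x + c) else 0) has_integral y) (cbox (-a - c) (a - c))"
    by simp
  moreover have "{x. x + c \<in> S} \<subseteq> cbox (-a - c) (a - c)"
    using a by (auto simp: mem_box inner_add_left inner_diff_left algebra_simps dest!: subsetD)
  ultimately show ?thesis
    using has_integral_restrict[of "{x. x + c \<in> S}" "cbox (-a - c) (a - c)" "\<lambda>x. f (x + c)" y] by simp
qed

text \<open>A is cut into the pieces \<open>T m\<close> whose translates by m lie in A'. By
  periodicity a translated piece has the same integral, and the translated pieces tile A'.\<close>

lemma integral_fundamental_domain_cong:
  fixes F :: "real^'n \<Rightarrow> real"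
  assumes A: "fundamental_domain A" and A': "fundamental_domain A'"
    and F: "continuous_on UNIV F" and per: "\<And>m x. m \<in> integer_lattice \<Longrightarrow> F (x + m) = F x"
  shows "integral A F = integral A' F"
proof -
  define T where "T m = A \<inter> {x. x + m \<in> A'}" for m
  define K where "K = {m \<in> integer_lattice. T m \<noteq> {}}"
  have b: "bounded A" "bounded A'" and ms: "A \<in> sets lebesgue" "A' \<in> sets lebesgue"
    and ex: "\<exists>!m. m \<in> integer_lattice \<and> y + m \<in> A" "\<exists>!m. m \<in> integer_lattice \<and> y + m \<in> A'" for y
    using A A' by (auto simp: fundamental_domain_def)
  \<comment> \<open>Only finitely many pieces are nonempty: such an m is a difference of points of
    two bounded sets, and a bounded set contains finitely many lattice points.\<close>
  have "K \<subseteq> integer_lattice \<inter> (\<lambda>(x, y). x - y) ` (A' \<times> A)"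
  proof
    fix m assume "m \<in> K"
    then obtain x where "m \<in> integer_lattice" "x \<in> A" "x + m \<in> A'" by (auto simp: K_def T_def)
    moreover have "m = (\<lambda>(x, y). x - y) (x + m, x)" by simp
    ultimately show "m \<in> integer_lattice \<inter> (\<lambda>(x, y). x - y) ` (A' \<times> A)" by blast
  qed
  moreover have "bounded ((\<lambda>(x, y). x - y) ` (A' \<times> A))"
    using bounded_minus[OF b(2,1)] by (simp add: image_def case_prod_unfold)
  ultimately have "finite K" using finite_bounded_lattice finite_subset by blast
  have tr: "{x. x + m \<in> B} \<in> sets lebesgue" if "B \<in> sets lebesgue" for m and B :: "(real^'n) set"
  proof -
    have "{x. x + m \<in> B} = (+) (- m) ` B" by (force simp: image_iff)
    then show ?thesis using lebesgue_sets_translation[OF that, of "- m"] by simp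
  qed
  have Tm: "T m \<in> sets lebesgue" "bounded (T m)" for m
    unfolding T_def using tr[OF ms(2)] ms(1) b(1) by (auto intro: bounded_subset)
  define I where "I m = integral (T m) F" for m
  have hi: "(F has_integral I m) (T m)" for m
    unfolding I_def
    using absolutely_integrable_continuous_bounded[OF F Tm(2,1)]
    by (intro integrable_integral set_lebesgue_integral_eq_integral(1))
  have "(F has_integral (\<Sum>m\<in>K. I m)) (\<Union>m\<in>K. T m)"
  proof (rule has_integral_UN[OF \<open>finite K\<close> hi])
    show "pairwise (\<lambda>i i'. negligible (T i \<inter> T i')) K"
      unfolding pairwise_def
    proof (intro ballI impI)
      fix i j assume ij: "i \<in> K" "j \<in> K" "i \<noteq> j"
      have "T i \<inter> T j = {}" using ex(2) ij unfolding T_def K_def by blast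
      then show "negligible (T i \<inter> T j)" by simp
    qed
  qed
  moreover have "(\<Union>m\<in>K. T m) = A"
  proof (intro equalityI subsetI)
    fix x assume x: "x \<in> A"
    obtain m where "m \<in> integer_lattice" "x + m \<in> A'" using ex(2)[of x] by blast
    then have "m \<in> K" "x \<in> T m" using x by (auto simp: K_def T_def)
    then show "x \<in> (\<Union>m\<in>K. T m)" by blast
  qed (auto simp: T_def)
  ultimately have 1: "integral A F = (\<Sum>m\<in>K. I m)" by (simp add: integral_unique)
  define T' where "T' m = {x. x + - m \<in> T m}" for m
  have hi': "(F has_integral I m) (T' m)" if "m \<in> K" for m
  proof -
    have "(\<lambda>x. F (x + - m)) = F"
      using that per[OF integer_lattice_minus, of m] by (auto simp: K_def)
    then show ?thesis using has_integral_translate[OF hi Tm(2), of "- m" m] unfolding T'_def by simp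
  qed
  have "(F has_integral (\<Sum>m\<in>K. I m)) (\<Union>m\<in>K. T' m)"
  proof (rule has_integral_UN[OF \<open>finite K\<close> hi'])
    show "pairwise (\<lambda>i i'. negligible (T' i \<inter> T' i')) K"
      unfolding pairwise_def
    proof (intro ballI impI)
      fix i j assume ij: "i \<in> K" "j \<in> K" "i \<noteq> j"
      have "- i \<noteq> - j" "- i \<in> integer_lattice" "- j \<in> integer_lattice"
        using ij integer_lattice_minus by (auto simp: K_def)
      then have "T' i \<inter> T' j = {}" using ex(1) unfolding T'_def T_def by blast
      then show "negligible (T' i \<inter> T' j)" by simp
    qed
  qed
  moreover have "(\<Union>m\<in>K. T' m) = A'"
  proof (intro equalityI subsetI)
    fix x assume x: "x \<in> A'"
    obtain m where m: "m \<in> integer_lattice" "x + m \<in> A" using ex(1)[of x] by blast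
    then have "- m \<in> K" "x \<in> T' (- m)"
      using x integer_lattice_minus[OF m(1)] by (auto simp: K_def T_def T'_def intro!: exI[of _ "x + m"])
    then show "x \<in> (\<Union>m\<in>K. T' m)" by blast
  qed (auto simp: T'_def T_def)
  ultimately have "integral A' F = (\<Sum>m\<in>K. I m)" by (simp add: integral_unique)
  with 1 show ?thesis by simp
qed

text \<open>By equivariance \<Psi> maps the half-open cube onto another fundamental domain. After
  the usual change of variables, the integral over this image is therefore the integral over the
  cube.\<close>

lemma has_integral_periodic_change_of_variables_wellorder:
  fixes \<Psi> \<Theta> :: "real^'m::{finite,wellorder} \<Rightarrow> real^'m::_" and F :: "real^'m::_ \<Rightarrow> real"
  assumes D: "\<And>x. (\<Psi> has_derivative \<Psi>' x) (at x)"
    and inv: "\<And>x. \<Theta> (\<Psi> x) = x" "\<And>y. \<Psi> (\<Theta> y) = y" and cont: "continuous_on UNIV \<Theta>"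
    and eqv: "\<And>m x. m \<in> integer_lattice \<Longrightarrow> \<Psi> (x + m) = \<Psi> x + m"
    and F: "continuous_on UNIV F" and per: "\<And>m x. m \<in> integer_lattice \<Longrightarrow> F (x + m) = F x"
  shows "((\<lambda>x. \<bar>det (matrix (\<Psi>' x))\<bar> * F (\<Psi> x)) has_integral integral (cbox 0 1) F) (cbox 0 1)"
proof -
  let ?C = "half_open_cube :: (real^'m::_) set"
  have c\<Psi>: "continuous_on S \<Psi>" for S
    using D by (intro has_derivative_continuous_on[where f' = \<Psi>']) (auto intro: has_derivative_at_withinI)
  have im: "\<Psi> ` ?C = \<Theta> -` ?C"
  proof (intro equalityI subsetI)
    fix y assume "y \<in> \<Theta> -` ?C"
    then show "y \<in> \<Psi> ` ?C" using imageI[of "\<Theta> y" ?C \<Psi>] inv(2) by simp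
  qed (use inv(1) in auto)
  have "\<Theta> \<in> borel_measurable borel" using cont by (rule borel_measurable_continuous_onI)
  from measurable_sets[OF this half_open_cube_borel] have "\<Psi> ` ?C \<in> sets lebesgue"
    unfolding im by (metis Int_UNIV_right space_borel sets_completionI_sets sets_lborel)
  moreover have bd: "bounded (\<Psi> ` ?C)"
    using compact_imp_bounded[OF compact_continuous_image[OF c\<Psi> compact_cbox[of 0 1]]] half_open_cube_subset
    by (meson bounded_subset image_mono)
  moreover have "\<exists>!m. m \<in> integer_lattice \<and> y + m \<in> \<Psi> ` ?C" for y
  proof -
    have "\<Theta> (y + m) = \<Theta> y + m" if "m \<in> integer_lattice" for m
      using eqv[OF that, of "\<Theta> y"] inv by metis
    then have "m \<in> integer_lattice \<and> y + m \<in> \<Psi> ` ?C \<longleftrightarrow> m \<in> integer_lattice \<and> \<Theta> y + m \<in> ?C" for m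
      unfolding im by auto
    then show ?thesis using half_open_cube_translate[of "\<Theta> y"] by simp
  qed
  ultimately have fd: "fundamental_domain (\<Psi> ` ?C)" unfolding fundamental_domain_def by blast
  \<comment> \<open>The formula applied below is stated for vector-valued integrands, so the scalar
    F is wrapped as a vector of length 1.\<close>
  let ?F = "\<lambda>y. vec (F y) :: real^1"
  have "continuous_on UNIV ?F"
    using F unfolding vec_def by (intro continuous_on_vec_lambda) 
  then have abs: "?F absolutely_integrable_on \<Psi> ` ?C"
    using fd by (intro absolutely_integrable_continuous_bounded) (auto simp: fundamental_domain_def)
  have "(\<lambda>x. \<bar>det (matrix (\<Psi>' x))\<bar> *\<^sub>R ?F (\<Psi> x)) absolutely_integrable_on ?C \<and>
     integral ?C (\<lambda>x. \<bar>det (matrix (\<Psi>' x))\<bar> *\<^sub>R ?F (\<Psi> x)) = integral (\<Psi> ` ?C) ?F"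
  proof (rule has_absolute_integral_change_of_variables[THEN iffD2])
    have "fundamental_domain ?C" by (rule fundamental_domain_half_open_cube)
    then show "?C \<in> sets lebesgue" by (simp add: fundamental_domain_def)
    show "(\<Psi> has_derivative \<Psi>' x) (at x within ?C)" for x using D by (rule has_derivative_at_withinI)
    show "inj_on \<Psi> ?C" using inv(1) by (metis inj_onI)
  qed (use abs in simp)
  then have int: "(\<lambda>x. \<bar>det (matrix (\<Psi>' x))\<bar> *\<^sub>R ?F (\<Psi> x)) integrable_on ?C"
    and eq: "integral ?C (\<lambda>x. \<bar>det (matrix (\<Psi>' x))\<bar> *\<^sub>R ?F (\<Psi> x)) = integral (\<Psi> ` ?C) ?F"
    using set_lebesgue_integral_eq_integral(1) by blast+
  have "((\<lambda>x. \<bar>det (matrix (\<Psi>' x))\<bar> * F (\<Psi> x)) has_integral integral (\<Psi> ` ?C) F) ?C"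
    using int eq by (simp add: has_integral_iff integrable_on_1_iff integral_on_1_eq vec_eq_iff)
  moreover have "integral (\<Psi> ` ?C) F = integral ?C F"
    by (rule integral_fundamental_domain_cong[OF fd fundamental_domain_half_open_cube F per])
  moreover have "integral ?C F = integral (cbox 0 1) F"
  proof (rule integral_unique)
    have "F integrable_on cbox 0 1" using F continuous_on_subset by (intro integrable_continuous) blast
    then show "(F has_integral integral (cbox 0 1) F) ?C"
      by (simp add: has_integral_half_open_cube integrable_integral)
  qed
  ultimately show ?thesis by (simp add: has_integral_half_open_cube)
qed

lemma matrix_reindex:
  fixes L :: "real^'n \<Rightarrow> real^'n" and f :: "'m::finite \<Rightarrow> 'n"
  assumes "linear L" "\<And>x. f (g x) = x" "\<And>x. g (f x) = x"
  shows "matrix (\<lambda>v. reindex_vec f (L (reindex_vec g v))) = (\<chi> i j. matrix L $ f i $ f j)"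
proof -
  have "reindex_vec g (axis j 1) = (axis (f j) 1 :: real^'n)" for j
    using assms(2,3) by (auto simp: reindex_vec_def vec_eq_iff axis_def)
  then show ?thesis by (simp add: matrix_def reindex_vec_def vec_eq_iff)
qed

text \<open>The formula for ordered index types is transported along a relabelling of coordinates,
  which changes neither integrals over the unit cube nor the Jacobian determinant.\<close>

proposition has_integral_periodic_change_of_variables:
  fixes \<Psi> \<Theta> :: "real^'n \<Rightarrow> real^'n" and F :: "real^'n \<Rightarrow> real"
  assumes D: "\<And>x. (\<Psi> has_derivative \<Psi>' x) (at x)"
    and inv: "\<And>x. \<Theta> (\<Psi> x) = x" "\<And>y. \<Psi> (\<Theta> y) = y" and cont: "continuous_on UNIV \<Theta>"
    and eqv: "\<And>m x. m \<in> integer_lattice \<Longrightarrow> \<Psi> (x + m) = \<Psi> x + m"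
    and F: "continuous_on UNIV F" and per: "\<And>m x. m \<in> integer_lattice \<Longrightarrow> F (x + m) = F x"
  shows "((\<lambda>x. \<bar>det (matrix (\<Psi>' x))\<bar> * F (\<Psi> x)) has_integral integral (cbox 0 1) F) (cbox 0 1)"
proof -
  let ?E = "reindex_vec of_copy :: real^'n \<Rightarrow> real^('n ordered_copy)"
  let ?R = "reindex_vec to_copy :: real^('n ordered_copy) \<Rightarrow> real^'n"
  have ER: "?R (?E x) = x" "?E (?R y) = y" for x y
    by (simp_all add: reindex_vec_inverse)
  have bl: "bounded_linear ?E" "bounded_linear ?R"
    using linear_reindex_vec linear_conv_bounded_linear by blast+
  have add: "?E (x + y) = ?E x + ?E y" "?R (u + v) = ?R u + ?R v" for x y u v
    using linear_reindex_vec linear_add by blast+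
  have lat: "?R m \<in> integer_lattice" if "m \<in> integer_lattice" for m
    using that by (simp add: integer_lattice_def reindex_vec_def)
  have bij: "bij (of_copy :: 'n ordered_copy \<Rightarrow> 'n)"
    by (rule bij_betw_byWitness[where f' = to_copy]) auto
  have lin: "linear (\<Psi>' x)" for x using D by (rule has_derivative_linear)
  have ER01: "?E 0 = 0" "?E 1 = 1" "?R 0 = 0" "?R 1 = 1" by (simp_all add: reindex_vec_def vec_eq_iff)
  have detE: "det (matrix (\<lambda>v. ?E (\<Psi>' x (?R v)))) = det (matrix (\<Psi>' x))" for x
    using det_reindex[OF bij, of "matrix (\<Psi>' x)"] matrix_reindex[OF lin, of of_copy to_copy x] by simp
  have main: "((\<lambda>x. \<bar>det (matrix (\<lambda>v. ?E (\<Psi>' (?R x) (?R v))))\<bar> * F (?R (?E (\<Psi> (?R x)))))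
      has_integral integral (cbox 0 1) (\<lambda>x. F (?R x))) (cbox 0 1)"
  proof (rule has_integral_periodic_change_of_variables_wellorder[where \<Theta> = "\<lambda>y. ?E (\<Theta> (?R y))"
        and \<Psi> = "\<lambda>x. ?E (\<Psi> (?R x))" and F = "\<lambda>x. F (?R x)"])
    show "((\<lambda>x. ?E (\<Psi> (?R x))) has_derivative (\<lambda>v. ?E (\<Psi>' (?R x) (?R v)))) (at x)" for x
      by (intro bounded_linear.has_derivative[OF bl(1)]
          has_derivative_compose[OF bounded_linear_imp_has_derivative[OF bl(2)] D])
    show "continuous_on UNIV (\<lambda>y. ?E (\<Theta> (?R y)))"
      by (intro bounded_linear.continuous_on[OF bl(1)] continuous_on_compose2[OF cont]
          linear_continuous_on bl(2)) simp
    show "continuous_on UNIV (\<lambda>y. F (?R y))"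
      by (intro continuous_on_compose2[OF F] linear_continuous_on bl(2)) simp
  qed (simp_all add: ER inv add eqv lat per)
  have "F integrable_on cbox 0 1"
    using F continuous_on_subset by (intro integrable_continuous) blast
  from has_integral_reindex_vec[of to_copy of_copy, OF _ _ integrable_integral[OF this]]
  have "integral (cbox 0 1) (\<lambda>x. F (?R x)) = integral (cbox 0 1) F"
    by (simp add: ER01 integral_unique)
  with has_integral_reindex_vec[of of_copy to_copy, OF _ _ main] show ?thesis
    by (simp add: ER01 ER detE)
qed

lemma integral_periodic_translate:
  fixes F :: "real^'n \<Rightarrow> real"
  assumes F: "continuous_on UNIV F" and per: "\<And>m x. m \<in> integer_lattice \<Longrightarrow> F (x + m) = F x"
  shows "integral (cbox 0 1) (\<lambda>x. F (x + z)) = integral (cbox 0 1) F"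
proof -
  have "((\<lambda>x. \<bar>det (matrix (\<lambda>v::real^'n. v))\<bar> * F (x + z)) has_integral integral (cbox 0 1) F) (cbox 0 1)"
    by (rule has_integral_periodic_change_of_variables[where \<Theta> = "\<lambda>x. x - z" and \<Psi>' = "\<lambda>x v. v"])
      (auto intro!: derivative_eq_intros continuous_intros F simp: algebra_simps, metis add.commute per)
  moreover have "matrix (\<lambda>v::real^'n. v) = mat 1" using matrix_id_mat_1 by (simp add: id_def)
  ultimately show ?thesis by (simp add: integral_unique)
qed

section \<open>The Poincare inequality for periodic functions\<close>

definition periodic_C1 :: "(real^'n \<Rightarrow> real) \<Rightarrow> (real^'n \<Rightarrow> real^'n \<Rightarrow> real) \<Rightarrow> bool"
  where "periodic_C1 p p' \<longleftrightarrow> (\<forall>x. (p has_derivative p' x) (at x)) \<and>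
    (\<forall>v. continuous_on UNIV (\<lambda>x. p' x v)) \<and> (\<forall>m\<in>integer_lattice. \<forall>x. p (x + m) = p x)"

lemma periodic_C1D:
  assumes "periodic_C1 p p'"
  shows "(p has_derivative p' x) (at x)" "continuous_on S (\<lambda>x. p' x v)" "continuous_on S p"
    and "m \<in> integer_lattice \<Longrightarrow> p (x + m) = p x"
    and "m \<in> integer_lattice \<Longrightarrow> p' (x + m) = p' x"
proof -
  show D: "(p has_derivative p' x) (at x)" for x
    using assms by (simp add: periodic_C1_def)
  have "continuous_on UNIV (\<lambda>x. p' x v)" using assms by (simp add: periodic_C1_def)
  then show "continuous_on S (\<lambda>x. p' x v)" by (rule continuous_on_subset) simp
  show "continuous_on S p"
    by (rule has_derivative_continuous_on[OF has_derivative_at_withinI[OF D]])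
  show per: "p (x + m) = p x" if "m \<in> integer_lattice" for x m
    using assms that by (simp add: periodic_C1_def)
  show "p' (x + m) = p' x" if m: "m \<in> integer_lattice"
  proof -
    have "((\<lambda>x. x + m) has_derivative (\<lambda>v. v)) (at x)" by (auto intro!: derivative_eq_intros)
    from has_derivative_compose[OF this D]
    have "((\<lambda>x. p (x + m)) has_derivative p' (x + m)) (at x)" by simp
    then have "(p has_derivative p' (x + m)) (at x)" using per[OF m] by simp
    then show ?thesis using D has_derivative_unique by blast
  qed
qed

lemma content_unit_cube_cart [simp]: "measure lborel (cbox 0 1 :: (real^'n) set) = 1"
proof -
  have "(cbox 0 1 :: (real^'n) set) \<noteq> {}" by (simp add: interval_ne_empty_cart)
  then show ?thesis by (simp add: content_cbox_cart)
qed

lemma has_integral_unit_cube_const: "((\<lambda>x. c) has_integral c) (cbox 0 1 :: (real^'n) set)" for c :: real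
  using has_integral_const[of c 0 "1 :: real^'n"] by simp

lemma integrable_cube: "continuous_on UNIV f \<Longrightarrow> f integrable_on cbox a b"
  for f :: "'a::euclidean_space \<Rightarrow> 'b::banach"
  by (intro integrable_continuous) (blast intro: continuous_on_subset)

text \<open>Fubini, then translation invariance of the inner integral for each fixed t. This removes
  the segment integrals that the fundamental theorem of calculus produces.\<close>

lemma integral_line_periodic:
  fixes F :: "real^'n \<Rightarrow> real"
  assumes F: "continuous_on UNIV F" and per: "\<And>m x. m \<in> integer_lattice \<Longrightarrow> F (x + m) = F x"
  shows "integral (cbox 0 1) (\<lambda>x. integral (cbox 0 1) (\<lambda>t::real. F (x + t *\<^sub>R z))) = integral (cbox 0 1) F"
proof -
  have "continuous_on (cbox (0, 0) (1, 1)) (\<lambda>(x, t::real). F (x + t *\<^sub>R z))"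
    unfolding case_prod_unfold by (intro continuous_on_compose2[OF F] continuous_intros) simp
  from integral_swap_continuous[OF this]
  have "integral (cbox 0 1) (\<lambda>x. integral (cbox 0 1) (\<lambda>t::real. F (x + t *\<^sub>R z)))
      = integral (cbox 0 1) (\<lambda>t::real. integral (cbox 0 1) (\<lambda>x. F (x + t *\<^sub>R z)))" by simp
  also have "\<dots> = integral (cbox 0 1) (\<lambda>t::real. integral (cbox 0 1) F)"
    using integral_periodic_translate[OF F per] by simp
  finally show ?thesis by simp
qed

lemma periodic_C1_increment:
  assumes "periodic_C1 p p'"
  shows "((\<lambda>t. p' (x + t *\<^sub>R z) z) has_integral (p (x + z) - p x)) (cbox 0 (1::real))"
proof -
  have "((\<lambda>t. p' (x + t *\<^sub>R z) z) has_integral (p (x + 1 *\<^sub>R z) - p (x + 0 *\<^sub>R z))) {0..1}"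
  proof (rule fundamental_theorem_of_calculus)
    fix t :: real assume "t \<in> {0..1}"
    have "((\<lambda>t. x + t *\<^sub>R z) has_derivative (\<lambda>h. h *\<^sub>R z)) (at t)"
      by (auto intro!: derivative_eq_intros)
    from has_derivative_compose[OF this periodic_C1D(1)[OF assms]]
    have "((\<lambda>t. p (x + t *\<^sub>R z)) has_derivative (\<lambda>h. p' (x + t *\<^sub>R z) (h *\<^sub>R z))) (at t)" .
    moreover have "linear (p' (x + t *\<^sub>R z))"
      using has_derivative_linear[OF periodic_C1D(1)[OF assms]] .
    ultimately have "((\<lambda>t. p (x + t *\<^sub>R z)) has_vector_derivative p' (x + t *\<^sub>R z) z) (at t)"
      unfolding has_vector_derivative_def by (simp add: linear_cmul)
    then show "((\<lambda>t. p (x + t *\<^sub>R z)) has_vector_derivative p' (x + t *\<^sub>R z) z) (at t within {0..1})"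
      by (rule has_vector_derivative_at_within)
  qed simp
  then show ?thesis by simp
qed

text \<open>Averaged along segments, the derivative in direction c becomes the increment
  \<open>p (x + c) - p x\<close>, whose two terms have the same integral.\<close>

lemma integral_periodic_derivative:
  assumes p: "periodic_C1 p p'"
  shows "integral (cbox 0 1) (\<lambda>x. p' x c) = 0"
proof -
  note D = periodic_C1D[OF p]
  have "integral (cbox 0 1) (\<lambda>x. p' x c)
      = integral (cbox 0 1) (\<lambda>x. integral (cbox 0 1) (\<lambda>t::real. p' (x + t *\<^sub>R c) c))"
    using integral_line_periodic[of "\<lambda>x. p' x c" c] D(2,5) by simp
  also have "\<dots> = integral (cbox 0 1) (\<lambda>x. p (x + c) - p x)"
    by (simp only: integral_unique[OF periodic_C1_increment[OF p]])
  also have "\<dots> = integral (cbox 0 1) (\<lambda>x. p (x + c)) - integral (cbox 0 1) p"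
    by (intro integral_diff integrable_cube continuous_on_compose2[OF D(3)[of UNIV]] continuous_intros D(3)) simp
  also have "\<dots> = 0"
    using integral_periodic_translate[OF D(3,4)] by simp
  finally show ?thesis .
qed

text \<open>The variance of f is nonnegative.\<close>

lemma integral_square_le:
  fixes f :: "real \<Rightarrow> real"
  assumes "continuous_on {0..1} f"
  shows "(integral {0..1} f)\<^sup>2 \<le> integral {0..1} (\<lambda>t. (f t)\<^sup>2)"
proof -
  let ?m = "integral {0..1} f"
  have i: "f integrable_on {0..1}" "(\<lambda>t. (f t)\<^sup>2) integrable_on {0..1}"
    using assms by (auto intro!: integrable_continuous_real continuous_intros)
  have "0 \<le> integral {0..1} (\<lambda>t. (f t - ?m)\<^sup>2)"
    using assms by (intro integral_nonneg integrable_continuous_real continuous_intros) auto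
  also have "(\<lambda>t. (f t - ?m)\<^sup>2) = (\<lambda>t. (f t)\<^sup>2 - 2 * ?m * f t + ?m\<^sup>2)"
    by (auto simp: power2_eq_square algebra_simps)
  also have "integral {0..1} (\<lambda>t. (f t)\<^sup>2 - 2 * ?m * f t + ?m\<^sup>2)
      = integral {0..1} (\<lambda>t. (f t)\<^sup>2) - 2 * ?m * ?m + ?m\<^sup>2"
    using has_integral_add[OF has_integral_diff[OF integrable_integral[OF i(2)]
          has_integral_mult_right[OF integrable_integral[OF i(1)], of "2 * ?m"]]
        has_integral_const_real[of "?m\<^sup>2" 0 1]]
    by (simp add: integral_unique)
  finally show ?thesis by (simp add: power2_eq_square)
qed

definition gradient_sq :: "(real^'n \<Rightarrow> real) \<Rightarrow> real"
  where "gradient_sq l = (\<Sum>i\<in>UNIV. (l (axis i 1))\<^sup>2)"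

lemma linear_axis_expansion:
  fixes l :: "real^'n \<Rightarrow> real"
  assumes "linear l"
  shows "l z = (\<Sum>i\<in>UNIV. z $ i * l (axis i 1))"
proof -
  have "l z = l (\<Sum>i\<in>UNIV. z $ i *\<^sub>R axis i 1)"
    using basis_expansion[of z] by (simp add: scalar_mult_eq_scaleR)
  then show ?thesis using assms by (simp add: linear_sum linear_cmul)
qed

text \<open>Cauchy-Schwarz for the sum over the coordinates, which costs the factor
  \<open>CARD('n)\<close>.\<close>

lemma derivative_sq_le:
  fixes l :: "real^'n \<Rightarrow> real"
  assumes "linear l" "\<And>i. \<bar>z $ i\<bar> \<le> b"
  shows "(l z)\<^sup>2 \<le> b\<^sup>2 * CARD('n) * gradient_sq l"
proof -
  have "(l z)\<^sup>2 \<le> (\<Sum>i\<in>UNIV. (z $ i * l (axis i 1))\<^sup>2) * CARD('n)"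
    unfolding linear_axis_expansion[OF assms(1), of z] by (rule sum_squared_le_sum_of_squares)
  also have "\<dots> \<le> (\<Sum>i\<in>(UNIV::'n set). b\<^sup>2 * (l (axis i 1))\<^sup>2) * CARD('n)"
  proof (intro mult_right_mono sum_mono)
    fix i
    have "(z $ i)\<^sup>2 \<le> b\<^sup>2" using assms(2)[of i] by (meson abs_ge_zero order_trans power2_le_iff_abs_le)
    then show "(z $ i * l (axis i 1))\<^sup>2 \<le> b\<^sup>2 * (l (axis i 1))\<^sup>2"
      by (simp add: power_mult_distrib mult_right_mono)
  qed simp
  finally show ?thesis by (simp add: gradient_sq_def sum_distrib_left[symmetric] mult_ac)
qed

lemma continuous_gradient_sq:
  "periodic_C1 p p' \<Longrightarrow> continuous_on S (\<lambda>x. gradient_sq (p' x))"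
  unfolding gradient_sq_def by (intro continuous_intros periodic_C1D(2))

text \<open>The increment is the integral of the derivative along the segment from x to x + z. Its
  square is estimated by Cauchy-Schwarz, with all coordinates of z at most 1, and averaging over x
  removes the segment.\<close>

lemma translation_difference_le:
  fixes p :: "real^'n \<Rightarrow> real"
  assumes p: "periodic_C1 p p'" and z: "z \<in> cbox 0 1"
  shows "integral (cbox 0 1) (\<lambda>x. (p (x + z) - p x)\<^sup>2)
    \<le> CARD('n) * integral (cbox 0 1) (\<lambda>x. gradient_sq (p' x))"
proof -
  note D = periodic_C1D[OF p]
  have cline: "continuous_on S (\<lambda>t. f (x + t *\<^sub>R z))" if "continuous_on UNIV f"
    for f :: "real^'n \<Rightarrow> real" and S and x
    by (intro continuous_on_compose2[OF that] continuous_intros) simp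
  have pt: "(p (x + z) - p x)\<^sup>2 \<le> CARD('n) * integral (cbox 0 1) (\<lambda>t::real. gradient_sq (p' (x + t *\<^sub>R z)))" for x
  proof -
    have "(p (x + z) - p x)\<^sup>2 = (integral {0..1} (\<lambda>t. p' (x + t *\<^sub>R z) z))\<^sup>2"
      using integral_unique[OF periodic_C1_increment[OF p, of x z]] by simp
    also have "\<dots> \<le> integral {0..1} (\<lambda>t. (p' (x + t *\<^sub>R z) z)\<^sup>2)"
      by (intro integral_square_le cline[of "\<lambda>x. p' x z"] D(2))
    also have "\<dots> \<le> integral {0..1} (\<lambda>t. CARD('n) * gradient_sq (p' (x + t *\<^sub>R z)))"
    proof (intro integral_le integrable_continuous_real continuous_intros)
      show "(p' (x + t *\<^sub>R z) z)\<^sup>2 \<le> CARD('n) * gradient_sq (p' (x + t *\<^sub>R z))" for t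
        using derivative_sq_le[OF has_derivative_linear[OF D(1)], of z 1] z
        by (simp add: mem_box_cart)
    qed (intro cline[of "\<lambda>x. p' x z"] cline[of "\<lambda>x. gradient_sq (p' x)"] D(2) continuous_gradient_sq[OF p])+
    finally show ?thesis by simp
  qed
  have "integral (cbox 0 1) (\<lambda>x. (p (x + z) - p x)\<^sup>2)
      \<le> integral (cbox 0 1) (\<lambda>x. CARD('n) * integral (cbox 0 1) (\<lambda>t::real. gradient_sq (p' (x + t *\<^sub>R z))))"
  proof (intro integral_le integrable_cube pt)
    show "continuous_on UNIV (\<lambda>x. (p (x + z) - p x)\<^sup>2)"
      by (intro continuous_intros continuous_on_compose2[OF D(3)[of UNIV]] D(3)) simp
    have "continuous_on (UNIV \<times> cbox 0 1) (\<lambda>(x, t::real). gradient_sq (p' (x + t *\<^sub>R z)))"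
      unfolding case_prod_unfold
      by (intro continuous_on_compose2[OF continuous_gradient_sq[OF p, of UNIV]] continuous_intros) simp
    then show "continuous_on UNIV (\<lambda>x. CARD('n) * integral (cbox 0 1) (\<lambda>t::real. gradient_sq (p' (x + t *\<^sub>R z))))"
      by (intro continuous_intros integral_continuous_on_param)
  qed
  also have "\<dots> = CARD('n) * integral (cbox 0 1) (\<lambda>x. gradient_sq (p' x))"
    using integral_line_periodic[OF continuous_gradient_sq[OF p], of z] D(5) by simp
  finally show ?thesis .
qed

text \<open>The bound on translation differences is averaged over all z in the cube. Its left side
  becomes twice the variance of p, because the correlation R has mean p0^2. The constant is not
  sharp; the absorption argument below accepts any constant that depends only on the
  dimension.\<close>

proposition poincare_inequality:
  fixes p :: "real^'n \<Rightarrow> real"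
  assumes p: "periodic_C1 p p'"
  shows "2 * integral (cbox 0 1) (\<lambda>x. (p x - integral (cbox 0 1) p)\<^sup>2)
    \<le> CARD('n) * integral (cbox 0 1) (\<lambda>x. gradient_sq (p' x))"
proof -
  note D = periodic_C1D[OF p]
  let ?C = "cbox 0 1 :: (real^'n) set"
  define p0 where "p0 = integral ?C p"
  define S where "S = integral ?C (\<lambda>x. (p x)\<^sup>2)"
  define E where "E = integral ?C (\<lambda>x. gradient_sq (p' x))"
  define R where "R z = integral ?C (\<lambda>x. p (x + z) * p x)" for z
  have c: "continuous_on UNIV p" by (rule D)
  have cz: "continuous_on UNIV (\<lambda>x. p (x + z))" for z
    by (intro continuous_on_compose2[OF c] continuous_intros) simp
  have ip: "p integrable_on ?C" "(\<lambda>x. (p x)\<^sup>2) integrable_on ?C"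
    using c by (auto intro!: integrable_cube continuous_intros)
  have Sz: "integral ?C (\<lambda>x. (p (x + z))\<^sup>2) = S" for z
    unfolding S_def using integral_periodic_translate[of "\<lambda>x. (p x)\<^sup>2" z] c D(4)
    by (simp add: continuous_intros)
  have le: "2 * S - 2 * R z \<le> CARD('n) * E" if "z \<in> ?C" for z
  proof -
    have "integral ?C (\<lambda>x. (p (x + z) - p x)\<^sup>2)
        = integral ?C (\<lambda>x. (p (x + z))\<^sup>2 + (p x)\<^sup>2 - 2 * (p (x + z) * p x))"
      by (simp add: power2_diff algebra_simps)
    also have "\<dots> = integral ?C (\<lambda>x. (p (x + z))\<^sup>2) + S - 2 * R z"
      unfolding S_def R_def using c cz
      by (subst integral_diff integral_add; (auto intro!: integrable_cube continuous_intros)?)+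
    finally show ?thesis using translation_difference_le[OF p that] Sz by (simp add: E_def)
  qed
  have c2: "continuous_on T (\<lambda>(z, x). p (x + z) * p x)" for T
    unfolding case_prod_unfold by (intro continuous_intros continuous_on_compose2[OF c]) simp_all
  have intR: "integral ?C R = p0\<^sup>2"
  proof -
    have "integral ?C R = integral ?C (\<lambda>x. integral ?C (\<lambda>z. p (x + z) * p x))"
      unfolding R_def by (rule integral_swap_continuous[OF c2])
    also have "\<dots> = integral ?C (\<lambda>x. p0 * p x)"
      using integral_periodic_translate[OF c D(4)] by (simp add: add.commute p0_def)
    finally show ?thesis by (simp add: p0_def power2_eq_square)
  qed
  have cR: "continuous_on UNIV R" unfolding R_def by (rule integral_continuous_on_param[OF c2])
  have "integral ?C (\<lambda>z. 2 * S - 2 * R z) \<le> integral ?C (\<lambda>z. CARD('n) * E)"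
    by (intro integral_le integrable_cube continuous_intros cR le)
  moreover have "integral ?C (\<lambda>z. 2 * S - 2 * R z) = 2 * S - 2 * p0\<^sup>2"
    using has_integral_diff[OF has_integral_unit_cube_const[of "2 * S"]
        has_integral_mult_right[OF integrable_integral[OF integrable_cube[OF cR]], of 2]] intR
    by (simp add: integral_unique)
  moreover have "integral ?C (\<lambda>x. (p x - p0)\<^sup>2) = S - p0\<^sup>2"
  proof -
    have "integral ?C (\<lambda>x. (p x - p0)\<^sup>2) = integral ?C (\<lambda>x. (p x)\<^sup>2 - 2 * p0 * p x + p0\<^sup>2)"
      by (simp add: power2_diff algebra_simps)
    also have "\<dots> = S - 2 * p0 * p0 + p0\<^sup>2"
      unfolding S_def
      using has_integral_add[OF has_integral_diff[OF integrable_integral[OF ip(2)]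
            has_integral_mult_right[OF integrable_integral[OF ip(1)], of "2 * p0"]]
          has_integral_unit_cube_const[of "p0\<^sup>2"]]
      by (simp add: integral_unique p0_def)
    finally show ?thesis by (simp add: power2_eq_square)
  qed
  ultimately show ?thesis by (simp add: p0_def E_def)
qed

section \<open>The ground state energy of a small closed form\<close>

definition gradient_vec :: "(real^'n \<Rightarrow> real) \<Rightarrow> real^'n"
  where "gradient_vec l = (\<chi> i. l (axis i 1))"

lemma inner_gradient_vec:
  fixes l :: "real^'n \<Rightarrow> real"
  assumes "linear l" shows "gradient_vec l \<bullet> z = l z"
  unfolding linear_axis_expansion[OF assms, of z] by (simp add: gradient_vec_def inner_vec_def mult.commute)

lemma norm_gradient_vec: "(norm (gradient_vec l))\<^sup>2 = gradient_sq l"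
  unfolding power2_norm_eq_inner by (simp add: gradient_vec_def gradient_sq_def inner_vec_def power2_eq_square)

lemma continuous_gradient_vec:
  "periodic_C1 p p' \<Longrightarrow> continuous_on S (\<lambda>x. gradient_vec (p' x))"
  unfolding gradient_vec_def by (intro continuous_on_vec_lambda periodic_C1D(2))

text \<open>Since \<open>q' x c\<close> has mean zero, p may be replaced by its deviation from the
  mean. The inequality 2uv \<le> u^2 + v^2 and the Poincare inequality then bound everything by
  gradient energies.\<close>

lemma periodic_cross_term_le:
  fixes c :: "real^'n"
  assumes p: "periodic_C1 p p'" and q: "periodic_C1 q q'"
  shows "2 * integral (cbox 0 1) (\<lambda>x. p x * q' x c) \<le> CARD('n) * (1 + (norm c)\<^sup>2) *
    (integral (cbox 0 1) (\<lambda>x. gradient_sq (p' x)) + integral (cbox 0 1) (\<lambda>x. gradient_sq (q' x)))"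
proof -
  let ?C = "cbox 0 1 :: (real^'n) set"
  note P = periodic_C1D[OF p] and Q = periodic_C1D[OF q]
  define p0 where "p0 = integral ?C p"
  define Ep where "Ep = integral ?C (\<lambda>x. gradient_sq (p' x))"
  define Eq where "Eq = integral ?C (\<lambda>x. gradient_sq (q' x))"
  have E0: "Ep \<ge> 0"
    unfolding Ep_def using continuous_gradient_sq[OF p]
    by (intro integral_nonneg integrable_cube) (auto simp: gradient_sq_def sum_nonneg)
  have "integral ?C (\<lambda>x. (p x - p0) * q' x c) = integral ?C (\<lambda>x. p x * q' x c) - p0 * integral ?C (\<lambda>x. q' x c)"
  proof -
    have i: "(\<lambda>x. p x * q' x c) integrable_on ?C" "(\<lambda>x. q' x c) integrable_on ?C"
      by (intro integrable_cube continuous_intros P(3) Q(2))+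
    show ?thesis
      using has_integral_diff[OF integrable_integral[OF i(1)]
          has_integral_mult_right[OF integrable_integral[OF i(2)], of p0]]
      by (simp add: integral_unique left_diff_distrib)
  qed
  then have eq: "integral ?C (\<lambda>x. p x * q' x c) = integral ?C (\<lambda>x. (p x - p0) * q' x c)"
    using integral_periodic_derivative[OF q] by simp
  have "integral ?C (\<lambda>x. 2 * ((p x - p0) * q' x c)) \<le>
      integral ?C (\<lambda>x. (p x - p0)\<^sup>2 + (norm c)\<^sup>2 * CARD('n) * gradient_sq (q' x))"
  proof (intro integral_le integrable_cube continuous_intros P(3) Q(2) continuous_gradient_sq[OF q])
    fix x
    have "2 * ((p x - p0) * q' x c) \<le> (p x - p0)\<^sup>2 + (q' x c)\<^sup>2"
      using sum_squares_bound[of "p x - p0" "q' x c"] unfolding mult.assoc .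
    moreover have "(q' x c)\<^sup>2 \<le> (norm c)\<^sup>2 * CARD('n) * gradient_sq (q' x)"
      by (rule derivative_sq_le[OF has_derivative_linear[OF Q(1)] component_le_norm_cart])
    ultimately show "2 * ((p x - p0) * q' x c) \<le> (p x - p0)\<^sup>2 + (norm c)\<^sup>2 * CARD('n) * gradient_sq (q' x)"
      by linarith
  qed
  also have "\<dots> = integral ?C (\<lambda>x. (p x - p0)\<^sup>2) + (norm c)\<^sup>2 * CARD('n) * Eq"
  proof -
    have i: "(\<lambda>x. (p x - p0)\<^sup>2) integrable_on ?C" "(\<lambda>x. gradient_sq (q' x)) integrable_on ?C"
      by (intro integrable_cube continuous_intros P(3) continuous_gradient_sq[OF q])+
    show ?thesis
      unfolding Eq_def
      using has_integral_add[OF integrable_integral[OF i(1)]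
          has_integral_mult_right[OF integrable_integral[OF i(2)], of "(norm c)\<^sup>2 * CARD('n)"]]
      by (rule integral_unique)
  qed
  also have "integral ?C (\<lambda>x. (p x - p0)\<^sup>2) \<le> CARD('n) * Ep"
  proof -
    have "0 \<le> CARD('n) * Ep" using E0 by simp
    then show ?thesis
      using poincare_inequality[OF p] unfolding p0_def[symmetric] Ep_def[symmetric] by linarith
  qed
  finally have "2 * integral ?C (\<lambda>x. p x * q' x c) \<le> CARD('n) * Ep + (norm c)\<^sup>2 * CARD('n) * Eq"
    unfolding eq by simp
  also have "\<dots> \<le> CARD('n) * (1 + (norm c)\<^sup>2) * (Ep + Eq)"
  proof -
    have "Eq \<ge> 0"
      unfolding Eq_def using continuous_gradient_sq[OF q]
      by (intro integral_nonneg integrable_cube) (auto simp: gradient_sq_def sum_nonneg)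
    then show ?thesis using E0 by (simp add: algebra_simps)
  qed
  finally show ?thesis by (simp add: Ep_def Eq_def)
qed

text \<open>The integrand is the squared magnetic differential of p + iq, split into real and
  imaginary parts. Expanding it gives the gradient energy, a cross term linear in \<epsilon>, and
  exactly the quadratic term claimed. The cross term is at most \<epsilon> K times the gradient
  energy, so it is absorbed when \<epsilon> \<le> 1/K.\<close>

proposition magnetic_energy_lower_bound:
  fixes L :: "real^'n \<Rightarrow> real^'n"
  assumes L: "linear L" "inj L"
  obtains \<epsilon>0 where "\<epsilon>0 > 0"
    "\<And>\<epsilon> p p' q q'. 0 \<le> \<epsilon> \<Longrightarrow> \<epsilon> \<le> \<epsilon>0 \<Longrightarrow> periodic_C1 p p' \<Longrightarrow> periodic_C1 q q' \<Longrightarrow>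
      \<epsilon>\<^sup>2 * (norm (L a))\<^sup>2 * integral (cbox 0 1) (\<lambda>x. (p x)\<^sup>2 + (q x)\<^sup>2) \<le>
      integral (cbox 0 1) (\<lambda>x. (norm (L (gradient_vec (p' x) + (\<epsilon> * q x) *\<^sub>R a)))\<^sup>2
        + (norm (L (gradient_vec (q' x) - (\<epsilon> * p x) *\<^sub>R a)))\<^sup>2)"
proof -
  let ?C = "cbox 0 1 :: (real^'n) set"
  \<comment> \<open>With this vector \<open>L a \<bullet> L w\<close> equals
    \<open>c \<bullet> w\<close>, so the cross terms become derivatives along the fixed direction
    c.\<close>
  define c where "c = adjoint L (L a)"
  have c: "L a \<bullet> L w = c \<bullet> w" for w
    using adjoint_works[OF L(1), of w "L a"] by (simp add: c_def inner_commute)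
  obtain b where b: "b > 0" "\<And>x. b * norm x \<le> norm (L x)"
    using linear_inj_bounded_below_pos[OF L] by blast
  \<comment> \<open>The 2 counts the two cross terms, the bracket is the constant of
    \<open>periodic_cross_term_le\<close>, and the division by b^2 passes from the Euclidean
    gradient to the energy measured through L.\<close>
  define K where "K = 2 * (CARD('n) * (1 + (norm c)\<^sup>2)) / b\<^sup>2"
  have K: "K > 0" unfolding K_def using b(1) by (simp add: add_pos_nonneg)
  have main: "\<epsilon>\<^sup>2 * (norm (L a))\<^sup>2 * integral ?C (\<lambda>x. (p x)\<^sup>2 + (q x)\<^sup>2) \<le>
      integral ?C (\<lambda>x. (norm (L (gradient_vec (p' x) + (\<epsilon> * q x) *\<^sub>R a)))\<^sup>2
        + (norm (L (gradient_vec (q' x) - (\<epsilon> * p x) *\<^sub>R a)))\<^sup>2)"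
    if \<epsilon>: "0 \<le> \<epsilon>" "\<epsilon> \<le> 1 / K" and p: "periodic_C1 p p'" and q: "periodic_C1 q q'" for \<epsilon> p p' q q'
  proof -
    note P = periodic_C1D[OF p] and Q = periodic_C1D[OF q]
    have lin: "linear (p' x)" "linear (q' x)" for x using P(1) Q(1) has_derivative_linear by blast+
    define Np where "Np x = (norm (L (gradient_vec (p' x))))\<^sup>2" for x
    define Nq where "Nq x = (norm (L (gradient_vec (q' x))))\<^sup>2" for x
    have bl: "bounded_linear L" using L(1) linear_conv_bounded_linear by blast
    have cN: "continuous_on UNIV Np" "continuous_on UNIV Nq"
      unfolding Np_def Nq_def using continuous_gradient_vec[OF p] continuous_gradient_vec[OF q]
      by (auto intro!: continuous_intros bounded_linear.continuous_on[OF bl])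
    have g_le: "gradient_sq (p' x) \<le> Np x / b\<^sup>2" "gradient_sq (q' x) \<le> Nq x / b\<^sup>2" for x
    proof -
      have "(b * norm v)\<^sup>2 \<le> (norm (L v))\<^sup>2" for v
        using b power_mono[OF b(2)[of v], of 2] by simp
      then have "(norm v)\<^sup>2 \<le> (norm (L v))\<^sup>2 / b\<^sup>2" for v
        using b(1) by (simp add: power_mult_distrib field_simps)
      then show "gradient_sq (p' x) \<le> Np x / b\<^sup>2" "gradient_sq (q' x) \<le> Nq x / b\<^sup>2"
        unfolding Np_def Nq_def norm_gradient_vec[symmetric] by blast+
    qed
    define Ip where "Ip = integral ?C Np"
    define Iq where "Iq = integral ?C Nq"
    have E_le: "integral ?C (\<lambda>x. gradient_sq (p' x)) \<le> Ip / b\<^sup>2" "integral ?C (\<lambda>x. gradient_sq (q' x)) \<le> Iq / b\<^sup>2"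
    proof -
      have "integral ?C (\<lambda>x. gradient_sq (p' x)) \<le> integral ?C (\<lambda>x. Np x / b\<^sup>2)"
        "integral ?C (\<lambda>x. gradient_sq (q' x)) \<le> integral ?C (\<lambda>x. Nq x / b\<^sup>2)"
        using cN continuous_gradient_sq[OF p] continuous_gradient_sq[OF q] b(1)
        by (intro integral_le integrable_cube g_le continuous_intros; simp)+
      then show "integral ?C (\<lambda>x. gradient_sq (p' x)) \<le> Ip / b\<^sup>2" "integral ?C (\<lambda>x. gradient_sq (q' x)) \<le> Iq / b\<^sup>2"
        by (simp_all add: Ip_def Iq_def)
    qed
    let ?Rp = "integral ?C (\<lambda>x. p x * q' x c)" and ?Rq = "integral ?C (\<lambda>x. q x * p' x (- c))"
    define E where "E = integral ?C (\<lambda>x. gradient_sq (p' x)) + integral ?C (\<lambda>x. gradient_sq (q' x))"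
    define X where "X = CARD('n) * (1 + (norm c)\<^sup>2) * E"
    have "2 * ?Rp \<le> X" "2 * ?Rq \<le> X"
      using periodic_cross_term_le[OF p q, of c] periodic_cross_term_le[OF q p, of "- c"]
      by (simp_all add: X_def E_def add.commute)
    then have "2 * (?Rp + ?Rq) \<le> 2 * X" by simp
    also have "\<dots> = 2 * (CARD('n) * (1 + (norm c)\<^sup>2)) * E" by (simp add: X_def)
    also have "\<dots> \<le> 2 * (CARD('n) * (1 + (norm c)\<^sup>2)) * ((Ip + Iq) / b\<^sup>2)"
      using E_le by (intro mult_left_mono) (simp_all add: E_def add_divide_distrib)
    also have "\<dots> = K * (Ip + Iq)" by (simp add: K_def)
    finally have cross: "2 * (?Rp + ?Rq) \<le> K * (Ip + Iq)" .
    have I0: "0 \<le> Ip + Iq"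
      unfolding Ip_def Iq_def using cN
      by (intro add_nonneg_nonneg integral_nonneg integrable_cube) (auto simp: Np_def Nq_def)
    have "2 * \<epsilon> * (?Rp + ?Rq) \<le> \<epsilon> * (K * (Ip + Iq))"
      using mult_left_mono[OF cross \<epsilon>(1)] by (simp add: mult_ac)
    also have "\<dots> = (\<epsilon> * K) * (Ip + Iq)" by simp
    also have "\<dots> \<le> 1 * (Ip + Iq)"
      using \<epsilon> K I0 by (intro mult_right_mono) (simp_all add: field_simps)
    finally have cross': "2 * \<epsilon> * (?Rp + ?Rq) \<le> Ip + Iq" by simp
    have pt: "(norm (L (gradient_vec (p' x) + (\<epsilon> * q x) *\<^sub>R a)))\<^sup>2
        + (norm (L (gradient_vec (q' x) - (\<epsilon> * p x) *\<^sub>R a)))\<^sup>2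
      = (Np x + Nq x) - 2 * \<epsilon> * (p x * q' x c + q x * p' x (- c)) + \<epsilon>\<^sup>2 * (norm (L a))\<^sup>2 * ((p x)\<^sup>2 + (q x)\<^sup>2)" for x
    proof -
      have "c \<bullet> gradient_vec (p' x) = p' x c" "c \<bullet> gradient_vec (q' x) = q' x c" "p' x (- c) = - p' x c"
        using inner_gradient_vec[OF lin(1)] inner_gradient_vec[OF lin(2)] linear_neg[OF lin(1)]
        by (simp_all add: inner_commute)
      moreover have exp: "(norm (L (u + s *\<^sub>R a)))\<^sup>2 = (norm (L u))\<^sup>2 + 2 * s * (c \<bullet> u) + s\<^sup>2 * (norm (L a))\<^sup>2" for u s
        unfolding power2_norm_eq_inner
        by (simp add: linear_add[OF L(1)] linear_cmul[OF L(1)] inner_add_left inner_add_right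
            inner_commute[of "L u" "L a"] c power2_eq_square algebra_simps)
      moreover note exp[of "gradient_vec (p' x)" "\<epsilon> * q x"] exp[of "gradient_vec (q' x)" "- (\<epsilon> * p x)"]
      ultimately show ?thesis
        unfolding Np_def Nq_def by (simp add: power_mult_distrib algebra_simps)
    qed
    have h1: "((\<lambda>x. Np x + Nq x) has_integral (Ip + Iq)) ?C"
      unfolding Ip_def Iq_def using cN by (intro has_integral_add integrable_integral integrable_cube)
    have h2: "((\<lambda>x. p x * q' x c + q x * p' x (- c)) has_integral (?Rp + ?Rq)) ?C"
      by (intro has_integral_add integrable_integral integrable_cube continuous_intros P Q)
    have h3: "((\<lambda>x. (p x)\<^sup>2 + (q x)\<^sup>2) has_integral integral ?C (\<lambda>x. (p x)\<^sup>2 + (q x)\<^sup>2)) ?C"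
      by (intro integrable_integral integrable_cube continuous_intros P Q)
    have "integral ?C (\<lambda>x. (norm (L (gradient_vec (p' x) + (\<epsilon> * q x) *\<^sub>R a)))\<^sup>2
        + (norm (L (gradient_vec (q' x) - (\<epsilon> * p x) *\<^sub>R a)))\<^sup>2)
      = (Ip + Iq) - 2 * \<epsilon> * (?Rp + ?Rq) + \<epsilon>\<^sup>2 * (norm (L a))\<^sup>2 * integral ?C (\<lambda>x. (p x)\<^sup>2 + (q x)\<^sup>2)"
      unfolding pt
      by (rule integral_unique[OF has_integral_add[OF has_integral_diff[OF h1
              has_integral_mult_right[OF h2]] has_integral_mult_right[OF h3]]])
    then show ?thesis using cross' by simp
  qed
  show thesis
  proof (rule that[of "1 / K"])
    show "1 / K > 0" using K by simp
  qed (rule main)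
qed

text \<open>In matrix form the hypotheses read H = J^T B^T B J and Re w = J^T \<eta>1, Im w = J^T
  \<eta>2. In the quadratic form of the inverse of H the factors J cancel and the inverse transpose
  of B remains, which is \<open>adjoint (inv_into UNIV B)\<close>. Real and imaginary parts
  contribute separately because H is real.\<close>

lemma covector_norm_sq_eq:
  fixes H :: "real^'n^'n" and B J :: "real^'n \<Rightarrow> real^'n"
  assumes H: "\<And>v w. B (J v) \<bullet> B (J w) = v \<bullet> (H *v w)"
    and B: "linear B" "bij B" and J: "linear J" "bij J"
    and re: "\<And>v. (\<Sum>i\<in>UNIV. Re (w $ i) * v $ i) = \<eta>1 \<bullet> J v"
    and im: "\<And>v. (\<Sum>i\<in>UNIV. Im (w $ i) * v $ i) = \<eta>2 \<bullet> J v"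
  shows "covector_norm_sq H w =
    (norm (adjoint (inv_into UNIV B) \<eta>1))\<^sup>2 + (norm (adjoint (inv_into UNIV B) \<eta>2))\<^sup>2"
proof -
  let ?L = "adjoint (inv_into UNIV B)" and ?S = "matrix_inv H"
  have linv: "linear (inv_into UNIV B)" using inj_linear_imp_inv_linear[OF B(1)] B(2) bij_is_inj by blast
  have BI: "B (inv_into UNIV B x) = x" "inv_into UNIV B (B x) = x" for x
    using B(2) by (simp_all add: bij_is_surj surj_f_inv_f bij_is_inj)
  have JI: "J (inv_into UNIV J x) = x" for x
    using J(2) by (simp_all add: bij_is_surj surj_f_inv_f)
  have L: "?L x \<bullet> y = x \<bullet> inv_into UNIV B y" for x y
    using adjoint_works[OF linv, of y x] by (simp add: inner_commute)
  have "x = 0" if "H *v x = 0" for x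
  proof -
    have "B (J x) = 0" using H[of x x] that by simp
    then show ?thesis
      using J B by (metis bij_is_inj linear_injective_0)
  qed
  then have "invertible H"
    using matrix_left_invertible_ker[of H] invertible_left_inverse by blast
  then have "?S ** H = mat 1"
    unfolding invertible_def matrix_inv_def by (rule someI2_ex) simp
  then have SH: "?S *v (H *v x) = x" for x
    by (simp add: matrix_vector_mul_assoc)
  have quad: "z \<bullet> (?S *v z) = (norm (?L \<eta>))\<^sup>2" if z: "\<And>v. z \<bullet> v = \<eta> \<bullet> J v" for z \<eta>
  proof -
    \<comment> \<open>The explicit solution of \<open>H *v y = z\<close>, so that the inverse matrix
      need not be computed.\<close>
    define y where "y = inv_into UNIV J (inv_into UNIV B (?L \<eta>))"
    have "v \<bullet> (H *v y) = v \<bullet> z" for v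
    proof -
      have "v \<bullet> (H *v y) = B (J v) \<bullet> ?L \<eta>"
        using H[of v y] by (simp add: y_def BI JI)
      also have "\<dots> = ?L \<eta> \<bullet> B (J v)" by (rule inner_commute)
      also have "\<dots> = \<eta> \<bullet> J v" by (simp add: L BI)
      also have "\<dots> = v \<bullet> z" using z[of v] by (simp add: inner_commute)
      finally show ?thesis .
    qed
    then have "H *v y = z" by (metis vector_eq_ldot)
    then have "z \<bullet> (?S *v z) = z \<bullet> y" using SH by metis
    also have "\<dots> = \<eta> \<bullet> inv_into UNIV B (?L \<eta>)" using z[of y] by (simp add: y_def JI)
    also have "\<dots> = ?L \<eta> \<bullet> ?L \<eta>" using L by simp
    finally show ?thesis by (simp add: power2_norm_eq_inner)
  qed
  have q1: "(\<chi> i. Re (w $ i)) \<bullet> (?S *v (\<chi> i. Re (w $ i))) = (norm (?L \<eta>1))\<^sup>2"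
    using re by (intro quad) (simp add: inner_vec_def)
  have q2: "(\<chi> i. Im (w $ i)) \<bullet> (?S *v (\<chi> i. Im (w $ i))) = (norm (?L \<eta>2))\<^sup>2"
    using im by (intro quad) (simp add: inner_vec_def)
  have "covector_norm_sq H w = (\<Sum>i\<in>UNIV. \<Sum>j\<in>UNIV. ?S $ i $ j * (Re (w $ i) * Re (w $ j) + Im (w $ i) * Im (w $ j)))"
    by (simp add: covector_norm_sq_def algebra_simps)
  also have "\<dots> = (\<chi> i. Re (w $ i)) \<bullet> (?S *v (\<chi> i. Re (w $ i))) + (\<chi> i. Im (w $ i)) \<bullet> (?S *v (\<chi> i. Im (w $ i)))"
    by (simp add: inner_vec_def matrix_vector_mult_def sum_distrib_left sum.distrib algebra_simps)
  finally show ?thesis using q1 q2 by simp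
qed

text \<open>With M the matrix of B after J, H is the Gram matrix \<open>transpose M ** M\<close>, so
  its determinant is a square.\<close>

lemma sqrt_det_gram:
  fixes H :: "real^'n^'n" and B J :: "real^'n \<Rightarrow> real^'n"
  assumes H: "\<And>v w. B (J v) \<bullet> B (J w) = v \<bullet> (H *v w)" and lin: "linear B" "linear J"
  shows "sqrt (det H) = \<bar>det (matrix B)\<bar> * \<bar>det (matrix J)\<bar>"
proof -
  define M where "M = matrix B ** matrix J"
  have MB: "M *v v = B (J v)" for v
    using lin by (simp add: M_def matrix_vector_mul_assoc[symmetric] matrix_works)
  have "v \<bullet> (H *v w) = v \<bullet> ((transpose M ** M) *v w)" for v w
  proof -
    have "v \<bullet> ((transpose M ** M) *v w) = (M *v w v* M) \<bullet> v"
      unfolding matrix_vector_mul_assoc[symmetric] transpose_matrix_vector by (rule inner_commute)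
    also have "\<dots> = (M *v w) \<bullet> (M *v v)" by (rule dot_lmul_matrix)
    finally show ?thesis using H[of v w] by (simp add: MB inner_commute)
  qed
  then have "H = transpose M ** M"
    unfolding matrix_eq by (metis vector_eq_ldot)
  then have "det H = (det (matrix B) * det (matrix J))\<^sup>2"
    by (simp add: M_def det_mul det_transpose power2_eq_square)
  then show ?thesis by (simp add: abs_mult)
qed

section \<open>Fields on the torus\<close>

lemma torus_proj_eq_iff: "torus_proj x = torus_proj y \<longleftrightarrow> x - y \<in> integer_lattice"
  by (simp add: torus.abs_eq_iff integer_lattice_def)

lemma torus_proj_rep [simp]: "torus_proj (torus_rep p) = p"
  using Quotient3_abs_rep[OF Quotient3_torus] .

lemma tpull_periodic: "m \<in> integer_lattice \<Longrightarrow> tpull f (x + m) = tpull f x"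
  using torus_proj_eq_iff[of "x + m" x] by (simp add: tpull_def)

lemma tpull_descend:
  fixes F :: "real^'n \<Rightarrow> 'b"
  assumes "\<And>m x. m \<in> integer_lattice \<Longrightarrow> F (x + m) = F x"
  shows "tpull (\<lambda>p. F (torus_rep p)) = F"
proof
  fix x :: "real^'n"
  have "torus_rep (torus_proj x) - x \<in> integer_lattice"
    using torus_proj_eq_iff torus_proj_rep by blast
  from assms[OF this, of x] show "tpull (\<lambda>p. F (torus_rep p)) x = F x"
    by (simp add: tpull_def)
qed

lemma flat_torus_space_tpull:
  assumes "flat_metric h"
  shows "flat_torus_space (\<lambda>x v w. v \<bullet> (tpull h x *v w))"
proof
  show "0 < v \<bullet> (tpull h x *v v)" if "v \<noteq> 0" for x v
    using assms that by (simp add: flat_metric_def riemannian_metric_def tpull_def)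
  show "\<exists>U F. x \<in> U \<and> local_isometry (\<lambda>x v w. v \<bullet> (tpull h x *v w)) U F" for x
  proof -
    from assms obtain U and F :: "real^'a \<Rightarrow> real^'a" where
      U: "open U" "x \<in> U" "smooth_on U F" "inj_on F U"
      "\<forall>y\<in>U. \<forall>v w. frechet_derivative F (at y) v \<bullet> frechet_derivative F (at y) w = v \<bullet> (tpull h y *v w)"
      unfolding flat_metric_def by meson
    have "local_isometry (\<lambda>x v w. v \<bullet> (tpull h x *v w)) U F"
      by (rule local_isometryI) (use U in auto)
    then show ?thesis using U(2) by blast
  qed
qed (simp add: tpull_periodic)

text \<open>Closedness is given for pairs of axis directions; bilinear expansion extends the
  symmetry of the derivative to all v and w.\<close>

lemma closed_one_form_smooth:
  assumes "closed_one_form \<beta>"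
  shows "(tpull \<beta> has_derivative frechet_derivative (tpull \<beta>) (at x)) (at x)"
    and "smooth_on UNIV (tpull \<beta>)"
    and "frechet_derivative (tpull \<beta>) (at x) v \<bullet> w = frechet_derivative (tpull \<beta>) (at x) w \<bullet> v"
proof -
  show sm: "smooth_on UNIV (tpull \<beta>)"
    using assms by (simp add: closed_one_form_def torus_smooth_def)
  let ?D = "frechet_derivative (tpull \<beta>) (at x)"
  show D: "(tpull \<beta> has_derivative ?D) (at x)"
    using smooth_on_has_derivative[OF sm] by simp
  have "tpartial (\<lambda>p. \<beta> p $ j) i x = ?D (axis i 1) $ j" for i j
  proof -
    have "((\<lambda>x. tpull \<beta> x $ j) has_derivative (\<lambda>v. ?D v $ j)) (at x)"
      by (rule bounded_linear.has_derivative[OF bounded_linear_vec_nth D])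
    moreover have "tpull (\<lambda>p. \<beta> p $ j) = (\<lambda>x. tpull \<beta> x $ j)" by (simp add: tpull_def fun_eq_iff)
    ultimately show ?thesis unfolding tpartial_def by (simp add: frechet_derivative_at[symmetric])
  qed
  then have sym: "?D (axis i 1) $ j = ?D (axis j 1) $ i" for i j
    using assms by (metis closed_one_form_def)
  have lin: "linear ?D" using D by (rule has_derivative_linear)
  have exp: "?D v \<bullet> w = (\<Sum>i\<in>UNIV. \<Sum>j\<in>UNIV. v $ i * w $ j * ?D (axis i 1) $ j)" for v w
  proof -
    have "?D v = (\<Sum>i\<in>UNIV. v $ i *\<^sub>R ?D (axis i 1))"
    proof -
      have "?D v = ?D (\<Sum>i\<in>UNIV. v $ i *\<^sub>R axis i 1)"
        using basis_expansion[of v] by (simp add: scalar_mult_eq_scaleR)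
      then show ?thesis using lin by (simp add: linear_sum linear_cmul)
    qed
    then show ?thesis
      by (simp add: inner_vec_def sum_distrib_right sum_distrib_left mult_ac)
        (rule sum.swap)
  qed
  have "?D v \<bullet> w = (\<Sum>i\<in>UNIV. \<Sum>j\<in>UNIV. v $ i * w $ j * ?D (axis j 1) $ i)"
    unfolding exp by (intro sum.cong refl) (subst sym, rule refl)
  also have "\<dots> = (\<Sum>j\<in>UNIV. \<Sum>i\<in>UNIV. v $ i * w $ j * ?D (axis j 1) $ i)" by (rule sum.swap)
  also have "\<dots> = ?D w \<bullet> v" unfolding exp by (simp add: mult_ac)
  finally show "?D v \<bullet> w = ?D w \<bullet> v" .
qed

text \<open>Differentiation under the integral gives \<open>b (t *\<^sub>R x) \<bullet> v\<close>
  plus t times the derivative of b in direction v, paired with x. Symmetry exchanges v and x there,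
  and the integrand becomes the t-derivative of
  \<open>t *\<^sub>R b (t *\<^sub>R x) \<bullet> v\<close>.\<close>

lemma poincare_lemma:
  fixes b :: "'a::euclidean_space \<Rightarrow> 'a"
  assumes sm: "smooth_on UNIV b"
    and sym: "\<And>x v w. frechet_derivative b (at x) v \<bullet> w = frechet_derivative b (at x) w \<bullet> v"
  shows "((\<lambda>x. integral (cbox 0 1) (\<lambda>t::real. b (t *\<^sub>R x) \<bullet> x)) has_derivative (\<lambda>v. b x0 \<bullet> v)) (at x0)"
proof -
  let ?D = "\<lambda>x. frechet_derivative b (at x)"
  have D: "(b has_derivative ?D x) (at x)" for x using smooth_on_has_derivative[OF sm] by simp
  have lin: "linear (?D x)" for x using D by (rule has_derivative_linear)
  have cD: "continuous_on UNIV (\<lambda>x. ?D x v)" for v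
    by (rule smooth_on_imp_continuous_on[OF smooth_on_derivative[OF sm]])
  have cb: "continuous_on UNIV b" by (rule smooth_on_imp_continuous_on[OF sm])
  let ?f' = "\<lambda>x (t::real) v. b (t *\<^sub>R x) \<bullet> v + t *\<^sub>R ?D (t *\<^sub>R x) v \<bullet> x"
  \<comment> \<open>The derivative is packaged as a bounded linear function because
    \<open>leibniz_rule\<close> integrates it in that space.\<close>
  define fx where "fx x t = Blinfun (?f' x t)" for x t
  have bl: "bounded_linear (?f' x t)" for x t
    by (rule linear_conv_bounded_linear[THEN iffD1], rule linearI)
      (simp_all add: linear_add[OF lin] linear_cmul[OF lin] inner_add_right inner_add_left algebra_simps)
  have fx: "blinfun_apply (fx x t) = ?f' x t" for x t
    unfolding fx_def using bl by (rule bounded_linear_Blinfun_apply)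
  have D_sum: "?D y x = (\<Sum>i\<in>Basis. (x \<bullet> i) *\<^sub>R ?D y i)" for x y
  proof -
    have "?D y x = ?D y (\<Sum>i\<in>Basis. (x \<bullet> i) *\<^sub>R i)" by (simp add: euclidean_representation)
    then show ?thesis using lin by (simp add: linear_sum linear_cmul)
  qed
  have 1: "((\<lambda>x. integral (cbox 0 1) (\<lambda>t. b (t *\<^sub>R x) \<bullet> x)) has_derivative
      integral (cbox 0 1) (fx x0)) (at x0 within UNIV)"
  proof (rule leibniz_rule)
    fix x :: 'a and t :: real
    have "((\<lambda>x. t *\<^sub>R x) has_derivative (\<lambda>v. t *\<^sub>R v)) (at x)" by (auto intro!: derivative_eq_intros)
    from has_derivative_compose[OF this D]
    have "((\<lambda>x. b (t *\<^sub>R x)) has_derivative (\<lambda>v. ?D (t *\<^sub>R x) (t *\<^sub>R v))) (at x)" .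
    from has_derivative_inner[OF this has_derivative_ident]
    show "((\<lambda>x. b (t *\<^sub>R x) \<bullet> x) has_derivative blinfun_apply (fx x t)) (at x within UNIV)"
      unfolding fx by (simp add: linear_cmul[OF lin])
    show "(\<lambda>t. b (t *\<^sub>R x) \<bullet> x) integrable_on cbox 0 1"
      by (intro integrable_continuous continuous_intros continuous_on_compose2[OF cb]) simp
  next
    show "continuous_on (UNIV \<times> cbox 0 1) (\<lambda>(x, t). fx x t)"
    proof (rule continuous_on_blinfun_componentwise)
      fix i :: 'a
      show "continuous_on (UNIV \<times> cbox 0 1) (\<lambda>z. blinfun_apply (case z of (x, t) \<Rightarrow> fx x t) i)"
        unfolding case_prod_unfold fx
        by (intro continuous_intros continuous_on_compose2[OF cb] continuous_on_compose2[OF cD[of i]]) simp_all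
    qed
  qed simp_all
  have int: "fx x0 integrable_on cbox 0 1"
  proof (intro integrable_continuous continuous_on_blinfun_componentwise)
    fix i :: 'a
    show "continuous_on (cbox 0 1) (\<lambda>t. blinfun_apply (fx x0 t) i)"
      unfolding fx
      by (intro continuous_intros continuous_on_compose2[OF cb] continuous_on_compose2[OF cD[of i]]) simp_all
  qed
  have "blinfun_apply (integral (cbox 0 1) (fx x0)) v = b x0 \<bullet> v" for v
  proof -
    have "((\<lambda>t. ?f' x0 t v) has_integral (1 *\<^sub>R b (1 *\<^sub>R x0) \<bullet> v - 0 *\<^sub>R b (0 *\<^sub>R x0) \<bullet> v)) {0..1}"
    proof (rule fundamental_theorem_of_calculus)
      fix t :: real
      have "((\<lambda>t. t *\<^sub>R x0) has_derivative (\<lambda>s. s *\<^sub>R x0)) (at t)" by (auto intro!: derivative_eq_intros)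
      from has_derivative_compose[OF this D]
      have b': "((\<lambda>t. b (t *\<^sub>R x0)) has_derivative (\<lambda>s. ?D (t *\<^sub>R x0) (s *\<^sub>R x0))) (at t)" .
      have "((\<lambda>t. t *\<^sub>R b (t *\<^sub>R x0) \<bullet> v) has_derivative
          (\<lambda>s. (t *\<^sub>R ?D (t *\<^sub>R x0) (s *\<^sub>R x0) + s *\<^sub>R b (t *\<^sub>R x0)) \<bullet> v)) (at t)"
        by (rule has_derivative_inner_left[OF has_derivative_scaleR[OF has_derivative_ident b']])
      also have "(\<lambda>s. (t *\<^sub>R ?D (t *\<^sub>R x0) (s *\<^sub>R x0) + s *\<^sub>R b (t *\<^sub>R x0)) \<bullet> v) = (\<lambda>s. s *\<^sub>R ?f' x0 t v)"
        by (simp add: linear_cmul[OF lin] inner_add_left sym[of "t *\<^sub>R x0" v x0] algebra_simps fun_eq_iff)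
      finally show "((\<lambda>t. t *\<^sub>R b (t *\<^sub>R x0) \<bullet> v) has_vector_derivative ?f' x0 t v) (at t within {0..1})"
        unfolding has_vector_derivative_def by (rule has_derivative_at_withinI)
    qed simp
    then show ?thesis
      unfolding blinfun_apply_integral[OF int] fx by (simp add: integral_unique)
  qed
  then have "blinfun_apply (integral (cbox 0 1) (fx x0)) = (\<lambda>v. b x0 \<bullet> v)" by blast
  then show ?thesis using 1 by simp
qed

text \<open>The vector \<open>a\<close> collects the periods of the form over the coordinate loops.\<close>

proposition closed_one_form_potential:
  assumes \<beta>: "closed_one_form \<beta>"
  obtains G a where "smooth_on UNIV G" "\<And>x. (G has_derivative (\<lambda>v. tpull \<beta> x \<bullet> v)) (at x)"
    "\<And>m x. m \<in> integer_lattice \<Longrightarrow> G (x + m) = G x + a \<bullet> m"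
proof -
  define G where "G x = integral (cbox 0 1) (\<lambda>t::real. tpull \<beta> (t *\<^sub>R x) \<bullet> x)" for x
  have D: "(G has_derivative (\<lambda>v. tpull \<beta> x \<bullet> v)) (at x)" for x
    unfolding G_def
    by (rule poincare_lemma[OF closed_one_form_smooth(2)[OF \<beta>] closed_one_form_smooth(3)[OF \<beta>]])
  have sm: "smooth_on UNIV G"
    by (rule smooth_onI_derivative[OF open_UNIV D])
      (rule smooth_on_linear[OF bounded_linear_inner_left open_UNIV closed_one_form_smooth(2)[OF \<beta>]])
  \<comment> \<open>The difference \<open>G (x + m) - G x\<close> has derivative zero because the
    form is periodic, so it equals its value at 0.\<close>
  have shift: "G (x + m) = G x + (G m - G 0)" if m: "m \<in> integer_lattice" for x m
  proof -
    have "((\<lambda>x. G (x + m) - G x) has_derivative (\<lambda>v. 0)) (at y)" for y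
    proof -
      have "((\<lambda>x. x + m) has_derivative (\<lambda>v. v)) (at y)" by (auto intro!: derivative_eq_intros)
      from has_derivative_diff[OF has_derivative_compose[OF this D] D]
      show ?thesis by (simp add: tpull_periodic[OF m])
    qed
    from has_derivative_zero_unique_connected[where f = "\<lambda>x. G (x + m) - G x", OF open_UNIV connected_UNIV this UNIV_I UNIV_I]
    have "G (x + m) - G x = G (0 + m) - G 0" .
    then show ?thesis by simp
  qed
  define a where "a = (\<chi> i. G (axis i 1) - G 0)"
  have "G m - G 0 = a \<bullet> m" if m: "m \<in> integer_lattice" for m
  proof -
    have "G m - G 0 = (\<Sum>i\<in>UNIV. m $ i *\<^sub>R (G (axis i 1) - G 0))"
      by (rule lattice_additive_eq[where b = "\<lambda>m. G m - G 0", OF _ m]) (use shift in simp)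
    then show ?thesis by (simp add: a_def inner_vec_def mult.commute)
  qed
  then have "G (x + m) = G x + a \<bullet> m" if "m \<in> integer_lattice" for m x
    using shift[OF that] that by simp
  with sm D show thesis by (rule that)
qed

section \<open>The Rayleigh quotient in flat coordinates\<close>

lemma periodic_C1_smooth:
  assumes "smooth_on UNIV p" "\<And>m x. m \<in> integer_lattice \<Longrightarrow> p (x + m) = p x"
  shows "periodic_C1 p (\<lambda>x. frechet_derivative p (at x))"
  unfolding periodic_C1_def
  using smooth_on_has_derivative[OF assms(1)] smooth_on_imp_continuous_on[OF smooth_on_derivative[OF assms(1)]]
    assms(2) by simp

text \<open>Multiplication by a unit complex number rotates the pair of real and imaginary parts;
  this is how a gauge phase acts on the energy density.\<close>

lemma norm_sq_rotation:
  fixes L :: "'a::real_inner \<Rightarrow> 'b::real_inner"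
  assumes "linear L"
  shows "(norm (L (cos \<theta> *\<^sub>R x - sin \<theta> *\<^sub>R y)))\<^sup>2 + (norm (L (sin \<theta> *\<^sub>R x + cos \<theta> *\<^sub>R y)))\<^sup>2
    = (norm (L x))\<^sup>2 + (norm (L y))\<^sup>2"
proof -
  have "(norm (c *\<^sub>R u - s *\<^sub>R v))\<^sup>2 + (norm (s *\<^sub>R u + c *\<^sub>R v))\<^sup>2 = (s\<^sup>2 + c\<^sup>2) * ((norm u)\<^sup>2 + (norm v)\<^sup>2)"
    for c s and u v :: 'b
    unfolding power2_norm_eq_inner
    by (simp add: inner_add_left inner_add_right inner_diff_left inner_diff_right inner_commute[of v u]
        power2_eq_square algebra_simps)
  then show ?thesis
    by (simp add: linear_add[OF assms] linear_diff[OF assms] linear_cmul[OF assms])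
qed

locale flat_coordinates =
  fixes h :: "'n::finite torus \<Rightarrow> real^'n^'n" and B \<Psi> \<Theta> :: "real^'n \<Rightarrow> real^'n"
  assumes B: "linear B" "bij B" and smooth: "smooth_on UNIV \<Psi>" "smooth_on UNIV \<Theta>"
    and inverse: "\<Theta> (\<Psi> x) = x" "\<Psi> (\<Theta> y) = y"
    and equivariant: "m \<in> integer_lattice \<Longrightarrow> \<Psi> (x + m) = \<Psi> x + m"
    and bij_derivative: "bij (frechet_derivative \<Psi> (at x))"
    and metric: "B (frechet_derivative \<Psi> (at x) v) \<bullet> B (frechet_derivative \<Psi> (at x) w) = v \<bullet> (tpull h x *v w)"
    and inverse_derivative: "frechet_derivative \<Psi> (at (\<Theta> y)) (frechet_derivative \<Theta> (at y) v) = v"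
begin

abbreviation "J \<equiv> \<lambda>x. frechet_derivative \<Psi> (at x)"

text \<open>The inverse transpose of B. The constant metric has Gram matrix B^T B, so
  \<open>norm (L \<eta>)\<close> is the dual norm of the constant covector \<eta>.\<close>

definition "L = adjoint (inv_into UNIV B)"

lemma linear_inverse_B: "linear (inv_into UNIV B)"
  using inj_linear_imp_inv_linear[OF B(1)] B(2) bij_is_inj by blast

lemma B_inverse [simp]: "B (inv_into UNIV B x) = x" "inv_into UNIV B (B x) = x"
  using B(2) by (simp_all add: bij_is_surj surj_f_inv_f bij_is_inj)

lemma L_inner: "L x \<bullet> y = x \<bullet> inv_into UNIV B y"
  unfolding L_def using adjoint_works[OF linear_inverse_B, of y x] by (simp add: inner_commute)

lemma linear_L: "linear L"
  unfolding L_def using linear_inverse_B by (rule adjoint_linear)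

lemma inj_L: "inj L"
  unfolding linear_injective_0[OF linear_L]
proof (intro allI impI)
  fix x assume "L x = 0"
  then have "x \<bullet> y = 0" for y using L_inner[of x "B y"] by simp
  then show "x = 0" by (metis inner_eq_zero_iff)
qed

lemma L_adjoint_B: "L x \<bullet> B y = x \<bullet> y"
  by (simp add: L_inner)

lemma \<Psi>_derivative: "(\<Psi> has_derivative J x) (at x)"
  using smooth_on_has_derivative[OF smooth(1)] by simp

lemma linear_J: "linear (J x)"
  using \<Psi>_derivative by (rule has_derivative_linear)

lemma \<Theta>_equivariant: "m \<in> integer_lattice \<Longrightarrow> \<Theta> (y + m) = \<Theta> y + m"
  using equivariant[of m "\<Theta> y"] inverse by metis

lemma det_B: "det (matrix B) \<noteq> 0"
  using det_nz_iff_inj[OF B(1)] B(2) bij_is_inj by blast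

text \<open>The volume density factors into the determinants of B and of the Jacobian of \<Psi>. The
  latter is absorbed by the change of variables; the former is constant and cancels in Rayleigh
  quotients.\<close>

lemma volume_integral_eq:
  assumes F: "continuous_on UNIV F" "\<And>m x. m \<in> integer_lattice \<Longrightarrow> F (x + m) = F x"
  shows "volume_integral h (\<lambda>x. F (\<Psi> x)) = \<bar>det (matrix B)\<bar> * integral (cbox 0 1) F"
proof -
  have "((\<lambda>x. \<bar>det (matrix (J x))\<bar> * F (\<Psi> x)) has_integral integral (cbox 0 1) F) (cbox 0 1)"
    by (rule has_integral_periodic_change_of_variables[OF \<Psi>_derivative inverse
          smooth_on_imp_continuous_on[OF smooth(2)] equivariant F])
  from has_integral_mult_right[OF this, of "\<bar>det (matrix B)\<bar>"]
  have "((\<lambda>x. F (\<Psi> x) * sqrt (det (tpull h x))) has_integral \<bar>det (matrix B)\<bar> * integral (cbox 0 1) F) (cbox 0 1)"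
    using sqrt_det_gram[OF metric B(1) linear_J] by (simp add: mult_ac)
  then show ?thesis unfolding volume_integral_def by (rule integral_unique)
qed

end

locale flat_coordinates_form = flat_coordinates +
  fixes \<beta> :: "'a::finite torus \<Rightarrow> real^'a" and G :: "real^'a \<Rightarrow> real" and a :: "real^'a"
  assumes G_smooth: "smooth_on UNIV G" and G_derivative: "(G has_derivative (\<lambda>v. tpull \<beta> x \<bullet> v)) (at x)"
    and G_shift: "m \<in> integer_lattice \<Longrightarrow> G (x + m) = G x + a \<bullet> m"
begin

text \<open>The form \<open>\<beta>\<close> is the sum of the parallel form \<open>\<Psi>\<^sup>*a\<close> and the differential of \<open>f\<close>, which is
  removed by a gauge transformation.\<close>

definition "f x = G x - a \<bullet> \<Psi> x"

lemma f_smooth: "smooth_on UNIV f"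
  unfolding f_def
  by (intro smooth_on_diff open_UNIV G_smooth smooth_on_linear[OF bounded_linear_inner_right _ smooth(1)])

lemma f_periodic: "m \<in> integer_lattice \<Longrightarrow> f (x + m) = f x"
  by (simp add: f_def G_shift equivariant inner_add_right)

lemma f_derivative: "(f has_derivative (\<lambda>t. tpull \<beta> x \<bullet> t - a \<bullet> J x t)) (at x)"
  unfolding f_def
  by (intro has_derivative_diff G_derivative bounded_linear.has_derivative[OF bounded_linear_inner_right \<Psi>_derivative])

text \<open>The function v = exp(-i e f) u in flat coordinates. For v = P + iQ, the covectors
  \<open>Z1\<close> and \<open>Z2\<close> defined next are the real and imaginary parts of dv - i e
  v a, the magnetic differential for constant coefficients. As f itself is periodic, v is periodic
  for every real e.\<close>

definition "gauged e u y = cis (- e * f (\<Theta> y)) * tpull u (\<Theta> y)"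

definition "Z1 e u y = gradient_vec (frechet_derivative (\<lambda>y. Re (gauged e u y)) (at y)) + (e * Im (gauged e u y)) *\<^sub>R a"

definition "Z2 e u y = gradient_vec (frechet_derivative (\<lambda>y. Im (gauged e u y)) (at y)) - (e * Re (gauged e u y)) *\<^sub>R a"

lemma smooth_gauge: "smooth_on UNIV (\<lambda>x. cis (e * f x))"
proof (rule smooth_on_compose[OF open_UNIV open_UNIV _ smooth_on_cis])
  show "smooth_on UNIV (\<lambda>x. e * f x)"
    by (rule smooth_on_mult[OF open_UNIV smooth_on_const f_smooth])
qed simp

lemma gauged_smooth:
  assumes "torus_smooth u"
  shows "smooth_on UNIV (gauged e u)"
proof -
  have "smooth_on UNIV (\<lambda>x. cis (- e * f x) * tpull u x)"
    using assms by (intro smooth_on_mult smooth_gauge open_UNIV) (simp add: torus_smooth_def)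
  from smooth_on_compose[OF open_UNIV open_UNIV _ this smooth(2)] show ?thesis
    by (simp add: gauged_def[abs_def])
qed

lemma gauged_periodic: "m \<in> integer_lattice \<Longrightarrow> gauged e u (y + m) = gauged e u y"
  by (simp add: gauged_def \<Theta>_equivariant f_periodic tpull_periodic)

lemma periodic_C1_gauged:
  assumes "torus_smooth u"
  shows "periodic_C1 (\<lambda>y. Re (gauged e u y)) (\<lambda>y. frechet_derivative (\<lambda>y. Re (gauged e u y)) (at y))"
    and "periodic_C1 (\<lambda>y. Im (gauged e u y)) (\<lambda>y. frechet_derivative (\<lambda>y. Im (gauged e u y)) (at y))"
  using smooth_on_linear[OF bounded_linear_Re open_UNIV gauged_smooth[OF assms]]
    smooth_on_linear[OF bounded_linear_Im open_UNIV gauged_smooth[OF assms]]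
  by (intro periodic_C1_smooth; simp add: gauged_periodic)+

lemma tpull_gauged:
  "tpull u x = cis (e * f x) * (complex_of_real (Re (gauged e u (\<Psi> x))) + \<i> * complex_of_real (Im (gauged e u (\<Psi> x))))"
proof -
  have "tpull u x = cis (e * f x) * gauged e u (\<Psi> x)"
    by (simp add: gauged_def inverse cis_mult mult.assoc[symmetric])
  then show ?thesis using complex_eq[of "gauged e u (\<Psi> x)"] by (simp only:)
qed

text \<open>For u = exp(i e f) v the product rule produces a term with i e df, which cancels the
  exact part of \<beta>. What remains is the phase times the pullback under \<Psi> of dv - i e v a.
  The phase drops out by rotation invariance, the pullback by
  \<open>covector_norm_sq_eq\<close>.\<close>

lemma covector_norm_magnetic_differential:
  assumes u: "torus_smooth u"
  shows "covector_norm_sq (tpull h x) (magnetic_differential (\<lambda>p. e *\<^sub>R \<beta> p) u x)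
    = (norm (L (Z1 e u (\<Psi> x))))\<^sup>2 + (norm (L (Z2 e u (\<Psi> x))))\<^sup>2"
proof -
  let ?P = "\<lambda>y. Re (gauged e u y)" and ?Q = "\<lambda>y. Im (gauged e u y)"
  let ?P' = "frechet_derivative ?P (at (\<Psi> x))" and ?Q' = "frechet_derivative ?Q (at (\<Psi> x))"
  let ?z1 = "Z1 e u (\<Psi> x)" and ?z2 = "Z2 e u (\<Psi> x)" and ?\<theta> = "e * f x"
  let ?w = "magnetic_differential (\<lambda>p. e *\<^sub>R \<beta> p) u x"
  have P: "(?P has_derivative ?P') (at (\<Psi> x))" and Q: "(?Q has_derivative ?Q') (at (\<Psi> x))"
    using periodic_C1D(1)[OF periodic_C1_gauged(1)[OF u]] periodic_C1D(1)[OF periodic_C1_gauged(2)[OF u]] by blast+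
  have lin: "linear ?P'" "linear ?Q'" using P Q has_derivative_linear by blast+
  define Du where "Du t = cis ?\<theta> * (complex_of_real (?P' (J x t)) + \<i> * complex_of_real (?Q' (J x t)))
      + cis ?\<theta> * (\<i> * complex_of_real (e * (tpull \<beta> x \<bullet> t - a \<bullet> J x t)))
        * (complex_of_real (?P (\<Psi> x)) + \<i> * complex_of_real (?Q (\<Psi> x)))" for t
  have "(tpull u has_derivative Du) (at x)"
  proof -
    have c: "((\<lambda>x. cis (e * f x)) has_derivative
        (\<lambda>t. cis ?\<theta> * (\<i> * complex_of_real (e * (tpull \<beta> x \<bullet> t - a \<bullet> J x t))))) (at x)"
    proof -
      have "((\<lambda>x. \<i> * complex_of_real (e * f x)) has_derivative
          (\<lambda>t. \<i> * complex_of_real (e * (tpull \<beta> x \<bullet> t - a \<bullet> J x t)))) (at x)"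
        by (intro has_derivative_mult_right bounded_linear.has_derivative[OF bounded_linear_of_real] f_derivative)
      from has_derivative_compose[OF this DERIV_exp[unfolded has_field_derivative_def]]
      show ?thesis by (simp add: cis_conv_exp)
    qed
    have pq: "((\<lambda>x. complex_of_real (?P (\<Psi> x)) + \<i> * complex_of_real (?Q (\<Psi> x))) has_derivative
        (\<lambda>t. complex_of_real (?P' (J x t)) + \<i> * complex_of_real (?Q' (J x t)))) (at x)"
      by (intro has_derivative_add has_derivative_mult_right bounded_linear.has_derivative[OF bounded_linear_of_real]
          has_derivative_compose[OF \<Psi>_derivative P] has_derivative_compose[OF \<Psi>_derivative Q])
    have "tpull u = (\<lambda>x. cis (e * f x) * (complex_of_real (?P (\<Psi> x)) + \<i> * complex_of_real (?Q (\<Psi> x))))"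
      using tpull_gauged by blast
    then show ?thesis
      using has_derivative_mult[OF c pq] by (simp only: Du_def[abs_def])
  qed
  then have tp: "tpartial u i x = Du (axis i 1)" for i
    unfolding tpartial_def by (simp add: frechet_derivative_at[symmetric])
  have z: "?z1 \<bullet> s = ?P' s + e * ?Q (\<Psi> x) * (a \<bullet> s)" "?z2 \<bullet> s = ?Q' s - e * ?P (\<Psi> x) * (a \<bullet> s)" for s
    by (simp_all add: Z1_def Z2_def inner_add_left inner_diff_left inner_gradient_vec[OF lin(1)] inner_gradient_vec[OF lin(2)])
  have w: "?w $ i = cis ?\<theta> * (complex_of_real (?z1 \<bullet> J x (axis i 1)) + \<i> * complex_of_real (?z2 \<bullet> J x (axis i 1)))" for i
  proof -
    have "tpull (\<lambda>p. e *\<^sub>R \<beta> p) x $ i = e * (tpull \<beta> x \<bullet> axis i 1)"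
      by (simp add: tpull_def inner_axis)
    then show ?thesis
      unfolding magnetic_differential_def vec_lambda_beta tp Du_def z tpull_gauged[of u x e]
      by (simp add: algebra_simps)
  qed
  define \<eta>1 where "\<eta>1 = cos ?\<theta> *\<^sub>R ?z1 - sin ?\<theta> *\<^sub>R ?z2"
  define \<eta>2 where "\<eta>2 = sin ?\<theta> *\<^sub>R ?z1 + cos ?\<theta> *\<^sub>R ?z2"
  have exp: "(\<Sum>i\<in>UNIV. (\<eta> \<bullet> J x (axis i 1)) * v $ i) = \<eta> \<bullet> J x v" for \<eta> v
  proof -
    have "linear (\<lambda>v. \<eta> \<bullet> J x v)"
      using linear_J by (simp add: linear_iff inner_add_right)
    from linear_axis_expansion[OF this, of v] show ?thesis by (simp add: mult.commute)
  qed
  have "Re (?w $ i) = \<eta>1 \<bullet> J x (axis i 1)" "Im (?w $ i) = \<eta>2 \<bullet> J x (axis i 1)" for i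
    unfolding w \<eta>1_def \<eta>2_def by (simp_all add: inner_add_left inner_diff_left algebra_simps)
  then have "covector_norm_sq (tpull h x) ?w = (norm (L \<eta>1))\<^sup>2 + (norm (L \<eta>2))\<^sup>2"
    unfolding L_def
    by (intro covector_norm_sq_eq[OF metric B linear_J bij_derivative]) (simp_all only: exp)
  then show ?thesis by (simp add: \<eta>1_def \<eta>2_def norm_sq_rotation[OF linear_L])
qed

lemma rayleigh_quotient_eq:
  assumes u: "torus_smooth u"
  shows "rayleigh_quotient h (\<lambda>p. e *\<^sub>R \<beta> p) u
    = integral (cbox 0 1) (\<lambda>y. (norm (L (Z1 e u y)))\<^sup>2 + (norm (L (Z2 e u y)))\<^sup>2)
      / integral (cbox 0 1) (\<lambda>y. (Re (gauged e u y))\<^sup>2 + (Im (gauged e u y))\<^sup>2)"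
proof -
  note P = periodic_C1_gauged(1)[OF u, of e] and Q = periodic_C1_gauged(2)[OF u, of e]
  have bl: "bounded_linear L" using linear_L linear_conv_bounded_linear by blast
  have cZ: "continuous_on UNIV (Z1 e u)" "continuous_on UNIV (Z2 e u)"
    unfolding Z1_def Z2_def
    by (intro continuous_intros continuous_gradient_vec[OF P] continuous_gradient_vec[OF Q]
        periodic_C1D(3)[OF P] periodic_C1D(3)[OF Q])+
  have "volume_integral h (\<lambda>x. covector_norm_sq (tpull h x) (magnetic_differential (\<lambda>p. e *\<^sub>R \<beta> p) u x))
      = \<bar>det (matrix B)\<bar> * integral (cbox 0 1) (\<lambda>y. (norm (L (Z1 e u y)))\<^sup>2 + (norm (L (Z2 e u y)))\<^sup>2)"
    unfolding covector_norm_magnetic_differential[OF u]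
  proof (rule volume_integral_eq)
    show "continuous_on UNIV (\<lambda>y. (norm (L (Z1 e u y)))\<^sup>2 + (norm (L (Z2 e u y)))\<^sup>2)"
      by (intro continuous_intros bounded_linear.continuous_on[OF bl] cZ)
    fix m x :: "real^'a" assume m: "m \<in> integer_lattice"
    show "(norm (L (Z1 e u (x + m))))\<^sup>2 + (norm (L (Z2 e u (x + m))))\<^sup>2
      = (norm (L (Z1 e u x)))\<^sup>2 + (norm (L (Z2 e u x)))\<^sup>2"
      using periodic_C1D(5)[OF P m, of x] periodic_C1D(5)[OF Q m, of x] gauged_periodic[OF m, of e u x]
      by (simp add: Z1_def Z2_def)
  qed
  moreover have "volume_integral h (\<lambda>x. (cmod (tpull u x))\<^sup>2)
      = \<bar>det (matrix B)\<bar> * integral (cbox 0 1) (\<lambda>y. (Re (gauged e u y))\<^sup>2 + (Im (gauged e u y))\<^sup>2)"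
  proof -
    have "cmod (tpull u x) = cmod (gauged e u (\<Psi> x))" for x
      by (simp add: gauged_def inverse norm_mult)
    then have "(cmod (tpull u x))\<^sup>2 = (Re (gauged e u (\<Psi> x)))\<^sup>2 + (Im (gauged e u (\<Psi> x)))\<^sup>2" for x
      by (simp only: cmod_power2)
    then show ?thesis
      using volume_integral_eq[of "\<lambda>y. (Re (gauged e u y))\<^sup>2 + (Im (gauged e u y))\<^sup>2"]
        periodic_C1D(3)[OF P, of UNIV] periodic_C1D(3)[OF Q, of UNIV] gauged_periodic
      by (simp add: continuous_intros)
  qed
  ultimately show ?thesis
    unfolding rayleigh_quotient_def using det_B by simp
qed

text \<open>A continuous nonnegative function with zero integral vanishes on the cube, and
  periodicity carries a point where u is nonzero into the cube.\<close>

lemma gauged_integral_pos: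
  assumes u: "torus_smooth u" "u \<noteq> (\<lambda>_. 0)"
  shows "integral (cbox 0 1) (\<lambda>y. (Re (gauged e u y))\<^sup>2 + (Im (gauged e u y))\<^sup>2) > 0"
proof -
  let ?F = "\<lambda>y. (Re (gauged e u y))\<^sup>2 + (Im (gauged e u y))\<^sup>2"
  note P = periodic_C1_gauged(1)[OF u(1), of e] and Q = periodic_C1_gauged(2)[OF u(1), of e]
  have c: "continuous_on S ?F" for S
    by (intro continuous_intros periodic_C1D(3)[OF P] periodic_C1D(3)[OF Q])
  obtain p where p: "u p \<noteq> 0" using u(2) by blast
  define y where "y = \<Psi> (torus_rep p)"
  have "gauged e u y \<noteq> 0" using p by (simp add: y_def gauged_def inverse tpull_def)
  moreover obtain m where m: "m \<in> integer_lattice" "y - m \<in> cbox 0 1" by (rule lattice_translate_into_cube)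
  ultimately have nz: "gauged e u (y - m) \<noteq> 0" using gauged_periodic[OF m(1), of e u "y - m"] by simp
  have "integral (cbox 0 1) ?F \<noteq> 0"
  proof
    assume "integral (cbox 0 1) ?F = 0"
    then have "(?F has_integral 0) (cbox 0 1)"
      using integrable_integral[OF integrable_cube[OF c], of 0 1] by simp
    moreover have "box 0 (1::real^'a) \<noteq> {}" by (simp add: interval_ne_empty_cart)
    ultimately have "?F (y - m) = 0"
      using has_integral_0_cbox_imp_0[OF c _ _ _ m(2)] by simp
    then show False using nz by (simp add: complex_eq_iff sum_power2_eq_zero_iff)
  qed
  moreover have "integral (cbox 0 1) ?F \<ge> 0"
    by (intro integral_nonneg integrable_cube c) simp
  ultimately show ?thesis by simp
qed

text \<open>This u0 is the function whose gauged form is the constant 1. Its gradient vanishes, and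
  only the term \<open>e *\<^sub>R a\<close> is left.\<close>

lemma ground_state_attained:
  defines "u0 \<equiv> \<lambda>e p. cis (e * f (torus_rep p))"
  shows "torus_smooth (u0 e)" "u0 e \<noteq> (\<lambda>_. 0)"
    and "rayleigh_quotient h (\<lambda>p. e *\<^sub>R \<beta> p) (u0 e) = e\<^sup>2 * (norm (L a))\<^sup>2"
proof -
  have tp: "tpull (u0 e) = (\<lambda>x. cis (e * f x))"
    unfolding u0_def by (rule tpull_descend) (simp add: f_periodic)
  then show sm: "torus_smooth (u0 e)"
    unfolding torus_smooth_def using smooth_gauge by simp
  show "u0 e \<noteq> (\<lambda>_. 0)"
  proof
    assume "u0 e = (\<lambda>_. 0)"
    then have "u0 e p = 0" for p by metis
    then show False by (simp add: u0_def)
  qed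
  have g: "gauged e (u0 e) = (\<lambda>y. 1)" by (simp add: gauged_def fun_eq_iff tp cis_mult)
  have "gradient_vec (\<lambda>h. 0) = (0 :: real^'a)" by (simp add: gradient_vec_def vec_eq_iff)
  then have "Z1 e (u0 e) y = 0" "Z2 e (u0 e) y = - (e *\<^sub>R a)" for y
    by (simp_all add: Z1_def Z2_def g frechet_derivative_const)
  then show "rayleigh_quotient h (\<lambda>p. e *\<^sub>R \<beta> p) (u0 e) = e\<^sup>2 * (norm (L a))\<^sup>2"
    unfolding rayleigh_quotient_eq[OF sm] g
    by (simp add: linear_0[OF linear_L] linear_neg[OF linear_L] linear_cmul[OF linear_L] power_mult_distrib)
qed

text \<open>The threshold is the one of the energy bound; it depends on B and a only, so it serves
  all test functions u at once.\<close>

proposition ground_state_energy_small: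
  obtains \<epsilon>0 where "\<epsilon>0 > 0"
    "\<And>e. 0 \<le> e \<Longrightarrow> e \<le> \<epsilon>0 \<Longrightarrow> ground_state_energy h (\<lambda>p. e *\<^sub>R \<beta> p) = e\<^sup>2 * (norm (L a))\<^sup>2"
proof -
  obtain \<epsilon>0 where \<epsilon>0: "\<epsilon>0 > 0" and bound:
    "\<And>\<epsilon> p p' q q'. 0 \<le> \<epsilon> \<Longrightarrow> \<epsilon> \<le> \<epsilon>0 \<Longrightarrow> periodic_C1 p p' \<Longrightarrow> periodic_C1 q q' \<Longrightarrow>
      \<epsilon>\<^sup>2 * (norm (L a))\<^sup>2 * integral (cbox 0 1) (\<lambda>x. (p x)\<^sup>2 + (q x)\<^sup>2) \<le>
      integral (cbox 0 1) (\<lambda>x. (norm (L (gradient_vec (p' x) + (\<epsilon> * q x) *\<^sub>R a)))\<^sup>2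
        + (norm (L (gradient_vec (q' x) - (\<epsilon> * p x) *\<^sub>R a)))\<^sup>2)"
    by (rule magnetic_energy_lower_bound[OF linear_L inj_L, of a]) (rule that)
  have "ground_state_energy h (\<lambda>p. e *\<^sub>R \<beta> p) = e\<^sup>2 * (norm (L a))\<^sup>2" if e: "0 \<le> e" "e \<le> \<epsilon>0" for e
    unfolding ground_state_energy_def
  proof (rule cInf_eq_minimum)
    show "e\<^sup>2 * (norm (L a))\<^sup>2 \<in> {rayleigh_quotient h (\<lambda>p. e *\<^sub>R \<beta> p) u |u. torus_smooth u \<and> u \<noteq> (\<lambda>_. 0)}"
      using ground_state_attained[of e] by (intro CollectI exI[of _ "\<lambda>p. cis (e * f (torus_rep p))"]) simp
    fix r assume "r \<in> {rayleigh_quotient h (\<lambda>p. e *\<^sub>R \<beta> p) u |u. torus_smooth u \<and> u \<noteq> (\<lambda>_. 0)}"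
    then obtain u where u: "torus_smooth u" "u \<noteq> (\<lambda>_. 0)" and r: "r = rayleigh_quotient h (\<lambda>p. e *\<^sub>R \<beta> p) u"
      by blast
    show "e\<^sup>2 * (norm (L a))\<^sup>2 \<le> r"
      unfolding r rayleigh_quotient_eq[OF u(1)] pos_le_divide_eq[OF gauged_integral_pos[OF u]]
      unfolding Z1_def Z2_def
      by (rule bound[OF e periodic_C1_gauged[OF u(1)]])
  qed
  with \<epsilon>0 show thesis by (rule that)
qed

end

section \<open>Periods and the first homology group\<close>

definition chain_sum :: "('a \<Rightarrow> 'b::real_vector) \<Rightarrow> ('a \<Rightarrow>\<^sub>0 int) \<Rightarrow> 'b"
  where "chain_sum f c = (\<Sum>\<sigma>\<in>Poly_Mapping.keys c. real_of_int (Poly_Mapping.lookup c \<sigma>) *\<^sub>R f \<sigma>)"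

lemma chain_sum_superset:
  assumes "finite A" "Poly_Mapping.keys c \<subseteq> A"
  shows "chain_sum f c = (\<Sum>\<sigma>\<in>A. real_of_int (Poly_Mapping.lookup c \<sigma>) *\<^sub>R f \<sigma>)"
  unfolding chain_sum_def
  by (rule sum.mono_neutral_left[OF assms]) (auto simp: in_keys_iff)

lemma chain_sum_zero [simp]: "chain_sum f 0 = 0"
  by (simp add: chain_sum_def)

lemma chain_sum_add: "chain_sum f (a + b) = chain_sum f a + chain_sum f b"
proof -
  let ?A = "Poly_Mapping.keys a \<union> Poly_Mapping.keys b"
  have "finite ?A" by simp
  moreover have "Poly_Mapping.keys (a + b) \<subseteq> ?A" by (rule Poly_Mapping.keys_add)
  ultimately show ?thesis
    by (simp add: chain_sum_superset[of ?A] lookup_add scaleR_left.add sum.distrib)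
qed

lemma chain_sum_cmul: "chain_sum f (frag_cmul z c) = real_of_int z *\<^sub>R chain_sum f c"
  using chain_sum_superset[OF finite_keys keys_cmul, of f z c]
  by (simp add: chain_sum_def scaleR_sum_right)

lemma chain_sum_diff: "chain_sum f (a - b) = chain_sum f a - chain_sum f b"
  using chain_sum_add[of f "a - b" b] by simp

lemma chain_sum_of [simp]: "chain_sum f (frag_of \<sigma>) = f \<sigma>"
  by (simp add: chain_sum_def)

lemma chain_sum_sum: "chain_sum f (\<Sum>i\<in>I. c i) = (\<Sum>i\<in>I. chain_sum f (c i))"
  by (induction I rule: infinite_finite_induct) (simp_all add: chain_sum_add)

lemma chain_sum_frag_extend: "chain_sum f (frag_extend b c) = chain_sum (\<lambda>x. chain_sum f (b x)) c"
  by (simp add: frag_extend_def chain_sum_sum chain_sum_cmul) (simp add: chain_sum_def)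

lemma chain_sum_cong: "(\<And>\<sigma>. \<sigma> \<in> Poly_Mapping.keys c \<Longrightarrow> f \<sigma> = g \<sigma>) \<Longrightarrow> chain_sum f c = chain_sum g c"
  by (simp add: chain_sum_def)

lemma simplex_edge_in_simplex: "t \<in> {0..1} \<Longrightarrow> simplex_edge t \<in> standard_simplex 1"
  by (auto simp: standard_simplex_def simplex_edge_def)

lemma chain_boundary_1:
  "chain_boundary 1 c = frag_extend (\<lambda>\<sigma>. frag_of (singular_face 1 0 \<sigma>) - frag_of (singular_face 1 1 \<sigma>)) c"
  by (simp add: chain_boundary_def)

lemma singular_face_1_vertex:
  "singular_face 1 0 \<sigma> (\<lambda>j. if j = 0 then 1 else 0) = \<sigma> (simplex_edge 1)"
  "singular_face 1 1 \<sigma> (\<lambda>j. if j = 0 then 1 else 0) = \<sigma> (simplex_edge 0)"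
proof -
  have "simplical_face 0 (\<lambda>j. if j = 0 then 1 else 0) = simplex_edge 1"
    "simplical_face 1 (\<lambda>j. if j = 0 then 1 else 0) = simplex_edge 0"
    by (auto simp: simplical_face_def simplex_edge_def fun_eq_iff)
  then show "singular_face 1 0 \<sigma> (\<lambda>j. if j = 0 then 1 else 0) = \<sigma> (simplex_edge 1)"
    "singular_face 1 1 \<sigma> (\<lambda>j. if j = 0 then 1 else 0) = \<sigma> (simplex_edge 0)"
    by (simp_all add: singular_face_def standard_simplex_0)
qed

text \<open>The sum factors through the boundary: each 0-simplex of the boundary is evaluated at its
  single vertex, and face 0 of an edge is its end, face 1 its start.\<close>

lemma cycle_sum_endpoints:
  fixes \<psi> :: "'a \<Rightarrow> 'b::real_vector"
  assumes "chain_boundary 1 c = 0"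
  shows "chain_sum (\<lambda>\<sigma>. \<psi> (\<sigma> (simplex_edge 1)) - \<psi> (\<sigma> (simplex_edge 0))) c = 0"
proof -
  have "chain_sum (\<lambda>\<tau>. \<psi> (\<tau> (\<lambda>j. if j = 0 then 1 else 0))) (chain_boundary 1 c) = 0"
    using assms by simp
  then show ?thesis
    unfolding chain_boundary_1 chain_sum_frag_extend chain_sum_diff chain_sum_of singular_face_1_vertex .
qed

section \<open>Lifts to the universal cover and winding vectors\<close>

lemma continuous_torus_proj: "continuous_on UNIV torus_proj"
  by (simp add: continuous_on_open_vimage open_torus_def)

text \<open>The k-th coordinate modulo 1 is recorded by \<open>cis (2 * pi * x $ k)\<close>, which
  never vanishes. Over a convex set this function has a continuous logarithm, and the imaginary part
  divided by 2 pi is the k-th coordinate of a lift.\<close>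

lemma torus_lift_exists:
  fixes f :: "'a::real_normed_vector \<Rightarrow> 'n::finite torus"
  assumes S: "convex S" and f: "continuous_on S f"
  obtains F where "continuous_on S F" "\<And>x. x \<in> S \<Longrightarrow> torus_proj (F x) = f x"
proof -
  define \<zeta> where "\<zeta> k p = cis (2 * pi * torus_rep p $ k)" for k and p :: "'n torus"
  have \<zeta>: "\<zeta> k (torus_proj x) = cis (2 * pi * x $ k)" for k x
  proof -
    have "torus_rep (torus_proj x) - x \<in> integer_lattice"
      using torus_proj_eq_iff torus_proj_rep by blast
    then obtain n where "torus_rep (torus_proj x) $ k - x $ k = of_int n"
      by (auto simp: integer_lattice_def Ints_def)
    then have rep: "torus_rep (torus_proj x) $ k = x $ k + of_int n" by linarith
    have "\<zeta> k (torus_proj x) = cis (2 * pi * x $ k) * cis (2 * pi * of_int n)"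
      by (simp only: \<zeta>_def rep cis_mult distrib_left)
    then show ?thesis by (simp add: cis_multiple_2pi)
  qed
  have "\<exists>l. continuous_on S l \<and> (\<forall>x\<in>S. \<zeta> k (f x) = exp (l x))" for k
  proof -
    have "continuous_on UNIV (\<zeta> k)"
      unfolding continuous_on_open_vimage[OF open_UNIV]
    proof (intro allI impI)
      fix U :: "complex set" assume U: "open U"
      have "torus_proj -` (\<zeta> k -` U) = (\<lambda>x. cis (2 * pi * x $ k)) -` U" by (auto simp: \<zeta>)
      moreover have "open ((\<lambda>x::real^'n. cis (2 * pi * x $ k)) -` U)"
        using U by (intro open_vimage) (auto intro!: continuous_intros)
      ultimately show "open (\<zeta> k -` U \<inter> UNIV)" by (simp add: open_torus_def)
    qed
    then have "continuous_on S (\<lambda>x. \<zeta> k (f x))"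
      by (rule continuous_on_compose2[OF _ f]) simp
    from continuous_logarithm_on_contractible[OF this convex_imp_contractible[OF S]]
    obtain l where "continuous_on S l" "\<And>x. x \<in> S \<Longrightarrow> \<zeta> k (f x) = exp (l x)"
      by (auto simp: \<zeta>_def)
    then show ?thesis by blast
  qed
  then have "\<forall>k. \<exists>l. continuous_on S l \<and> (\<forall>x\<in>S. \<zeta> k (f x) = exp (l x))" by blast
  from choice[OF this] obtain l where l: "continuous_on S (l k)" "x \<in> S \<Longrightarrow> \<zeta> k (f x) = exp (l k x)" for k x
    by blast
  define F where "F x = (\<chi> k. Im (l k x) / (2 * pi))" for x
  show thesis
  proof (rule that[of F])
    show "continuous_on S F" unfolding F_def using l(1) by (intro continuous_intros) auto
    fix x assume x: "x \<in> S"
    have "F x $ k - torus_rep (f x) $ k \<in> \<int>" for k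
    proof -
      have eq: "cis (2 * pi * torus_rep (f x) $ k) = exp (Re (l k x)) *\<^sub>R cis (Im (l k x))"
        using l(2)[OF x, of k] exp_eq_polar[of "l k x"] by (simp add: \<zeta>_def scaleR_conv_of_real)
      then have "cmod (exp (Re (l k x)) *\<^sub>R cis (Im (l k x))) = 1" by (metis norm_cis)
      then have "exp (Re (l k x)) = 1" by simp
      with eq have "cis (Im (l k x)) = cis (2 * pi * torus_rep (f x) $ k)" by simp
      then have "sin (Im (l k x)) = sin (2 * pi * torus_rep (f x) $ k)"
        "cos (Im (l k x)) = cos (2 * pi * torus_rep (f x) $ k)"
        by (simp_all add: complex_eq_iff)
      then obtain n :: int where "Im (l k x) = 2 * pi * torus_rep (f x) $ k + 2 * pi * n"
        using sin_cos_eq_iff by blast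
      then have "F x $ k - torus_rep (f x) $ k = of_int n" by (simp add: F_def field_simps)
      then show ?thesis by simp
    qed
    then have "torus_proj (F x) = torus_proj (torus_rep (f x))"
      unfolding torus_proj_eq_iff by (simp add: integer_lattice_def)
    then show "torus_proj (F x) = f x" by simp
  qed
qed

text \<open>Distinct integers are at distance at least 1, so each coordinate is a continuous
  function with discrete range.\<close>

lemma lattice_valued_constant:
  fixes f :: "'a::topological_space \<Rightarrow> real^'n"
  assumes "connected S" "continuous_on S f" "\<And>x. x \<in> S \<Longrightarrow> f x \<in> integer_lattice" "x \<in> S" "y \<in> S"
  shows "f x = f y"
proof -
  have "f x $ k = f y $ k" for k
  proof -
    have "(\<lambda>x. f x $ k) constant_on S"
    proof (rule continuous_discrete_range_constant[OF assms(1)])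
      show "continuous_on S (\<lambda>x. f x $ k)" using assms(2) by (intro continuous_intros)
      fix x assume x: "x \<in> S"
      have "1 \<le> norm (f y $ k - f x $ k)" if y: "y \<in> S" "f y $ k \<noteq> f x $ k" for y
      proof -
        have "f y $ k - f x $ k \<in> \<int>" using assms(3)[OF x] assms(3)[OF y(1)] by (auto simp: integer_lattice_def)
        then obtain n where n: "f y $ k - f x $ k = of_int n" by (auto elim: Ints_cases)
        with y(2) have "n \<noteq> 0" by auto
        then show ?thesis unfolding n by simp
      qed
      then show "\<exists>e>0. \<forall>y. y \<in> S \<and> f y $ k \<noteq> f x $ k \<longrightarrow> e \<le> norm (f y $ k - f x $ k)"
        by (intro exI[of _ 1]) simp
    qed
    then show ?thesis using assms(4,5) unfolding constant_on_def by metis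
  qed
  then show ?thesis by (simp add: vec_eq_iff)
qed

definition edge_lift :: "((nat \<Rightarrow> real) \<Rightarrow> 'n::finite torus) \<Rightarrow> (real \<Rightarrow> real^'n) \<Rightarrow> bool"
  where "edge_lift \<sigma> \<gamma> \<longleftrightarrow> continuous_on {0..1} \<gamma> \<and> (\<forall>t\<in>{0..1}. torus_proj (\<gamma> t) = \<sigma> (simplex_edge t))"

text \<open>The displacement of a lifted edge, corrected by a choice of representatives of its
  endpoints so that it always lies in the lattice; the correction cancels on cycles.\<close>

definition winding :: "((nat \<Rightarrow> real) \<Rightarrow> 'n::finite torus) \<Rightarrow> real^'n"
  where "winding \<sigma> = (let \<gamma> = (SOME \<gamma>. edge_lift \<sigma> \<gamma>)
    in (\<gamma> 1 - torus_rep (\<sigma> (simplex_edge 1))) - (\<gamma> 0 - torus_rep (\<sigma> (simplex_edge 0))))"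

text \<open>Two lifts of an edge differ by a continuous lattice-valued function, hence by a
  constant, which cancels between the endpoints.\<close>

lemma winding_eq:
  assumes "edge_lift \<sigma> \<gamma>"
  shows "winding \<sigma> = (\<gamma> 1 - torus_rep (\<sigma> (simplex_edge 1))) - (\<gamma> 0 - torus_rep (\<sigma> (simplex_edge 0)))"
proof -
  define \<gamma>' where "\<gamma>' = (SOME \<gamma>. edge_lift \<sigma> \<gamma>)"
  have \<gamma>': "edge_lift \<sigma> \<gamma>'" unfolding \<gamma>'_def using assms by (rule someI[where P = "edge_lift \<sigma>"])
  have "\<gamma>' 1 - \<gamma> 1 = \<gamma>' 0 - \<gamma> 0"
  proof (rule lattice_valued_constant[where f = "\<lambda>t. \<gamma>' t - \<gamma> t" and S = "{0..1}"])
    show "continuous_on {0..1} (\<lambda>t. \<gamma>' t - \<gamma> t)"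
      using assms \<gamma>' by (auto simp: edge_lift_def intro: continuous_intros)
    show "\<gamma>' t - \<gamma> t \<in> integer_lattice" if "t \<in> {0..1}" for t
      using assms \<gamma>' that by (simp add: edge_lift_def flip: torus_proj_eq_iff)
  qed auto
  then show ?thesis unfolding winding_def Let_def \<gamma>'_def[symmetric] by (simp add: algebra_simps)
qed

lemma winding_in_lattice:
  assumes "edge_lift \<sigma> \<gamma>"
  shows "winding \<sigma> \<in> integer_lattice"
  unfolding winding_eq[OF assms]
  by (rule integer_lattice_diff) (use assms in \<open>simp_all add: edge_lift_def flip: torus_proj_eq_iff\<close>)

lemma edge_lift_exists:
  assumes "singular_simplex 1 euclidean \<sigma>"
  obtains \<gamma> where "edge_lift \<sigma> \<gamma>"
proof -
  have "continuous_map (top_of_set {0..1}) (subtopology (powertop_real UNIV) (standard_simplex 1)) simplex_edge"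
    unfolding continuous_map_in_subtopology continuous_map_componentwise_UNIV
  proof (intro conjI allI)
    show "continuous_map (top_of_set {0..1}) euclideanreal (\<lambda>x. simplex_edge x k)" for k
      by (cases "k = 0"; cases "k = 1") (auto simp: simplex_edge_def intro!: continuous_intros)
  qed (use simplex_edge_in_simplex in auto)
  moreover have "continuous_map (subtopology (powertop_real UNIV) (standard_simplex 1)) euclidean \<sigma>"
    using assms by (simp add: singular_simplex_def)
  ultimately have "continuous_on {0..1} (\<sigma> \<circ> simplex_edge)"
    using continuous_map_compose continuous_map_iff_continuous by blast
  then obtain \<gamma> where "continuous_on {0..1} \<gamma>" "\<And>t. t \<in> {0..1} \<Longrightarrow> torus_proj (\<gamma> t) = (\<sigma> \<circ> simplex_edge) t"
    by (rule torus_lift_exists[OF convex_real_interval(5)]) (rule that)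
  then have "edge_lift \<sigma> \<gamma>" by (simp add: edge_lift_def)
  then show thesis by (rule that)
qed

definition triangle_point :: "real \<times> real \<Rightarrow> nat \<Rightarrow> real"
  where "triangle_point z = (\<lambda>i. if i = 0 then 1 - fst z - snd z else if i = 1 then fst z else if i = 2 then snd z else 0)"

text \<open>One lift F of the whole triangle restricts to lifts of its three edges. With alternating
  signs the values of F cancel vertex by vertex, and so do the corrections by
  representatives.\<close>

lemma winding_boundary_simplex:
  assumes \<tau>: "singular_simplex 2 euclidean \<tau>"
  shows "winding (singular_face 2 0 \<tau>) - winding (singular_face 2 1 \<tau>) + winding (singular_face 2 2 \<tau>) = 0"
proof -
  define S where "S = {z::real \<times> real. 0 \<le> fst z \<and> 0 \<le> snd z \<and> fst z + snd z \<le> 1}"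
  have "convex S"
    unfolding convex_def S_def
  proof (intro ballI allI impI CollectI conjI)
    fix x y :: "real \<times> real" and u v :: real
    assume x: "x \<in> {z. 0 \<le> fst z \<and> 0 \<le> snd z \<and> fst z + snd z \<le> 1}"
      and y: "y \<in> {z. 0 \<le> fst z \<and> 0 \<le> snd z \<and> fst z + snd z \<le> 1}" and uv: "0 \<le> u" "0 \<le> v" "u + v = 1"
    show "0 \<le> fst (u *\<^sub>R x + v *\<^sub>R y)" "0 \<le> snd (u *\<^sub>R x + v *\<^sub>R y)" using x y uv by auto
    have "u * (fst x + snd x) + v * (fst y + snd y) \<le> u * 1 + v * 1"
      using x y uv by (intro add_mono mult_left_mono) auto
    then show "fst (u *\<^sub>R x + v *\<^sub>R y) + snd (u *\<^sub>R x + v *\<^sub>R y) \<le> 1"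
      using uv by (simp add: algebra_simps)
  qed
  have mem: "triangle_point z \<in> standard_simplex 2" if "z \<in> S" for z
    using that by (auto simp: S_def standard_simplex_def triangle_point_def numeral_2_eq_2)
  have "continuous_map (top_of_set S) (subtopology (powertop_real UNIV) (standard_simplex 2)) triangle_point"
    unfolding continuous_map_in_subtopology continuous_map_componentwise_UNIV
  proof (intro conjI allI)
    show "continuous_map (top_of_set S) euclideanreal (\<lambda>x. triangle_point x k)" for k
      by (cases "k = 0"; cases "k = 1"; cases "k = 2") (auto simp: triangle_point_def intro!: continuous_intros)
  qed (use mem in auto)
  moreover have "continuous_map (subtopology (powertop_real UNIV) (standard_simplex 2)) euclidean \<tau>"
    using \<tau> by (simp add: singular_simplex_def)
  ultimately have "continuous_on S (\<tau> \<circ> triangle_point)"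
    using continuous_map_compose continuous_map_iff_continuous by blast
  then obtain F where F: "continuous_on S F" "\<And>z. z \<in> S \<Longrightarrow> torus_proj (F z) = (\<tau> \<circ> triangle_point) z"
    by (rule torus_lift_exists[OF \<open>convex S\<close>]) (rule that)
  have face: "singular_face 2 k \<tau> (simplex_edge t) = \<tau> (simplical_face k (simplex_edge t))"
    if "t \<in> {0..1}" for k t
    using simplex_edge_in_simplex[OF that] by (simp add: singular_face_def)
  have pts: "simplical_face 0 (simplex_edge t) = triangle_point (1 - t, t)"
    "simplical_face 1 (simplex_edge t) = triangle_point (0, t)"
    "simplical_face 2 (simplex_edge t) = triangle_point (t, 0)" for t
    by (auto simp: simplical_face_def simplex_edge_def triangle_point_def fun_eq_iff)
  have lift: "edge_lift (singular_face 2 k \<tau>) (\<lambda>t. F (p t))"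
    if "\<And>t. simplical_face k (simplex_edge t) = triangle_point (p t)" "continuous_on {0..1} p"
      "\<And>t. t \<in> {0..1} \<Longrightarrow> p t \<in> S" for k p
    unfolding edge_lift_def
  proof
    show "continuous_on {0..1} (\<lambda>t. F (p t))"
      by (rule continuous_on_compose2[OF F(1) that(2)]) (use that(3) in auto)
    show "\<forall>t\<in>{0..1}. torus_proj (F (p t)) = singular_face 2 k \<tau> (simplex_edge t)"
      using F(2)[OF that(3)] face that(1) by simp
  qed
  have l0: "edge_lift (singular_face 2 0 \<tau>) (\<lambda>t. F (1 - t, t))"
    by (rule lift[OF pts(1)]) (auto intro!: continuous_intros simp: S_def)
  have l1: "edge_lift (singular_face 2 1 \<tau>) (\<lambda>t. F (0, t))"
    by (rule lift[OF pts(2)]) (auto intro!: continuous_intros simp: S_def)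
  have l2: "edge_lift (singular_face 2 2 \<tau>) (\<lambda>t. F (t, 0))"
    by (rule lift[OF pts(3)]) (auto intro!: continuous_intros simp: S_def)
  show ?thesis
    unfolding winding_eq[OF l0] winding_eq[OF l1] winding_eq[OF l2] by (simp add: face pts pts(2)[unfolded One_nat_def])
qed

lemma winding_boundary:
  assumes "singular_chain 2 euclidean d"
  shows "chain_sum winding (chain_boundary 2 d) = (0 :: real^'n)"
proof -
  have "chain_boundary 2 d = frag_extend (\<lambda>f. frag_of (singular_face 2 0 f) - frag_of (singular_face 2 1 f)
      + frag_of (singular_face 2 2 f)) d"
    by (simp add: chain_boundary_def numeral_2_eq_2)
  then have "chain_sum winding (chain_boundary 2 d) = chain_sum (\<lambda>f. winding (singular_face 2 0 f)
      - winding (singular_face 2 1 f) + winding (singular_face 2 2 f)) d"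
    by (simp add: chain_sum_frag_extend chain_sum_add chain_sum_diff)
  also have "\<dots> = chain_sum (\<lambda>f. 0 :: real^'n) d"
    using assms by (intro chain_sum_cong winding_boundary_simplex) (auto simp: singular_chain_def)
  finally show ?thesis by (simp add: chain_sum_def)
qed

definition coordinate_loop :: "'n \<Rightarrow> (nat \<Rightarrow> real) \<Rightarrow> 'n::finite torus"
  where "coordinate_loop i = restrict (\<lambda>x. torus_proj (x 1 *\<^sub>R axis i 1)) (standard_simplex 1)"

lemma coordinate_loop_edge: "t \<in> {0..1} \<Longrightarrow> coordinate_loop i (simplex_edge t) = torus_proj (t *\<^sub>R axis i 1)"
  using simplex_edge_in_simplex[of t] by (simp add: coordinate_loop_def) (simp add: simplex_edge_def)

lemma singular_simplex_coordinate_loop: "singular_simplex 1 euclidean (coordinate_loop i)"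
  unfolding singular_simplex_def
proof
  have "continuous_map (powertop_real (UNIV::nat set)) euclideanreal (\<lambda>x. x 1)"
    by (rule continuous_map_product_projection) simp
  moreover have "continuous_map euclideanreal euclidean (\<lambda>t. torus_proj (t *\<^sub>R axis i (1::real)))"
    unfolding continuous_map_iff_continuous2
    by (rule continuous_on_compose2[OF continuous_torus_proj]) (auto intro!: continuous_intros)
  ultimately have "continuous_map (powertop_real (UNIV::nat set)) euclidean ((\<lambda>t. torus_proj (t *\<^sub>R axis i 1)) \<circ> (\<lambda>x. x 1))"
    by (rule continuous_map_compose)
  then have "continuous_map (subtopology (powertop_real UNIV) (standard_simplex 1)) euclidean
      (\<lambda>x. torus_proj (x 1 *\<^sub>R axis i 1))"
    by (intro continuous_map_from_subtopology) (simp add: comp_def)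
  then show "continuous_map (subtopology (powertop_real UNIV) (standard_simplex 1)) euclidean (coordinate_loop i)"
    by (rule continuous_map_eq) (simp add: coordinate_loop_def)
qed (simp add: coordinate_loop_def)

lemma smooth_edge_lift_coordinate_loop: "smooth_edge_lift (coordinate_loop i) (\<lambda>t. t *\<^sub>R axis i 1)"
  unfolding smooth_edge_lift_def
  using smooth_on_linear_map[OF bounded_linear_scaleR_left] by (simp add: coordinate_loop_edge)

lemma torus_proj_axis: "torus_proj (axis i 1) = torus_proj 0"
  unfolding torus_proj_eq_iff using integer_lattice_axis[of 1 i] by simp

lemma winding_coordinate_loop: "winding (coordinate_loop i) = axis i 1"
proof -
  have "edge_lift (coordinate_loop i) (\<lambda>t. t *\<^sub>R axis i 1)"
    unfolding edge_lift_def by (auto intro!: continuous_intros simp: coordinate_loop_edge)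
  from winding_eq[OF this] show ?thesis
    by (simp add: coordinate_loop_edge torus_proj_axis)
qed

lemma coordinate_loop_cycle: "singular_relcycle 1 euclidean {} (frag_of (coordinate_loop i))"
  unfolding singular_cycle
proof
  show "singular_chain 1 euclidean (frag_of (coordinate_loop i))"
    using singular_simplex_coordinate_loop by (simp add: singular_chain_of)
  let ?v = "\<lambda>j::nat. if j = 0 then 1 else 0 :: real"
  have "singular_face 1 0 (coordinate_loop i) = singular_face 1 1 (coordinate_loop i)"
  proof
    fix x
    show "singular_face 1 0 (coordinate_loop i) x = singular_face 1 1 (coordinate_loop i) x"
    proof (cases "x = ?v")
      case True
      show ?thesis
        unfolding True singular_face_1_vertex by (simp add: coordinate_loop_edge torus_proj_axis)
    next
      case False
      then show ?thesis by (simp add: singular_face_def standard_simplex_0)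
    qed
  qed
  then show "chain_boundary 1 (frag_of (coordinate_loop i)) = 0"
    unfolding chain_boundary_1 by simp
qed

section \<open>The group law of first homology on representatives\<close>

lemma homology_class_add:
  assumes "singular_relcycle 1 X {} a" "singular_relcycle 1 X {} b"
  shows "homologous_rel_set 1 X {} a \<otimes>\<^bsub>homology_group 1 X\<^esub> homologous_rel_set 1 X {} b
    = homologous_rel_set 1 X {} (a + b)"
proof -
  have "homologous_rel_set 1 X {} \<in> hom (relcycle_group 1 X {}) (homology_group 1 X)"
    using normal.r_coset_hom_Mod[OF normal_subgroup_singular_relboundary_relcycle[of 1 X "{}"]]
    by (simp add: right_coset_singular_relboundary relative_homology_group_def)
  from hom_mult[OF this, of a b] assms show ?thesis by simp
qed

lemma homology_class_in_carrier:
  "singular_relcycle 1 X {} a \<Longrightarrow> homologous_rel_set 1 X {} a \<in> carrier (homology_group 1 X)"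
  using carrier_relative_homology_group[of 1 X "{}"] by simp

lemma homology_class_zero: "homologous_rel_set 1 X {} 0 = \<one>\<^bsub>homology_group 1 X\<^esub>"
  using one_relative_homology_group[of 1 X "{}"] homologous_rel_eq_relboundary[of 1 X "{}" 0] by simp

lemma homology_class_int_pow:
  assumes a: "singular_relcycle 1 X {} a"
  shows "homologous_rel_set 1 X {} a [^]\<^bsub>homology_group 1 X\<^esub> (z::int)
    = homologous_rel_set 1 X {} (frag_cmul z a)"
proof -
  interpret H: group "homology_group 1 X" by simp
  let ?cls = "homologous_rel_set 1 X {}"
  have cyc: "singular_relcycle 1 X {} (frag_cmul z a)" for z
    using a by (rule singular_relcycle_cmul)
  have car: "?cls (frag_cmul z a) \<in> carrier (homology_group 1 X)" for z
    using homology_class_in_carrier cyc by blast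
  have car1: "?cls a \<in> carrier (homology_group 1 X)" using homology_class_in_carrier a by blast
  have step: "?cls (frag_cmul z a) \<otimes>\<^bsub>homology_group 1 X\<^esub> ?cls a = ?cls (frag_cmul (z + 1) a)" for z
    using homology_class_add[OF cyc a, of z] by (simp add: frag_cmul_distrib)
  show ?thesis
  proof (induction z rule: int_induct[where k = 0])
    case base
    then show ?case using homology_class_zero[of X] by (simp add: int_pow_0)
  next
    case (step1 z)
    have "?cls a [^]\<^bsub>homology_group 1 X\<^esub> (z + 1) = ?cls a [^]\<^bsub>homology_group 1 X\<^esub> z \<otimes>\<^bsub>homology_group 1 X\<^esub> ?cls a"
      using H.int_pow_mult[OF car1, of z 1] car1 by simp
    then show ?case using step1 step by simp
  next
    case (step2 z)
    have "?cls a [^]\<^bsub>homology_group 1 X\<^esub> (z - 1) \<otimes>\<^bsub>homology_group 1 X\<^esub> ?cls a = ?cls a [^]\<^bsub>homology_group 1 X\<^esub> z"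
      using H.int_pow_mult[OF car1, of "z - 1" 1] car1 by simp
    also have "\<dots> = ?cls (frag_cmul (z - 1) a) \<otimes>\<^bsub>homology_group 1 X\<^esub> ?cls a"
      using step2 step[of "z - 1"] by simp
    finally show ?case using car car1 by simp
  qed
qed

lemma homology_class_finprod:
  assumes "finite A" "\<And>j. j \<in> A \<Longrightarrow> singular_relcycle 1 X {} (x j)"
  shows "finprod (homology_group 1 X) (\<lambda>j. homologous_rel_set 1 X {} (x j) [^]\<^bsub>homology_group 1 X\<^esub> (m j :: int)) A
    = homologous_rel_set 1 X {} (\<Sum>j\<in>A. frag_cmul (m j) (x j))"
  using assms
proof (induction A rule: finite_induct)
  case empty
  interpret H: comm_group "homology_group 1 X" by simp
  show ?case using homology_class_zero[of X] H.finprod_empty by simp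
next
  case (insert i A)
  interpret H: comm_group "homology_group 1 X" by simp
  have cyc: "singular_relcycle 1 X {} (frag_cmul (m j) (x j))" if "j \<in> insert i A" for j
    using insert.prems[OF that] by (rule singular_relcycle_cmul)
  have car: "homologous_rel_set 1 X {} (x j) [^]\<^bsub>homology_group 1 X\<^esub> m j \<in> carrier (homology_group 1 X)"
    if "j \<in> insert i A" for j
    using homology_class_in_carrier[OF insert.prems[OF that]] by simp
  have "singular_relcycle 1 X {} (\<Sum>j\<in>A. frag_cmul (m j) (x j))"
    using cyc by (intro singular_relcycle_sum) auto
  then have "homologous_rel_set 1 X {} (x i) [^]\<^bsub>homology_group 1 X\<^esub> m i \<otimes>\<^bsub>homology_group 1 X\<^esub>
      homologous_rel_set 1 X {} (\<Sum>j\<in>A. frag_cmul (m j) (x j))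
    = homologous_rel_set 1 X {} (frag_cmul (m i) (x i) + (\<Sum>j\<in>A. frag_cmul (m j) (x j)))"
    using homology_class_int_pow[OF insert.prems[of i]] homology_class_add[OF cyc[of i]] by simp
  then show ?case
    using insert car by (subst H.finprod_insert) auto
qed

lemma singular_relboundary_sum:
  "(\<And>i. i \<in> I \<Longrightarrow> singular_relboundary p X S (f i)) \<Longrightarrow> singular_relboundary p X S (\<Sum>i\<in>I. f i)"
  by (induction I rule: infinite_finite_induct) (auto intro: singular_relboundary_add)

text \<open>The winding vectors of a basis are the inverse of the matrix expressing the coordinate loops
  in that basis. Hence that inverse is integral, and every basis class is a combination of
  coordinate loops.\<close>

proposition smooth_cycle_in_class:
  fixes \<xi> :: "nat \<Rightarrow> 'n::finite torus chain set"
  assumes basis: "integral_basis (homology_group 1 (euclidean :: 'n torus topology)) CARD('n) \<xi>"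
    and j: "j \<in> {1..CARD('n)}"
  shows "\<exists>c. c \<in> \<xi> j \<and> smooth_chain c"
proof -
  let ?X = "euclidean :: 'n torus topology" and ?d = "CARD('n)"
  let ?cls = "homologous_rel_set 1 ?X {}"
  have "\<forall>j\<in>{1..?d}. \<exists>x. singular_relcycle 1 ?X {} x \<and> \<xi> j = ?cls x"
    using basis carrier_relative_homology_group[of 1 ?X "{}"] by (auto simp: integral_basis_def)
  from bchoice[OF this] obtain x where x: "\<And>j. j \<in> {1..?d} \<Longrightarrow> singular_relcycle 1 ?X {} (x j)"
    "\<And>j. j \<in> {1..?d} \<Longrightarrow> \<xi> j = ?cls (x j)" by blast
  have "\<exists>m. singular_relboundary 1 ?X {} (frag_of (coordinate_loop i) - (\<Sum>j\<in>{1..?d}. frag_cmul (m j) (x j)))" for i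
  proof -
    have "?cls (frag_of (coordinate_loop i)) \<in> carrier (homology_group 1 ?X)"
      by (rule homology_class_in_carrier[OF coordinate_loop_cycle])
    then obtain m :: "nat \<Rightarrow> int" where
      "?cls (frag_of (coordinate_loop i)) = finprod (homology_group 1 ?X) (\<lambda>j. \<xi> j [^]\<^bsub>homology_group 1 ?X\<^esub> m j) {1..?d}"
      using basis unfolding integral_basis_def by blast
    also have "\<dots> = finprod (homology_group 1 ?X) (\<lambda>j. ?cls (x j) [^]\<^bsub>homology_group 1 ?X\<^esub> m j) {1..?d}"
    proof -
      interpret H: comm_group "homology_group 1 ?X" by simp
      have "?cls (x j) [^]\<^bsub>homology_group 1 ?X\<^esub> m j \<in> carrier (homology_group 1 ?X)" if "j \<in> {1..?d}" for j
        using H.int_pow_closed[OF homology_class_in_carrier[OF x(1)[OF that]]] .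
      then show ?thesis
        by (intro H.finprod_cong') (simp_all add: x(2) Pi_def del: One_nat_def)
    qed
    also have "\<dots> = ?cls (\<Sum>j\<in>{1..?d}. frag_cmul (m j) (x j))"
      by (rule homology_class_finprod) (use x in auto)
    finally have "homologous_rel 1 ?X {} (frag_of (coordinate_loop i)) (\<Sum>j\<in>{1..?d}. frag_cmul (m j) (x j))"
      by (simp add: homologous_rel_set_eq)
    then show ?thesis by (auto simp: homologous_rel_def)
  qed
  then have "\<forall>i. \<exists>m. singular_relboundary 1 ?X {} (frag_of (coordinate_loop i) - (\<Sum>j\<in>{1..?d}. frag_cmul (m j) (x j)))"
    by blast
  from choice[OF this] obtain M where M:
    "\<And>i. singular_relboundary 1 ?X {} (frag_of (coordinate_loop i) - (\<Sum>j\<in>{1..?d}. frag_cmul (M i j) (x j)))"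
    by blast
  define W where "W j = chain_sum winding (x j)" for j
  \<comment> \<open>Winding vectors vanish on boundaries, so pairing the relation for the i-th
    coordinate loop with \<open>winding\<close> leaves the i-th unit vector on one side.\<close>
  have MW: "(\<Sum>j\<in>{1..?d}. real_of_int (M i j) *\<^sub>R W j) = axis i 1" for i
  proof -
    from M[of i] obtain d where d: "singular_chain 2 ?X d"
      "chain_boundary 2 d = frag_of (coordinate_loop i) - (\<Sum>j\<in>{1..?d}. frag_cmul (M i j) (x j))"
      unfolding singular_boundary by (auto simp: numeral_2_eq_2)
    have "chain_sum winding (frag_of (coordinate_loop i) - (\<Sum>j\<in>{1..?d}. frag_cmul (M i j) (x j))) = 0"
      using winding_boundary[OF d(1)] by (simp only: d(2))
    then show ?thesis
      by (simp add: chain_sum_diff chain_sum_sum chain_sum_cmul winding_coordinate_loop W_def)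
  qed
  have W: "W j \<in> integer_lattice" if "j \<in> {1..?d}" for j
    unfolding W_def chain_sum_def
  proof (rule integer_lattice_sum)
    fix \<sigma> assume "\<sigma> \<in> Poly_Mapping.keys (x j)"
    then have "singular_simplex 1 ?X \<sigma>"
      using x(1)[OF that] unfolding singular_cycle singular_chain_def by auto
    then obtain \<gamma> where "edge_lift \<sigma> \<gamma>" by (rule edge_lift_exists)
    from winding_in_lattice[OF this]
    show "real_of_int (Poly_Mapping.lookup (x j) \<sigma>) *\<^sub>R winding \<sigma> \<in> integer_lattice"
      by (auto simp: integer_lattice_def)
  qed
  define N where "N j i = \<lfloor>W j $ i\<rfloor>" for j i
  have N: "W j $ i = of_int (N j i)" if "j \<in> {1..?d}" for j i
    using W[OF that] by (auto simp: N_def integer_lattice_def elim: Ints_cases)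
  \<comment> \<open>Basis classes are indexed by numbers, coordinates by \<open>'n\<close>; a
    bijection between the two index sets makes both families of coefficients square
    matrices.\<close>
  obtain \<pi> :: "nat \<Rightarrow> 'n" where \<pi>: "bij_betw \<pi> {1..?d} UNIV"
    using ex_bij_betw_nat_finite_1[of "UNIV::'n set"] by auto
  define \<rho> where "\<rho> = inv_into {1..?d} \<pi>"
  have \<rho>: "\<rho> (\<pi> j) = j" if "j \<in> {1..?d}" for j
    using that \<pi> by (simp add: \<rho>_def bij_betw_def)
  define MM :: "real^'n^'n" where "MM = (\<chi> i k. of_int (M i (\<rho> k)))"
  define NN :: "real^'n^'n" where "NN = (\<chi> k i. W (\<rho> k) $ i)"
  have "MM ** NN = mat 1"
    unfolding vec_eq_iff
  proof (intro allI)
    fix i l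
    have "(MM ** NN) $ i $ l = (\<Sum>k\<in>UNIV. of_int (M i (\<rho> k)) * W (\<rho> k) $ l)"
      by (simp add: MM_def NN_def matrix_matrix_mult_def)
    also have "\<dots> = (\<Sum>j\<in>{1..?d}. of_int (M i (\<rho> (\<pi> j))) * W (\<rho> (\<pi> j)) $ l)"
      by (rule sum.reindex_bij_betw[OF \<pi>, symmetric])
    also have "\<dots> = (\<Sum>j\<in>{1..?d}. real_of_int (M i j) *\<^sub>R W j) $ l"
      using \<rho> by (simp add: sum_component)
    also have "\<dots> = mat 1 $ i $ l" unfolding MW by (auto simp: axis_def mat_def)
    finally show "(MM ** NN) $ i $ l = mat 1 $ i $ l" .
  qed
  \<comment> \<open>Here the number of basis classes equals the dimension: for square matrices a
    right inverse is a left inverse. The rows of NN are lattice vectors, so its entries can serve as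
    coefficients of a chain.\<close>
  then have NM: "NN ** MM = mat 1" using matrix_left_right_inverse by blast
  have NM': "(\<Sum>i\<in>UNIV. N j i * M i k) = (if j = k then 1 else 0)" if "j \<in> {1..?d}" "k \<in> {1..?d}" for j k
  proof -
    have "(NN ** MM) $ \<pi> j $ \<pi> k = (\<Sum>i\<in>UNIV. W j $ i * of_int (M i k))"
      using that \<rho> by (simp add: MM_def NN_def matrix_matrix_mult_def)
    also have "\<dots> = of_int (\<Sum>i\<in>UNIV. N j i * M i k)" using N[OF that(1)] by simp
    finally have "real_of_int (\<Sum>i\<in>UNIV. N j i * M i k) = mat 1 $ \<pi> j $ \<pi> k" using NM by simp
    also have "\<dots> = real_of_int (if j = k then 1 else 0)"
      using inj_on_eq_iff[OF bij_betw_imp_inj_on[OF \<pi>] that] by (simp add: mat_def)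
    finally show ?thesis by (simp only: of_int_eq_iff)
  qed
  \<comment> \<open>The combination of coordinate loops with coefficients from row j of N. Replacing
    each loop by its expression in the x k gives the product N M, the identity, so y is homologous
    to \<open>x j\<close>.\<close>
  define y where "y = (\<Sum>i\<in>(UNIV::'n set). frag_cmul (N j i) (frag_of (coordinate_loop i)))"
  have "(\<Sum>i\<in>UNIV. frag_cmul (N j i) (\<Sum>k\<in>{1..?d}. frag_cmul (M i k) (x k)))
      = (\<Sum>k\<in>{1..?d}. \<Sum>i\<in>UNIV. frag_cmul (N j i * M i k) (x k))"
    by (simp add: frag_cmul_sum sum.swap[of _ _ UNIV])
  also have "\<dots> = (\<Sum>k\<in>{1..?d}. frag_cmul (\<Sum>i\<in>UNIV. N j i * M i k) (x k))"
  proof -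
    have "frag_cmul (sum f I) c = (\<Sum>i\<in>I. frag_cmul (f i) c)" for f :: "'n \<Rightarrow> int" and I and c :: "'n torus chain"
      by (induction I rule: infinite_finite_induct) (simp_all add: frag_cmul_distrib)
    then show ?thesis by simp
  qed
  also have "\<dots> = (\<Sum>k\<in>{1..?d}. if j = k then x k else 0)"
    by (rule sum.cong[OF refl]) (simp add: NM'[OF j])
  also have "\<dots> = x j" using j by simp
  finally have xj: "(\<Sum>i\<in>UNIV. frag_cmul (N j i) (\<Sum>k\<in>{1..?d}. frag_cmul (M i k) (x k))) = x j" .
  have "singular_relboundary 1 ?X {} (\<Sum>i\<in>UNIV. frag_cmul (N j i)
      (frag_of (coordinate_loop i) - (\<Sum>k\<in>{1..?d}. frag_cmul (M i k) (x k))))"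
    by (intro singular_relboundary_sum singular_relboundary_cmul M)
  also have "(\<Sum>i\<in>UNIV. frag_cmul (N j i) (frag_of (coordinate_loop i) - (\<Sum>k\<in>{1..?d}. frag_cmul (M i k) (x k)))) = y - x j"
  proof -
    have "frag_cmul z (a - b) = frag_cmul z a - frag_cmul z b" for z and a b :: "'n torus chain"
      by (metis add_diff_cancel diff_add_cancel frag_cmul_distrib2)
    then show ?thesis using xj by (simp add: sum_subtractf y_def)
  qed
  finally have "homologous_rel 1 ?X {} y (x j)" by (simp add: homologous_rel_def)
  then have "homologous_rel 1 ?X {} (x j) y" by (subst homologous_rel_sym)
  then have "y \<in> \<xi> j" using x(2)[OF j] by simp
  moreover have "smooth_chain y"
    unfolding smooth_chain_def
  proof
    fix \<sigma> assume "\<sigma> \<in> Poly_Mapping.keys y"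
    then obtain i where "\<sigma> = coordinate_loop i"
      using keys_sum[of "\<lambda>i. frag_cmul (N j i) (frag_of (coordinate_loop i))" "UNIV::'n set"]
      unfolding y_def by (auto simp: keys_frag_of)
    then show "\<exists>\<gamma>. smooth_edge_lift \<sigma> \<gamma>" using smooth_edge_lift_coordinate_loop by blast
  qed
  ultimately show ?thesis by blast
qed

text \<open>Fundamental theorem of calculus along the chosen lift. The result keeps that choice
  explicit, so that one lift can serve several forms at once.\<close>

lemma simplex_integral_potential:
  assumes \<sigma>: "smooth_edge_lift \<sigma> \<gamma>0"
    and G: "\<And>x. (G has_derivative (\<lambda>v. tpull \<alpha> x \<bullet> v)) (at x)"
  shows "simplex_integral \<alpha> \<sigma> = G ((SOME \<gamma>. smooth_edge_lift \<sigma> \<gamma>) 1) - G ((SOME \<gamma>. smooth_edge_lift \<sigma> \<gamma>) 0)"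
proof -
  define \<gamma> where "\<gamma> = (SOME \<gamma>. smooth_edge_lift \<sigma> \<gamma>)"
  have "smooth_edge_lift \<sigma> \<gamma>" unfolding \<gamma>_def using \<sigma> by (rule someI[where P = "smooth_edge_lift \<sigma>"])
  then have sm: "smooth_on UNIV \<gamma>" by (simp add: smooth_edge_lift_def)
  have \<gamma>': "(\<gamma> has_vector_derivative vector_derivative \<gamma> (at t)) (at t)" for t
  proof -
    have "\<gamma> differentiable (at t)"
      using smooth_on_has_derivative[OF sm UNIV_I] by (rule differentiableI)
    then show ?thesis by (rule vector_derivative_works[THEN iffD1])
  qed
  have "((\<lambda>t. tpull \<alpha> (\<gamma> t) \<bullet> vector_derivative \<gamma> (at t)) has_integral (G (\<gamma> 1) - G (\<gamma> 0))) {0..1}"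
  proof (rule fundamental_theorem_of_calculus)
    fix t :: real
    from has_derivative_compose[OF \<gamma>'[of t, unfolded has_vector_derivative_def] G]
    have "((\<lambda>t. G (\<gamma> t)) has_vector_derivative tpull \<alpha> (\<gamma> t) \<bullet> vector_derivative \<gamma> (at t)) (at t)"
      by (simp add: has_vector_derivative_def)
    then show "((\<lambda>t. G (\<gamma> t)) has_vector_derivative tpull \<alpha> (\<gamma> t) \<bullet> vector_derivative \<gamma> (at t)) (at t within {0..1})"
      by (rule has_vector_derivative_at_within)
  qed simp
  then show ?thesis
    unfolding simplex_integral_def Let_def \<gamma>_def[symmetric] by (rule integral_unique)
qed

text \<open>A relation between the period vectors makes the corresponding combination of the forms exact,
  so that its integrals over cycles vanish.\<close>

proposition periods_independent:
  fixes \<alpha> :: "nat \<Rightarrow> 'n::finite torus \<Rightarrow> real^'n" and G :: "nat \<Rightarrow> real^'n \<Rightarrow> real"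
  assumes basis: "integral_basis (homology_group 1 (euclidean :: 'n torus topology)) CARD('n) \<xi>"
    and dual: "dual_basis CARD('n) \<xi> \<alpha>"
    and G: "\<And>k x. k \<in> {1..CARD('n)} \<Longrightarrow> (G k has_derivative (\<lambda>v. tpull (\<alpha> k) x \<bullet> v)) (at x)"
    and shift: "\<And>k m x. k \<in> {1..CARD('n)} \<Longrightarrow> m \<in> integer_lattice \<Longrightarrow> G k (x + m) = G k x + a k \<bullet> m"
    and t: "(\<Sum>k\<in>{1..CARD('n)}. t k *\<^sub>R a k) = 0" and j: "j \<in> {1..CARD('n)}"
  shows "t j = 0"
proof -
  let ?X = "euclidean :: 'n torus topology" and ?K = "{1..CARD('n)}"
  \<comment> \<open>The representative chosen in \<open>class_integral\<close> depends only on the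
    class, so all forms \<open>\<alpha> k\<close> are integrated over the same chain c.\<close>
  define c where "c = (SOME c. c \<in> \<xi> j \<and> smooth_chain c)"
  have c: "c \<in> \<xi> j" "smooth_chain c"
    unfolding c_def using someI_ex[OF smooth_cycle_in_class[OF basis j]] by blast+
  have "\<xi> j \<in> carrier (homology_group 1 ?X)" using basis j by (simp add: integral_basis_def)
  then obtain b where b: "singular_relcycle 1 ?X {} b" "homologous_rel 1 ?X {} b c"
    using c(1) carrier_relative_homology_group[of 1 ?X "{}"] by auto
  then have "singular_relcycle 1 ?X {} c" using homologous_rel_singular_relcycle by blast
  then have bd: "chain_boundary 1 c = 0" by (simp add: singular_cycle)
  define S where "S x = (\<Sum>k\<in>?K. t k * G k x)" for x
  have S: "S (x + m) = S x" if "m \<in> integer_lattice" for x m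
  proof -
    have "S (x + m) = S x + (\<Sum>k\<in>?K. t k * (a k \<bullet> m))"
      using shift that by (simp add: S_def distrib_left sum.distrib)
    also have "(\<Sum>k\<in>?K. t k * (a k \<bullet> m)) = (\<Sum>k\<in>?K. t k *\<^sub>R a k) \<bullet> m"
      by (simp add: inner_sum_left)
    finally show ?thesis using t by simp
  qed
  \<comment> \<open>The combined potential S is periodic, hence a function on the torus. Edge
    integrals thus become differences of its endpoint values, and these cancel on a cycle.\<close>
  have Sp: "S x = S (torus_rep (torus_proj x))" for x
  proof -
    have "torus_rep (torus_proj x) - x \<in> integer_lattice" using torus_proj_eq_iff torus_proj_rep by blast
    from S[OF this, of x] show ?thesis by simp
  qed
  have "(\<Sum>k\<in>?K. t k * class_integral (\<alpha> k) (\<xi> j)) = (\<Sum>k\<in>?K. t k * chain_sum (simplex_integral (\<alpha> k)) c)"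
    by (simp add: class_integral_def c_def[symmetric] chain_integral_def chain_sum_def)
  also have "\<dots> = chain_sum (\<lambda>\<sigma>. \<Sum>k\<in>?K. t k * simplex_integral (\<alpha> k) \<sigma>) c"
    unfolding chain_sum_def by (simp add: sum_distrib_left mult_ac) (rule sum.swap)
  also have "\<dots> = chain_sum (\<lambda>\<sigma>. S (torus_rep (\<sigma> (simplex_edge 1))) - S (torus_rep (\<sigma> (simplex_edge 0)))) c"
  proof (rule chain_sum_cong)
    fix \<sigma> assume "\<sigma> \<in> Poly_Mapping.keys c"
    then obtain \<gamma>0 where \<gamma>0: "smooth_edge_lift \<sigma> \<gamma>0" using c(2) unfolding smooth_chain_def by blast
    define \<gamma> where "\<gamma> = (SOME \<gamma>. smooth_edge_lift \<sigma> \<gamma>)"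
    have \<gamma>: "smooth_edge_lift \<sigma> \<gamma>" unfolding \<gamma>_def using \<gamma>0 by (rule someI[where P = "smooth_edge_lift \<sigma>"])
    have "(\<Sum>k\<in>?K. t k * simplex_integral (\<alpha> k) \<sigma>) = S (\<gamma> 1) - S (\<gamma> 0)"
      using simplex_integral_potential[OF \<gamma>0 G]
      by (simp add: S_def \<gamma>_def right_diff_distrib sum_subtractf)
    then show "(\<Sum>k\<in>?K. t k * simplex_integral (\<alpha> k) \<sigma>)
        = S (torus_rep (\<sigma> (simplex_edge 1))) - S (torus_rep (\<sigma> (simplex_edge 0)))"
      using \<gamma> Sp[of "\<gamma> 1"] Sp[of "\<gamma> 0"] by (simp add: smooth_edge_lift_def)
  qed
  also have "\<dots> = 0" by (rule cycle_sum_endpoints[OF bd])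
  finally have "(\<Sum>k\<in>?K. t k * class_integral (\<alpha> k) (\<xi> j)) = 0" .
  moreover have "(\<Sum>k\<in>?K. t k * class_integral (\<alpha> k) (\<xi> j)) = (\<Sum>k\<in>?K. if k = j then t k else 0)"
    using dual j by (intro sum.cong refl) (auto simp: dual_basis_def)
  ultimately show ?thesis using j by simp
qed

section \<open>Isometry of flat tori with equal ground state energies\<close>

lemma flat_metric_coordinates:
  assumes "flat_metric h"
  obtains B \<Psi> \<Theta> where "flat_coordinates h B \<Psi> \<Theta>"
proof -
  interpret flat_torus_space "\<lambda>x v w. v \<bullet> (tpull h x *v w)"
    by (rule flat_torus_space_tpull[OF assms])
  obtain \<Psi> \<Theta> B :: "real^'a \<Rightarrow> real^'a" where N: "linear B" "bij B" "smooth_on UNIV \<Psi>" "smooth_on UNIV \<Theta>"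
    "\<And>x. \<Theta> (\<Psi> x) = x" "\<And>y. \<Psi> (\<Theta> y) = y"
    "\<And>m x. m \<in> integer_lattice \<Longrightarrow> \<Psi> (x + m) = \<Psi> x + m"
    "\<And>x. bij (frechet_derivative \<Psi> (at x))"
    "\<And>x v w. B (frechet_derivative \<Psi> (at x) v) \<bullet> B (frechet_derivative \<Psi> (at x) w) = v \<bullet> (tpull h x *v w)"
    "\<And>y v. frechet_derivative \<Psi> (at (\<Theta> y)) (frechet_derivative \<Theta> (at y) v) = v"
    by (rule normal_form) (rule that)
  have "flat_coordinates h B \<Psi> \<Theta>" by (rule flat_coordinates.intro) (fact N)+
  then show thesis by (rule that)
qed

text \<open>The case j = k gives the norms of the \<open>a j\<close>, since \<open>a j + a j\<close>
  is twice \<open>a j\<close>; the remaining cases then give the mixed inner products by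
  polarisation. As many independent vectors as the dimension span the space, and agreement extends
  bilinearly.\<close>

lemma quadratic_forms_eq_on_basis:
  fixes L M :: "real^'n \<Rightarrow> real^'n" and a :: "nat \<Rightarrow> real^'n"
  assumes lin: "linear L" "linear M"
    and indep: "\<And>t j. (\<Sum>k\<in>{1..CARD('n)}. t k *\<^sub>R a k) = 0 \<Longrightarrow> j \<in> {1..CARD('n)} \<Longrightarrow> t j = 0"
    and eq: "\<And>j k. 1 \<le> j \<Longrightarrow> j \<le> k \<Longrightarrow> k \<le> CARD('n) \<Longrightarrow> norm (L (a j + a k)) = norm (M (a j + a k))"
  shows "L x \<bullet> L y = M x \<bullet> M y"
proof -
  let ?K = "{1..CARD('n)}"
  have inj: "inj_on a ?K"
  proof (rule inj_onI, rule ccontr)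
    fix i j assume ij: "i \<in> ?K" "j \<in> ?K" "a i = a j" "i \<noteq> j"
    have "(\<Sum>k\<in>?K. ((if k = i then 1 else 0) - (if k = j then 1 else 0)) *\<^sub>R a k) = a i - a j"
      using ij(1,2) by (simp add: scaleR_left_diff_distrib sum_subtractf if_distrib[of "\<lambda>r. r *\<^sub>R _"] cong: if_cong)
    then have "(\<Sum>k\<in>?K. ((if k = i then 1 else 0) - (if k = j then 1 else 0)) *\<^sub>R a k) = 0"
      using ij(3) by simp
    from indep[OF this ij(1)] show False using ij(4) by simp
  qed
  have "independent (a ` ?K)"
    unfolding independent_explicit_finite_subsets
  proof (intro allI impI ballI)
    fix S u v assume S: "S \<subseteq> a ` ?K" "finite S" "(\<Sum>v\<in>S. u v *\<^sub>R v) = 0" "v \<in> S"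
    \<comment> \<open>A relation among vectors in the image of a is pulled back to coefficients on
      the index set, with 0 where the vector lies outside S.\<close>
    let ?t = "\<lambda>k. if a k \<in> S then u (a k) else 0"
    have "(\<Sum>k\<in>?K. ?t k *\<^sub>R a k) = (\<Sum>v\<in>a ` ?K. (if v \<in> S then u v else 0) *\<^sub>R v)"
      by (subst sum.reindex[OF inj]) (simp add: comp_def)
    also have "\<dots> = (\<Sum>v\<in>S. u v *\<^sub>R v)"
      using S(1) by (intro sum.mono_neutral_cong_right) auto
    finally have "(\<Sum>k\<in>?K. ?t k *\<^sub>R a k) = 0" using S(3) by simp
    moreover obtain j where "j \<in> ?K" "v = a j" using S(1,4) by blast
    ultimately show "u v = 0" using indep[of ?t j] S(4) by simp
  qed
  moreover have "card (a ` ?K) = DIM(real^'n)" using card_image[OF inj] by simp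
  ultimately have span: "span (a ` ?K) = UNIV"
    using card_ge_dim_independent[of "a ` ?K" UNIV] by auto
  have eq': "norm (L (a j + a k)) = norm (M (a j + a k))" if "j \<in> ?K" "k \<in> ?K" for j k
  proof (cases "j \<le> k")
    case True
    then show ?thesis using eq[of j k] that by simp
  next
    case False
    then show ?thesis using eq[of k j] that by (simp add: add.commute)
  qed
  have n: "(norm (L (a j)))\<^sup>2 = (norm (M (a j)))\<^sup>2" if "j \<in> ?K" for j
  proof -
    have "a j + a j = 2 *\<^sub>R a j" by (simp add: scaleR_2)
    then show ?thesis using eq'[OF that that] by (simp add: linear_cmul[OF lin(1)] linear_cmul[OF lin(2)])
  qed
  have on_basis: "L u \<bullet> L v = M u \<bullet> M v" if "u \<in> a ` ?K" "v \<in> a ` ?K" for u v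
  proof -
    from that obtain j k where jk: "j \<in> ?K" "k \<in> ?K" "u = a j" "v = a k" by blast
    have "(norm (L (a j + a k)))\<^sup>2 = (norm (M (a j + a k)))\<^sup>2" using eq'[OF jk(1,2)] by simp
    then have "(norm (L u))\<^sup>2 + 2 * (L u \<bullet> L v) + (norm (L v))\<^sup>2 = (norm (M u))\<^sup>2 + 2 * (M u \<bullet> M v) + (norm (M v))\<^sup>2"
      unfolding jk(3,4)[symmetric] linear_add[OF lin(1)] linear_add[OF lin(2)]
      by (simp add: power2_norm_eq_inner inner_add_left inner_add_right inner_commute[of "L v" "L u"]
          inner_commute[of "M v" "M u"] algebra_simps)
    then show ?thesis using n[OF jk(1)] n[OF jk(2)] jk(3,4) by simp
  qed
  have "bilinear (\<lambda>x y. L x \<bullet> L y)" "bilinear (\<lambda>x y. M x \<bullet> M y)"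
    unfolding bilinear_def
    by (auto intro!: linearI simp: linear_add[OF lin(1)] linear_add[OF lin(2)] linear_cmul[OF lin(1)]
        linear_cmul[OF lin(2)] inner_add_left inner_add_right)
  from bilinear_eq[OF this, of UNIV "a ` ?K" UNIV "a ` ?K"] show ?thesis
    using span on_basis by auto
qed

text \<open>The form of L is the inverse of the Gram form of B, and forms with equal inverses are
  equal. Without matrices: if x satisfies \<open>A.L x = B v\<close>, duality gives
  \<open>A0.L x = B0 v\<close> for the same x.\<close>

lemma flat_coordinates_gram_eq:
  assumes "flat_coordinates h B \<Psi> \<Theta>" "flat_coordinates h0 B0 \<Psi>0 \<Theta>0"
    and eq: "\<And>x y. flat_coordinates.L B x \<bullet> flat_coordinates.L B y
      = flat_coordinates.L B0 x \<bullet> flat_coordinates.L B0 y"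
  shows "B v \<bullet> B w = B0 v \<bullet> B0 w"
proof -
  interpret A: flat_coordinates h B \<Psi> \<Theta> by fact
  interpret A0: flat_coordinates h0 B0 \<Psi>0 \<Theta>0 by fact
  have "surj A.L" using linear_injective_imp_surjective[OF A.linear_L A.inj_L] by simp
  then obtain x where x: "A.L x = B v" by (metis surjD)
  have "B0 v = A0.L x"
  proof -
    have "y \<bullet> inv_into UNIV B0 (A0.L x) = y \<bullet> v" for y
      using A0.L_inner[of y "A0.L x"] eq[of y x] A.L_adjoint_B[of y v] x by simp
    then have "inv_into UNIV B0 (A0.L x) = v" by (metis vector_eq_ldot)
    then show ?thesis using A0.B_inverse(1)[of "A0.L x"] by simp
  qed
  then show ?thesis using A.L_adjoint_B[of x w] A0.L_adjoint_B[of x w] x by simp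
qed

lemma transition_map_properties:
  assumes "flat_coordinates h B \<Psi> \<Theta>" "flat_coordinates h0 B0 \<Psi>0 \<Theta>0"
  shows "smooth_on UNIV (\<lambda>x. \<Theta>0 (\<Psi> x))" "m \<in> integer_lattice \<Longrightarrow> \<Theta>0 (\<Psi> (x + m)) = \<Theta>0 (\<Psi> x) + m"
proof -
  interpret A: flat_coordinates h B \<Psi> \<Theta> by fact
  interpret A0: flat_coordinates h0 B0 \<Psi>0 \<Theta>0 by fact
  show "smooth_on UNIV (\<lambda>x. \<Theta>0 (\<Psi> x))"
    by (rule smooth_on_compose[OF open_UNIV open_UNIV _ A0.smooth(2) A.smooth(1)]) simp
  show "m \<in> integer_lattice \<Longrightarrow> \<Theta>0 (\<Psi> (x + m)) = \<Theta>0 (\<Psi> x) + m"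
    by (simp add: A.equivariant A0.\<Theta>_equivariant)
qed

lemma torus_proj_descend:
  assumes "\<And>m x. m \<in> integer_lattice \<Longrightarrow> F (x + m) = F x + m"
  shows "torus_proj (F (torus_rep (torus_proj x))) = torus_proj (F x)"
proof -
  have m: "torus_rep (torus_proj x) - x \<in> integer_lattice"
    using torus_proj_eq_iff torus_proj_rep by blast
  have "F (torus_rep (torus_proj x)) - F x = torus_rep (torus_proj x) - x"
    using assms[OF m, of x] by simp
  then show ?thesis using m by (simp add: torus_proj_eq_iff)
qed

proposition flat_coordinates_isometric:
  fixes h h0 :: "'n::finite torus \<Rightarrow> real^'n^'n"
  assumes A: "flat_coordinates h B \<Psi> \<Theta>" and A0: "flat_coordinates h0 B0 \<Psi>0 \<Theta>0"
    and gram: "\<And>v w. B v \<bullet> B w = B0 v \<bullet> B0 w"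
  shows "isometric_metrics h h0"
proof -
  interpret A: flat_coordinates h B \<Psi> \<Theta> by fact
  interpret A0: flat_coordinates h0 B0 \<Psi>0 \<Theta>0 by fact
  define \<Phi> where "\<Phi> x = \<Theta>0 (\<Psi> x)" for x
  define \<Phi>' where "\<Phi>' x = \<Theta> (\<Psi>0 x)" for x
  define \<phi> where "\<phi> p = torus_proj (\<Phi> (torus_rep p))" for p
  define \<phi>' where "\<phi>' p = torus_proj (\<Phi>' (torus_rep p))" for p
  have inv: "\<Phi>' (\<Phi> x) = x" "\<Phi> (\<Phi>' x) = x" for x
    by (simp_all add: \<Phi>_def \<Phi>'_def A.inverse A0.inverse)
  have sm: "smooth_on UNIV \<Phi>" "smooth_on UNIV \<Phi>'"
    unfolding \<Phi>_def \<Phi>'_def by (rule transition_map_properties(1)[OF A A0] transition_map_properties(1)[OF A0 A])+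
  have \<phi>: "\<phi> (torus_proj x) = torus_proj (\<Phi> x)" for x
    unfolding \<phi>_def by (rule torus_proj_descend) (simp add: \<Phi>_def transition_map_properties(2)[OF A A0])
  have \<phi>': "\<phi>' (torus_proj x) = torus_proj (\<Phi>' x)" for x
    unfolding \<phi>'_def by (rule torus_proj_descend) (simp add: \<Phi>'_def transition_map_properties(2)[OF A0 A])
  have \<phi>\<phi>': "\<phi>' (\<phi> p) = p" "\<phi> (\<phi>' p) = p" for p
    using \<phi>'[of "\<Phi> (torus_rep p)"] \<phi>[of "\<Phi>' (torus_rep p)"] by (simp_all add: \<phi>_def[of p] \<phi>'_def[of p] inv)
  have bij: "bij \<phi>" by (rule bij_betw_byWitness[where f' = \<phi>']) (auto simp: \<phi>\<phi>')
  have "inv_into UNIV \<phi> = \<phi>'"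
    using \<phi>\<phi>' by (intro ext) (metis bij bij_inv_eq_iff)
  moreover have "torus_smooth_map \<phi>" "torus_smooth_map \<phi>'"
    unfolding torus_smooth_map_def torus_lift_def using sm \<phi> \<phi>' by blast+
  ultimately have diffeo: "torus_diffeomorphism \<phi>"
    unfolding torus_diffeomorphism_def using bij by simp
  have metric: "frechet_derivative \<Phi> (at y) v \<bullet> (tpull h0 (\<Phi> y) *v frechet_derivative \<Phi> (at y) w)
      = v \<bullet> (tpull h y *v w)" for y v w
  proof -
    have "(\<Theta>0 has_derivative frechet_derivative \<Theta>0 (at (\<Psi> y))) (at (\<Psi> y))"
      using smooth_on_has_derivative[OF A0.smooth(2)] by simp
    from has_derivative_compose[OF A.\<Psi>_derivative this]
    have D: "frechet_derivative \<Phi> (at y) = (\<lambda>v. frechet_derivative \<Theta>0 (at (\<Psi> y)) (frechet_derivative \<Psi> (at y) v))"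
      by (simp add: \<Phi>_def[abs_def] frechet_derivative_at[symmetric])
    have "frechet_derivative \<Psi>0 (at (\<Phi> y)) (frechet_derivative \<Phi> (at y) v) = frechet_derivative \<Psi> (at y) v" for v
      unfolding D \<Phi>_def by (rule A0.inverse_derivative)
    then show ?thesis
      unfolding A0.metric[symmetric] A.metric[symmetric] by (simp add: gram)
  qed
  have "torus_isometry h h0 \<phi>"
    unfolding torus_isometry_def
  proof (intro conjI diffeo allI impI ballI)
    fix U F y v w assume lift: "torus_lift \<phi> U F" and y: "y \<in> U"
    have U: "open U" "smooth_on U F" "\<And>z. z \<in> U \<Longrightarrow> torus_proj (F z) = torus_proj (\<Phi> z)"
      using lift \<phi> by (auto simp: torus_lift_def)
    obtain r where r: "r > 0" "ball y r \<subseteq> U" using U(1) y open_contains_ball by blast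
    have m: "F z - \<Phi> z \<in> integer_lattice" if "z \<in> U" for z
      using U(3)[OF that] by (simp add: torus_proj_eq_iff)
    \<comment> \<open>\<open>torus_isometry\<close> quantifies over all local lifts. An arbitrary
      lift F differs from \<Phi> by a continuous lattice-valued function, which is constant near y,
      so both have the same derivative there.\<close>
    have const: "F z - \<Phi> z = F y - \<Phi> y" if "z \<in> ball y r" for z
    proof (rule lattice_valued_constant[where f = "\<lambda>z. F z - \<Phi> z" and S = "ball y r"])
      show "continuous_on (ball y r) (\<lambda>z. F z - \<Phi> z)"
        using r(2) smooth_on_imp_continuous_on[OF U(2)] smooth_on_imp_continuous_on[OF sm(1)]
        by (intro continuous_intros) (auto intro: continuous_on_subset)
    qed (use that r m in auto)
    have "((\<lambda>z. \<Phi> z + (F y - \<Phi> y)) has_derivative frechet_derivative \<Phi> (at y)) (at y)"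
      using smooth_on_has_derivative[OF sm(1), of y] by (auto intro!: derivative_eq_intros)
    then have "(F has_derivative frechet_derivative \<Phi> (at y)) (at y)"
    proof (rule has_derivative_transform_within_open[OF _ open_ball])
      show "y \<in> ball y r" using r by simp
      show "\<Phi> z + (F y - \<Phi> y) = F z" if "z \<in> ball y r" for z
        using const[OF that] by (simp add: algebra_simps)
    qed
    then have "frechet_derivative F (at y) = frechet_derivative \<Phi> (at y)"
      by (simp add: frechet_derivative_at[symmetric])
    moreover have "tpull h0 (F y) = tpull h0 (\<Phi> y)" using U(3)[OF y] by (simp add: tpull_def)
    ultimately show "frechet_derivative F (at y) v \<bullet> (tpull h0 (F y) *v frechet_derivative F (at y) w)
        = v \<bullet> (tpull h y *v w)"
      using metric by simp
  qed
  then show ?thesis unfolding isometric_metrics_def by blast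
qed

text \<open>Potentials and period vectors add, which brings the sums of two dual forms into the
  setting of \<open>flat_coordinates_form\<close>.\<close>

lemma closed_one_form_add:
  assumes \<alpha>: "smooth_on UNIV G1" "\<And>x. (G1 has_derivative (\<lambda>v. tpull \<alpha> x \<bullet> v)) (at x)"
    "\<And>m x. m \<in> integer_lattice \<Longrightarrow> G1 (x + m) = G1 x + a \<bullet> m"
    and \<beta>: "smooth_on UNIV G2" "\<And>x. (G2 has_derivative (\<lambda>v. tpull \<beta> x \<bullet> v)) (at x)"
    "\<And>m x. m \<in> integer_lattice \<Longrightarrow> G2 (x + m) = G2 x + b \<bullet> m"
    and A: "flat_coordinates h B \<Psi> \<Theta>"
  shows "flat_coordinates_form h B \<Psi> \<Theta> (\<lambda>p. \<alpha> p + \<beta> p) (\<lambda>x. G1 x + G2 x) (a + b)"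
proof -
  interpret A: flat_coordinates h B \<Psi> \<Theta> by fact
  show ?thesis
  proof
    show "smooth_on UNIV (\<lambda>x. G1 x + G2 x)" by (rule smooth_on_add[OF open_UNIV \<alpha>(1) \<beta>(1)])
    show "((\<lambda>x. G1 x + G2 x) has_derivative (\<lambda>v. tpull (\<lambda>p. \<alpha> p + \<beta> p) x \<bullet> v)) (at x)" for x
      using has_derivative_add[OF \<alpha>(2) \<beta>(2), of x] by (simp add: tpull_def inner_add_left)
  qed (simp add: \<alpha>(3) \<beta>(3) inner_add_left)
qed

text \<open>Each energy equals its quadratic expression below a threshold of its own. A single n
  beyond both thresholds allows the common factor 1/n^2 to be cancelled.\<close>

lemma norm_eq_of_ground_state_energies:
  assumes "flat_coordinates_form h B \<Psi> \<Theta> \<beta> G a" "flat_coordinates_form h0 B0 \<Psi>0 \<Theta>0 \<beta> G a"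
    and eq: "\<And>n. 1 \<le> n \<Longrightarrow> ground_state_energy h (\<lambda>p. (1 / real n) *\<^sub>R \<beta> p)
      = ground_state_energy h0 (\<lambda>p. (1 / real n) *\<^sub>R \<beta> p)"
  shows "norm (flat_coordinates.L B a) = norm (flat_coordinates.L B0 a)"
proof -
  interpret A: flat_coordinates_form h B \<Psi> \<Theta> \<beta> G a by fact
  interpret A0: flat_coordinates_form h0 B0 \<Psi>0 \<Theta>0 \<beta> G a by fact
  obtain \<epsilon>1 where \<epsilon>1: "\<epsilon>1 > 0"
    "\<And>e. 0 \<le> e \<Longrightarrow> e \<le> \<epsilon>1 \<Longrightarrow> ground_state_energy h (\<lambda>p. e *\<^sub>R \<beta> p) = e\<^sup>2 * (norm (A.L a))\<^sup>2"
    by (rule A.ground_state_energy_small) (rule that)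
  obtain \<epsilon>2 where \<epsilon>2: "\<epsilon>2 > 0"
    "\<And>e. 0 \<le> e \<Longrightarrow> e \<le> \<epsilon>2 \<Longrightarrow> ground_state_energy h0 (\<lambda>p. e *\<^sub>R \<beta> p) = e\<^sup>2 * (norm (A0.L a))\<^sup>2"
    by (rule A0.ground_state_energy_small) (rule that)
  obtain n where n: "inverse (real (Suc n)) < min \<epsilon>1 \<epsilon>2"
    using reals_Archimedean[of "min \<epsilon>1 \<epsilon>2"] \<epsilon>1(1) \<epsilon>2(1) by auto
  define e where "e = 1 / real (Suc n)"
  have e: "0 < e" "e \<le> \<epsilon>1" "e \<le> \<epsilon>2" using n by (simp_all add: e_def inverse_eq_divide)
  have "e\<^sup>2 * (norm (A.L a))\<^sup>2 = e\<^sup>2 * (norm (A0.L a))\<^sup>2"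
    using eq[of "Suc n"] \<epsilon>1(2)[of e] \<epsilon>2(2)[of e] e unfolding e_def[symmetric] by simp
  then show ?thesis using e(1) by simp
qed

theorem theorem9:
  fixes h h0 :: "'n::finite torus \<Rightarrow> real ^ 'n ^ 'n"
    and \<xi> :: "nat \<Rightarrow> 'n torus chain set"
    and \<alpha> :: "nat \<Rightarrow> 'n torus \<Rightarrow> real ^ 'n"
  assumes "integral_basis (homology_group 1 (euclidean :: 'n torus topology)) CARD('n) \<xi>"
    and "dual_basis CARD('n) \<xi> \<alpha>"
    and "flat_metric h"
    and "flat_metric h0"
    and "\<And>j k n. 1 \<le> j \<Longrightarrow> j \<le> k \<Longrightarrow> k \<le> CARD('n) \<Longrightarrow> 1 \<le> n \<Longrightarrow>
           ground_state_energy h (\<lambda>p. (1 / real n) *\<^sub>R (\<alpha> j p + \<alpha> k p))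
             = ground_state_energy h0 (\<lambda>p. (1 / real n) *\<^sub>R (\<alpha> j p + \<alpha> k p))"
  shows "isometric_metrics h h0"
proof -
  obtain B \<Psi> \<Theta> where A: "flat_coordinates h B \<Psi> \<Theta>" by (rule flat_metric_coordinates[OF assms(3)])
  obtain B0 \<Psi>0 \<Theta>0 where A0: "flat_coordinates h0 B0 \<Psi>0 \<Theta>0" by (rule flat_metric_coordinates[OF assms(4)])
  interpret A: flat_coordinates h B \<Psi> \<Theta> by fact
  interpret A0: flat_coordinates h0 B0 \<Psi>0 \<Theta>0 by fact
  \<comment> \<open>Potential and period vector are chosen together and refer to neither metric, so
    both tori are compared on the same vectors \<open>a k\<close>.\<close>
  have "\<exists>Ga. smooth_on UNIV (fst Ga) \<and> (\<forall>x. (fst Ga has_derivative (\<lambda>v. tpull (\<alpha> k) x \<bullet> v)) (at x)) \<and>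
      (\<forall>m\<in>integer_lattice. \<forall>x. fst Ga (x + m) = fst Ga x + snd Ga \<bullet> m)" if k: "k \<in> {1..CARD('n)}" for k
  proof -
    have "closed_one_form (\<alpha> k)" using assms(2) k by (simp add: dual_basis_def)
    then obtain G a where "smooth_on UNIV G" "\<And>x. (G has_derivative (\<lambda>v. tpull (\<alpha> k) x \<bullet> v)) (at x)"
      "\<And>m x. m \<in> integer_lattice \<Longrightarrow> G (x + m) = G x + a \<bullet> m"
      by (rule closed_one_form_potential) (rule that)
    then show ?thesis by (intro exI[of _ "(G, a)"]) simp
  qed
  then have "\<forall>k\<in>{1..CARD('n)}. \<exists>Ga. smooth_on UNIV (fst Ga) \<and>
      (\<forall>x. (fst Ga has_derivative (\<lambda>v. tpull (\<alpha> k) x \<bullet> v)) (at x)) \<and>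
      (\<forall>m\<in>integer_lattice. \<forall>x. fst Ga (x + m) = fst Ga x + snd Ga \<bullet> m)" by blast
  from bchoice[OF this] obtain Ga where Ga: "\<forall>k\<in>{1..CARD('n)}. smooth_on UNIV (fst (Ga k)) \<and>
      (\<forall>x. (fst (Ga k) has_derivative (\<lambda>v. tpull (\<alpha> k) x \<bullet> v)) (at x)) \<and>
      (\<forall>m\<in>integer_lattice. \<forall>x. fst (Ga k) (x + m) = fst (Ga k) x + snd (Ga k) \<bullet> m)" ..
  define G where "G k = fst (Ga k)" for k
  define a where "a k = snd (Ga k)" for k
  have G: "smooth_on UNIV (G k)" "(G k has_derivative (\<lambda>v. tpull (\<alpha> k) x \<bullet> v)) (at x)"
    "m \<in> integer_lattice \<Longrightarrow> G k (x + m) = G k x + a k \<bullet> m" if "k \<in> {1..CARD('n)}" for k x m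
    using Ga that by (simp_all add: G_def a_def)
  have norm: "norm (A.L (a j + a k)) = norm (A0.L (a j + a k))" if jk: "1 \<le> j" "j \<le> k" "k \<le> CARD('n)" for j k
  proof -
    have K: "j \<in> {1..CARD('n)}" "k \<in> {1..CARD('n)}" using jk by auto
    show ?thesis
      by (rule norm_eq_of_ground_state_energies[OF closed_one_form_add[OF G[OF K(1)] G[OF K(2)] A]
            closed_one_form_add[OF G[OF K(1)] G[OF K(2)] A0] assms(5)[OF jk]])
  qed
  have indep: "t j = 0" if "(\<Sum>k\<in>{1..CARD('n)}. t k *\<^sub>R a k) = 0" "j \<in> {1..CARD('n)}" for t j
    by (rule periods_independent[where G = G and a = a, OF assms(1,2) G(2,3) that])
  have "A.L x \<bullet> A.L y = A0.L x \<bullet> A0.L y" for x y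
    by (rule quadratic_forms_eq_on_basis[where L = A.L and M = A0.L and a = a])
      (use A.linear_L A0.linear_L indep norm in blast)+
  from flat_coordinates_gram_eq[OF A A0 this] show ?thesis
    by (rule flat_coordinates_isometric[OF A A0])
qed

end
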